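(* Let $f,g,h,R$ satisfy the data assumption stated in the context, and let $\Omega\subset\mathbb{R}^N$ be a bounded domain. Let $(u,\Omega)$ be an admissible controller--domain pair with $u\in C^\infty(\Omega,\mathbb{R}^M)$. Let $$v_u(x)=\int_0^\infty\Bigl[h(\mathbf{x}_u(t;x))+\langle u(\mathbf{x}_u(t;x)),R\,u(\mathbf{x}_u(t;x))\rangle\Bigr]\,\mathrm{d}t\quad(x\in\Omega),\qquad u^+(x):=-\tfrac12R^{-1}g(x)^\top\nabla v_u(x).$$ Then: 1. There exists a proper sublevel set $\Omega_c\subset\Omega$ of $v_u$. 2. For every proper sublevel set $\Omega_c\subset\Omega$ of $v_u$, the pair $(u,\Omega_c)$ is an admissible controller--domain pair. 3. For every proper sublevel set $\Omega_c\subset\Omega$ of $v_u$, the pair $(u^+,\Omega_c)$ is an admissible controller--domain pair. (In 2. and 3. the controllers are restricted to $\Omega_c$.)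
   Context: A domain is a non-empty, open and connected subset of $\mathbb{R}^N$; $\|\cdot\|$ is the Euclidean norm; $\operatorname{cl}$ denotes closure; $B_\varepsilon(0)$ is the open ball of radius $\varepsilon$ about $0$. Data assumption: $f\in C^\infty(\mathbb{R}^N,\mathbb{R}^N)$, $g\in C^\infty(\mathbb{R}^N,\mathbb{R}^{N\times M})$, $h\in C^\infty(\mathbb{R}^N,\mathbb{R})$, $R\in\mathbb{R}^{M\times M}$ is symmetric positive-definite, $f(0)=0$, and $h$ is a positive-definite function, i.e. $h(0)=0$ and $h(x)>0$ for $x\ne0$. For a feedback controller $u:\Omega\to\mathbb{R}^M$, $\mathbf{x}_u(t;x)$ denotes the solution of the closed-loop system $\dot{\mathbf{x}}_u(t;x)=f(\mathbf{x}_u(t;x))+g(\mathbf{x}_u(t;x))u(\mathbf{x}_u(t;x))$, $\mathbf{x}_u(0;x)=x$. Admissible controller--domain pair: for a domain $\Omega\subset\mathbb{R}^N$ and $u\in C^0(\Omega,\mathbb{R}^M)$, the pair $(u,\Omega)$ is admissible if (1) $0\in\Omega$; (2) $u(0)=0$; (3) for every $x\in\Omega$, $\mathbf{x}_u(t;x)\in\Omega$ for all $t\ge0$; (4) $\lim_{t\to\infty}\|\mathbf{x}_u(t;x)\|=0$ for all $x\in\Omega$; (5) there exist constants $\varepsilon,C,\nu>0$ with $B_\varepsilon(0)\subset\Omega$ such that $\|\mathbf{x}_u(t;x)\|\le Ce^{-\nu t}\|x\|$ for all $x\in B_\varepsilon(0)$ and $t\ge0$. Proper sublevel set: let $c>0$.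 A bounded domain $\Omega_c\subset\mathbb{R}^N$ is a proper sublevel set of a positive-definite function $V\in C^0(\operatorname{cl}(\Omega_c),\mathbb{R})$ (i.e. $V(0)=0$ and $V>0$ away from $0$) if $V(x)<c$ for every $x\in\Omega_c$ and $V(x)=c$ for every $x\in\partial\Omega_c$. In particular $V$ must be defined and continuous on $\operatorname{cl}(\Omega_c)$, so a proper sublevel set $\Omega_c\subset\Omega$ of a function defined on $\Omega$ satisfies $\operatorname{cl}(\Omega_c)\subset\Omega$. Under the hypotheses of the theorem, $v_u$ is a well-defined, smooth, positive-definite function on $\Omega$. *)

theory Defs
  imports "HOL-Analysis.Analysis"
begin

(* Class C^k on an open set: the function is differentiable and every directional derivative
   is again of class C^(k-1). The derivative is the full one (not "within S"), so the
   definition is only meant for open S. *)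
fun Ck_on :: "nat \<Rightarrow> 'a::real_normed_vector set \<Rightarrow> ('a \<Rightarrow> 'b::real_normed_vector) \<Rightarrow> bool" where
  "Ck_on 0 S f \<longleftrightarrow> continuous_on S f"
| "Ck_on (Suc k) S f \<longleftrightarrow>
     (\<forall>x\<in>S. f differentiable (at x)) \<and>
     (\<forall>v. Ck_on k S (\<lambda>x. frechet_derivative f (at x) v))"

definition smooth_on :: "'a::real_normed_vector set \<Rightarrow> ('a \<Rightarrow> 'b::real_normed_vector) \<Rightarrow> bool" where
  "smooth_on S f \<longleftrightarrow> (\<forall>k. Ck_on k S f)"

definition is_domain :: "'a::topological_space set \<Rightarrow> bool" where
  "is_domain S \<longleftrightarrow> S \<noteq> {} \<and> open S \<and> connected S"

(* V is regarded as a function with domain S; its value at 0 must make sense, hence 0 \<in> S. *)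
definition pos_def_fun_on :: "'a::real_normed_vector set \<Rightarrow> ('a \<Rightarrow> real) \<Rightarrow> bool" where
  "pos_def_fun_on S V \<longleftrightarrow> 0 \<in> S \<and> V 0 = 0 \<and> (\<forall>x\<in>S - {0}. V x > 0)"

definition sym_pos_def_matrix :: "real^'m^'m \<Rightarrow> bool" where
  "sym_pos_def_matrix R \<longleftrightarrow> transpose R = R \<and> (\<forall>w. w \<noteq> 0 \<longrightarrow> w \<bullet> (R *v w) > 0)"

definition grad :: "('a::real_inner \<Rightarrow> real) \<Rightarrow> 'a \<Rightarrow> 'a" where
  "grad V x = (THE D. GDERIV V x :> D)"

definition data_assumption ::
  "(real^'n \<Rightarrow> real^'n) \<Rightarrow> (real^'n \<Rightarrow> real^'m^'n) \<Rightarrow> (real^'n \<Rightarrow> real) \<Rightarrow> real^'m^'m \<Rightarrow> bool" where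
  "data_assumption f g h R \<longleftrightarrow>
     smooth_on UNIV f \<and> smooth_on UNIV g \<and> smooth_on UNIV h \<and>
     sym_pos_def_matrix R \<and> f 0 = 0 \<and> pos_def_fun_on UNIV h"

definition closed_loop ::
  "(real^'n \<Rightarrow> real^'n) \<Rightarrow> (real^'n \<Rightarrow> real^'m^'n) \<Rightarrow> (real^'n \<Rightarrow> real^'m) \<Rightarrow> real^'n \<Rightarrow> real^'n" where
  "closed_loop f g u x = f x + g x *v u x"

(* A vector field F on \<Omega> is represented by a total function whose values outside \<Omega> are
   irrelevant; a solution of x' = F x is therefore a curve with values in \<Omega>. The derivative
   is one-sided at the end points of the time interval I. *)
definition solves ::
  "('a::real_normed_vector \<Rightarrow> 'a) \<Rightarrow> 'a set \<Rightarrow> 'a \<Rightarrow> real set \<Rightarrow> (real \<Rightarrow> 'a) \<Rightarrow> bool" where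
  "solves F \<Omega> x I \<phi> \<longleftrightarrow>
     \<phi> 0 = x \<and>
     (\<forall>t\<in>I. \<phi> t \<in> \<Omega> \<and> (\<phi> has_vector_derivative F (\<phi> t)) (at t within I))"

definition uniquely_solvable :: "('a::real_normed_vector \<Rightarrow> 'a) \<Rightarrow> 'a set \<Rightarrow> 'a \<Rightarrow> bool" where
  "uniquely_solvable F \<Omega> x \<longleftrightarrow>
     (\<exists>\<phi>. solves F \<Omega> x {0..} \<phi> \<and>
          (\<forall>T\<ge>0. \<forall>\<psi>. solves F \<Omega> x {0..T} \<psi> \<longrightarrow> (\<forall>t\<in>{0..T}. \<psi> t = \<phi> t)))"

(* Meaningful only where uniquely_solvable holds; see the next two lemmas. *)
definition trajectory :: "('a::real_normed_vector \<Rightarrow> 'a) \<Rightarrow> 'a set \<Rightarrow> 'a \<Rightarrow> real \<Rightarrow> 'a" where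
  "trajectory F \<Omega> x t = (THE y. \<exists>\<phi>. solves F \<Omega> x {0..t} \<phi> \<and> \<phi> t = y)"

lemma trajectory_eq:
  assumes sol: "solves F \<Omega> x {0..} \<phi>"
    and uniq: "\<And>T \<psi> t. solves F \<Omega> x {0..T} \<psi> \<Longrightarrow> t \<in> {0..T} \<Longrightarrow> \<psi> t = \<phi> t"
    and "t \<ge> 0"
  shows "trajectory F \<Omega> x t = \<phi> t"
proof -
  have "solves F \<Omega> x {0..t} \<phi>"
    unfolding solves_def
  proof (intro conjI ballI)
    fix s assume "s \<in> {0..t}"
    then have "\<phi> s \<in> \<Omega>" "(\<phi> has_vector_derivative F (\<phi> s)) (at s within {0..})"
      using sol by (simp_all add: solves_def)
    then show "\<phi> s \<in> \<Omega>" "(\<phi> has_vector_derivative F (\<phi> s)) (at s within {0..t})"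
      by (auto elim: has_vector_derivative_within_subset)
  qed (use sol in \<open>simp add: solves_def\<close>)
  moreover have "\<psi> t = \<phi> t" if "solves F \<Omega> x {0..t} \<psi>" for \<psi>
    using uniq[OF that] \<open>t \<ge> 0\<close> by simp
  ultimately show ?thesis
    unfolding trajectory_def by blast
qed

lemma uniquely_solvable_trajectory:
  assumes "uniquely_solvable F \<Omega> x"
  shows "solves F \<Omega> x {0..} (trajectory F \<Omega> x)"
proof -
  obtain \<phi> where \<phi>: "solves F \<Omega> x {0..} \<phi>"
    and u: "\<And>T \<psi>. T \<ge> 0 \<Longrightarrow> solves F \<Omega> x {0..T} \<psi> \<Longrightarrow> \<forall>t\<in>{0..T}. \<psi> t = \<phi> t"
    using assms unfolding uniquely_solvable_def by blast
  have eq: "trajectory F \<Omega> x t = \<phi> t" if "t \<ge> 0" for t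
  proof (rule trajectory_eq[OF \<phi> _ that])
    fix T \<psi> s
    assume sol: "solves F \<Omega> x {0..T} \<psi>" and s: "s \<in> {0..T}"
    from s have "T \<ge> 0" by simp
    from u[OF this sol] s show "\<psi> s = \<phi> s" by blast
  qed
  have "(trajectory F \<Omega> x has_vector_derivative F (\<phi> t)) (at t within {0..})" if "t \<ge> 0" for t
  proof (rule has_vector_derivative_transform[of t "{0..}" _ \<phi>])
    show "(\<phi> has_vector_derivative F (\<phi> t)) (at t within {0..})"
      using \<phi> that unfolding solves_def by blast
  qed (simp_all add: that eq)
  moreover have "\<phi> 0 = x" "\<And>t. t \<ge> 0 \<Longrightarrow> \<phi> t \<in> \<Omega>"
    using \<phi> unfolding solves_def by simp_all
  ultimately show ?thesis
    unfolding solves_def by (simp add: eq)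
qed

lemma GDERIV_grad:
  assumes "GDERIV V x :> D"
  shows "grad V x = D"
proof -
  have "D' = D" if "GDERIV V x :> D'" for D'
  proof -
    have "(\<lambda>k. k \<bullet> D') = (\<lambda>k. k \<bullet> D)"
      using that assms unfolding gderiv_def by (rule has_derivative_unique)
    then have "k \<bullet> D' = k \<bullet> D" for k by (rule fun_cong)
    then show ?thesis using vector_eq_ldot by blast
  qed
  then show ?thesis unfolding grad_def using assms by blast
qed

(* Unique solvability gives meaning to "the solution": for a merely continuous u it is not
   automatic. Invariance of \<Omega> is part of it, since solutions have values in \<Omega>. *)
definition admissible ::
  "(real^'n \<Rightarrow> real^'n) \<Rightarrow> (real^'n \<Rightarrow> real^'m^'n) \<Rightarrow> (real^'n \<Rightarrow> real^'m) \<Rightarrow> (real^'n) set \<Rightarrow> bool" where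
  "admissible f g u \<Omega> \<longleftrightarrow>
     is_domain \<Omega> \<and> continuous_on \<Omega> u \<and>
     0 \<in> \<Omega> \<and>
     u 0 = 0 \<and>
     (\<forall>x\<in>\<Omega>. uniquely_solvable (closed_loop f g u) \<Omega> x) \<and>
     (\<forall>x\<in>\<Omega>. ((\<lambda>t. norm (trajectory (closed_loop f g u) \<Omega> x t)) \<longlongrightarrow> 0) at_top) \<and>
     (\<exists>\<epsilon> C \<nu>. \<epsilon> > 0 \<and> C > 0 \<and> \<nu> > 0 \<and> ball 0 \<epsilon> \<subseteq> \<Omega> \<and>
        (\<forall>x\<in>ball 0 \<epsilon>. \<forall>t\<ge>0.
           norm (trajectory (closed_loop f g u) \<Omega> x t) \<le> C * exp (- \<nu> * t) * norm x))"

(* S is a proper sublevel set, at level c, of the function V with domain D. The condition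
   closure S \<subseteq> D expresses that V is defined on closure S. *)
definition proper_sublevel_set ::
  "('a::real_normed_vector \<Rightarrow> real) \<Rightarrow> 'a set \<Rightarrow> real \<Rightarrow> 'a set \<Rightarrow> bool" where
  "proper_sublevel_set V D c S \<longleftrightarrow>
     c > 0 \<and> is_domain S \<and> bounded S \<and> closure S \<subseteq> D \<and>
     continuous_on (closure S) V \<and> pos_def_fun_on (closure S) V \<and>
     (\<forall>x\<in>S. V x < c) \<and> (\<forall>x\<in>frontier S. V x = c)"

definition cost ::
  "(real^'n \<Rightarrow> real^'n) \<Rightarrow> (real^'n \<Rightarrow> real^'m^'n) \<Rightarrow> (real^'n \<Rightarrow> real) \<Rightarrow> real^'m^'m \<Rightarrow>
   (real^'n \<Rightarrow> real^'m) \<Rightarrow> (real^'n) set \<Rightarrow> real^'n \<Rightarrow> real" where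
  "cost f g h R u \<Omega> x =
     integral {0..} (\<lambda>t. let y = trajectory (closed_loop f g u) \<Omega> x t
                          in h y + u y \<bullet> (R *v u y))"

definition improved_control ::
  "(real^'n \<Rightarrow> real^'m^'n) \<Rightarrow> real^'m^'m \<Rightarrow> (real^'n \<Rightarrow> real) \<Rightarrow> real^'n \<Rightarrow> real^'m" where
  "improved_control g R v x = - (1/2) *\<^sub>R (matrix_inv R *v (transpose (g x) *v grad v x))"

end

theory Submission
  imports Defs
begin

text \<open>
  Regularity of the cost is obtained without variational equations. A map is locally
  \<open>C\<^sup>1\<^sup>,\<^sup>1\<close> iff it is locally Lipschitz and its second differences are quadratically
  small, and Gronwall's inequality transfers these bounds from the vector field to the flow on
  compact time intervals. Near the origin exponential stability makes some time-\<open>T\<close> map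
  a contraction, and the cost is the sum of the cost of one time step along its iterates; hence the cost
  is \<open>C\<^sup>1\<^sup>,\<^sup>1\<close> there, and the flow carries this to the whole domain.

  The improved control makes the cost \<open>v\<close> strictly decreasing, which yields invariance, global
  existence and attraction. Since \<open>h\<close> may vanish to higher than second order at the
  origin, \<open>v\<close> alone does not give exponential decay. With \<open>w\<close> the cost of
  the running cost \<open>|x|\<^sup>2\<close> under the old control, \<open>w + \<kappa> v\<close> is a quadratic Lyapunov
  function for the improved system: the perturbation of the decay of \<open>w\<close> caused by
  \<open>u_plus - u\<close> is absorbed by the term of \<open>v\<close> that is quadratic in
  \<open>u_plus - u\<close>.
\<close>

section \<open>Maps with quadratically small second differences\<close>

text \<open>What is used of the cost is that its gradient exists, is locally Lipschitz and is
  linearly bounded near the origin: the improved control contains this gradient, so uniqueness of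
  the new trajectories and their exponential decay both depend on it. The difficulty is the infinite
  horizon. Gronwall's constant grows exponentially in time, and exponential stability controls the
  distance of a trajectory to the origin, not the distance between two trajectories. Smallness of a
  single time step at the origin is therefore first converted into a Lipschitz constant 1/2 of that
  step; only then do differences and second differences of the iterates decay geometrically and can
  be summed.

  In \<open>w + \<kappa> v\<close>, Young's inequality spends half of the decay rate of
  \<open>w\<close> on one part of the cross term. The other part is quadratic in
  \<open>u_plus - u\<close>, and \<open>\<kappa>\<close> is its coefficient divided by the
  coercivity constant of \<open>R\<close>. This is where positive definiteness of \<open>R\<close>
  becomes quantitative.\<close>

text \<open>
  The second difference is bounded for arbitrary \<open>a\<close>, \<open>b\<close>, \<open>m\<close> rather than only for the
  midpoint \<open>m\<close> of \<open>a\<close> and \<open>b\<close>: in this form the estimate is stable under composition.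
\<close>

definition C11_bound :: "real \<Rightarrow> 'a::real_normed_vector set \<Rightarrow> ('a \<Rightarrow> 'b::real_normed_vector) \<Rightarrow> bool" where
  "C11_bound L U f \<longleftrightarrow> 0 \<le> L \<and>
     (\<forall>a\<in>U. \<forall>b\<in>U. norm (f a - f b) \<le> L * norm (a - b)) \<and>
     (\<forall>a\<in>U. \<forall>b\<in>U. \<forall>m\<in>U. norm (f a + f b - 2 *\<^sub>R f m)
        \<le> L * (norm (a + b - 2 *\<^sub>R m) + (norm (a - m))\<^sup>2 + (norm (b - m))\<^sup>2))"

text \<open>The balls must lie in \<open>S\<close>, so the predicate forces \<open>S\<close> to be
  open, and continuity and gradients obtained from it are full ones, not relative to
  \<open>S\<close>.\<close>

definition locally_C11 :: "'a::real_normed_vector set \<Rightarrow> ('a \<Rightarrow> 'b::real_normed_vector) \<Rightarrow> bool" where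
  "locally_C11 S f \<longleftrightarrow> (\<forall>x\<in>S. \<exists>r>0. \<exists>L. ball x r \<subseteq> S \<and> C11_bound L (ball x r) f)"

lemma C11_boundI:
  assumes "0 \<le> L"
    and "\<And>a b. a \<in> U \<Longrightarrow> b \<in> U \<Longrightarrow> norm (f a - f b) \<le> L * norm (a - b)"
    and "\<And>a b m. a \<in> U \<Longrightarrow> b \<in> U \<Longrightarrow> m \<in> U \<Longrightarrow> norm (f a + f b - 2 *\<^sub>R f m)
        \<le> L * (norm (a + b - 2 *\<^sub>R m) + (norm (a - m))\<^sup>2 + (norm (b - m))\<^sup>2)"
  shows "C11_bound L U f"
  using assms unfolding C11_bound_def by blast

lemma C11_bound_nonneg: "C11_bound L U f \<Longrightarrow> 0 \<le> L"
  unfolding C11_bound_def by blast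

lemma C11_bound_lipschitz:
  "C11_bound L U f \<Longrightarrow> a \<in> U \<Longrightarrow> b \<in> U \<Longrightarrow> norm (f a - f b) \<le> L * norm (a - b)"
  unfolding C11_bound_def by blast

lemma C11_bound_second:
  "C11_bound L U f \<Longrightarrow> a \<in> U \<Longrightarrow> b \<in> U \<Longrightarrow> m \<in> U \<Longrightarrow> norm (f a + f b - 2 *\<^sub>R f m)
        \<le> L * (norm (a + b - 2 *\<^sub>R m) + (norm (a - m))\<^sup>2 + (norm (b - m))\<^sup>2)"
  unfolding C11_bound_def by blast

lemma C11_bound_mono:
  assumes "C11_bound L U f" "L \<le> M" "V \<subseteq> U"
  shows "C11_bound M V f"
proof (rule C11_boundI)
  show "0 \<le> M" using C11_bound_nonneg[OF assms(1)] assms(2) by simp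
  fix a b m assume V: "a \<in> V" "b \<in> V"
  then have U: "a \<in> U" "b \<in> U" using assms(3) by auto
  show "norm (f a - f b) \<le> M * norm (a - b)"
    using C11_bound_lipschitz[OF assms(1) U] mult_right_mono[OF assms(2) norm_ge_zero]
    by (rule order_trans)
  assume "m \<in> V"
  then have m: "m \<in> U" using assms(3) by auto
  show "norm (f a + f b - 2 *\<^sub>R f m)
        \<le> M * (norm (a + b - 2 *\<^sub>R m) + (norm (a - m))\<^sup>2 + (norm (b - m))\<^sup>2)"
    by (rule order_trans[OF C11_bound_second[OF assms(1) U m]], rule mult_right_mono[OF assms(2)]) simp
qed

lemma C11_bound_cong:
  assumes "\<And>x. x \<in> U \<Longrightarrow> f x = g x" "C11_bound L U f"
  shows "C11_bound L U g"
  using assms unfolding C11_bound_def by simp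

text \<open>The point \<open>f m\<close> need not be the midpoint of \<open>f a\<close> and
  \<open>f b\<close>; its deviation is the second difference of \<open>f\<close>, which the bound
  for \<open>g\<close> admits. In the constant, \<open>L\<close> comes from this deviation and
  \<open>L\<^sup>2\<close> from squaring the Lipschitz estimate.\<close>

lemma C11_bound_compose:
  assumes f: "C11_bound L U f" and g: "C11_bound M V g" and sub: "f ` U \<subseteq> V"
  shows "C11_bound (M * (L + L\<^sup>2)) U (\<lambda>x. g (f x))"
proof (rule C11_boundI)
  have L: "0 \<le> L" and M: "0 \<le> M" using f g C11_bound_nonneg by auto
  then show "0 \<le> M * (L + L\<^sup>2)" by simp
  fix a b m assume ab: "a \<in> U" "b \<in> U"
  then have V: "f a \<in> V" "f b \<in> V" using sub by auto
  have "norm (g (f a) - g (f b)) \<le> M * norm (f a - f b)" by (rule C11_bound_lipschitz[OF g V])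
  also have "\<dots> \<le> M * (L * norm (a - b))"
    by (intro mult_left_mono C11_bound_lipschitz[OF f ab] M)
  also have "\<dots> \<le> M * (L + L\<^sup>2) * norm (a - b)"
    using M by (simp add: algebra_simps)
  finally show "norm (g (f a) - g (f b)) \<le> M * (L + L\<^sup>2) * norm (a - b)" .
  assume m: "m \<in> U"
  then have mV: "f m \<in> V" using sub by auto
  let ?q = "(norm (a - m))\<^sup>2 + (norm (b - m))\<^sup>2"
  have q: "(norm (f x - f m))\<^sup>2 \<le> L\<^sup>2 * (norm (x - m))\<^sup>2" if "x \<in> U" for x
    using power_mono[OF C11_bound_lipschitz[OF f that m] norm_ge_zero, of 2]
    by (simp add: power_mult_distrib)
  have "norm (g (f a) + g (f b) - 2 *\<^sub>R g (f m))
     \<le> M * (norm (f a + f b - 2 *\<^sub>R f m) + (norm (f a - f m))\<^sup>2 + (norm (f b - f m))\<^sup>2)"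
    by (rule C11_bound_second[OF g V mV])
  also have "\<dots> \<le> M * (L * (norm (a + b - 2 *\<^sub>R m) + ?q) + L\<^sup>2 * ?q)"
    using C11_bound_second[OF f ab m] q[OF ab(1)] q[OF ab(2)]
    by (intro mult_left_mono M) (simp add: algebra_simps)
  also have "\<dots> \<le> M * ((L + L\<^sup>2) * (norm (a + b - 2 *\<^sub>R m) + ?q))"
    by (intro mult_left_mono M) (simp add: algebra_simps)
  finally show "norm (g (f a) + g (f b) - 2 *\<^sub>R g (f m))
     \<le> M * (L + L\<^sup>2) * (norm (a + b - 2 *\<^sub>R m) + (norm (a - m))\<^sup>2 + (norm (b - m))\<^sup>2)"
    by (simp add: algebra_simps)
qed

lemma C11_bound_add:
  assumes f: "C11_bound L U f" and g: "C11_bound M U g"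
  shows "C11_bound (L + M) U (\<lambda>x. f x + g x)"
proof (rule C11_boundI)
  show "0 \<le> L + M" using C11_bound_nonneg[OF f] C11_bound_nonneg[OF g] by simp
  fix a b m assume ab: "a \<in> U" "b \<in> U"
  show "norm (f a + g a - (f b + g b)) \<le> (L + M) * norm (a - b)"
    using norm_triangle_ineq[of "f a - f b" "g a - g b"]
      C11_bound_lipschitz[OF f ab] C11_bound_lipschitz[OF g ab]
    by (simp add: algebra_simps)
  assume m: "m \<in> U"
  have "norm (f a + g a + (f b + g b) - 2 *\<^sub>R (f m + g m))
     = norm ((f a + f b - 2 *\<^sub>R f m) + (g a + g b - 2 *\<^sub>R g m))"
    by (simp add: algebra_simps)
  also have "\<dots> \<le> norm (f a + f b - 2 *\<^sub>R f m) + norm (g a + g b - 2 *\<^sub>R g m)"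
    by (rule norm_triangle_ineq)
  also note add_mono[OF C11_bound_second[OF f ab m] C11_bound_second[OF g ab m]]
  finally show "norm (f a + g a + (f b + g b) - 2 *\<^sub>R (f m + g m))
     \<le> (L + M) * (norm (a + b - 2 *\<^sub>R m) + (norm (a - m))\<^sup>2 + (norm (b - m))\<^sup>2)"
    by (simp add: distrib_right)
qed

text \<open>A discrete Leibniz rule: the second difference of the product is exactly the sum of two
  terms with a second difference in one factor and of two products of first differences. The latter
  are quadratic in the distances to \<open>m\<close>.\<close>

lemma C11_bound_bilinear:
  assumes B: "bounded_bilinear B" and f: "C11_bound L U f" and g: "C11_bound M U g"
    and Bf: "\<And>x. x \<in> U \<Longrightarrow> norm (f x) \<le> P" and Bg: "\<And>x. x \<in> U \<Longrightarrow> norm (g x) \<le> Q"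
  shows "\<exists>N. C11_bound N U (\<lambda>x. B (f x) (g x))"
proof (cases "U = {}")
  case True
  then show ?thesis by (auto simp: C11_bound_def)
next
  case False
  interpret bounded_bilinear B by (rule B)
  obtain K where K: "K > 0" "\<And>a b. norm (B a b) \<le> norm a * norm b * K"
    using pos_bounded by blast
  have L: "0 \<le> L" and M: "0 \<le> M" using f g C11_bound_nonneg by auto
  have P: "0 \<le> P" and Q: "0 \<le> Q"
    using False Bf Bg norm_ge_zero order_trans by (metis ex_in_conv)+
  have bd: "norm (B a b) \<le> p * q * K" if "norm a \<le> p" "norm b \<le> q" for a b p q
  proof -
    have "norm a * norm b \<le> p * q"
      using that by (meson mult_mono norm_ge_zero order_trans)
    then show ?thesis using K(2)[of a b] K(1) by (meson less_imp_le mult_right_mono order_trans)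
  qed
  let ?N = "(P * M + L * Q + L * M) * K"
  have "C11_bound ?N U (\<lambda>x. B (f x) (g x))"
  proof (rule C11_boundI)
    show "0 \<le> ?N" using P Q L M K(1) by simp
    fix a b m assume ab: "a \<in> U" "b \<in> U"
    have "B (f a) (g a) - B (f b) (g b) = B (f a) (g a - g b) + B (f a - f b) (g b)"
      by (simp add: diff_left diff_right)
    also have "norm \<dots> \<le> P * (M * norm (a - b)) * K + (L * norm (a - b)) * Q * K"
      by (intro norm_triangle_le add_mono bd Bf Bg ab C11_bound_lipschitz[OF f]
          C11_bound_lipschitz[OF g])
    also have "\<dots> \<le> ?N * norm (a - b)"
      using L M K(1) by (simp add: algebra_simps)
    finally show "norm (B (f a) (g a) - B (f b) (g b)) \<le> ?N * norm (a - b)" .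
    assume m: "m \<in> U"
    let ?s = "norm (a + b - 2 *\<^sub>R m) + (norm (a - m))\<^sup>2 + (norm (b - m))\<^sup>2"
    let ?q = "(norm (a - m))\<^sup>2 + (norm (b - m))\<^sup>2"
    have "B (f a) (g a) + B (f b) (g b) - 2 *\<^sub>R B (f m) (g m)
      = (B (f m) (g a + g b - 2 *\<^sub>R g m) + B (f a + f b - 2 *\<^sub>R f m) (g m))
        + (B (f a - f m) (g a - g m) + B (f b - f m) (g b - g m))"
      by (simp add: diff_left diff_right add_left add_right scaleR_left scaleR_right scaleR_2)
    also have "norm \<dots> \<le> (P * (M * ?s) * K + (L * ?s) * Q * K)
       + ((L * norm (a - m)) * (M * norm (a - m)) * K + (L * norm (b - m)) * (M * norm (b - m)) * K)"
      by (intro norm_triangle_le add_mono bd Bf Bg ab m C11_bound_lipschitz[OF f]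
          C11_bound_lipschitz[OF g] C11_bound_second[OF f] C11_bound_second[OF g])
    also have "\<dots> = (P * M + L * Q) * K * ?s + L * M * K * ?q"
      by (simp add: algebra_simps power2_eq_square)
    also have "\<dots> \<le> (P * M + L * Q) * K * ?s + L * M * K * ?s"
      using L M K(1) by (intro add_left_mono mult_left_mono) simp_all
    also have "\<dots> = ?N * ?s" by (simp add: algebra_simps)
    finally show "norm (B (f a) (g a) + B (f b) (g b) - 2 *\<^sub>R B (f m) (g m)) \<le> ?N * ?s" .
  qed
  then show ?thesis ..
qed

section \<open>Calculus of locally C11 maps and uniform constants on compact sets\<close>

lemma locally_C11_obtain:
  assumes "locally_C11 S f" "x \<in> S"
  obtains r L where "r > 0" "ball x r \<subseteq> S" "C11_bound L (ball x r) f"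
  using assms unfolding locally_C11_def by blast

lemma C11_bound_ball_bounded:
  assumes "C11_bound L (ball x r) k" "y \<in> ball x r"
  shows "norm (k y) \<le> norm (k x) + L * r"
proof -
  have "norm (y - x) < r" using assms(2) by (simp add: dist_norm norm_minus_commute)
  moreover have "x \<in> ball x r" using assms(2) by (metis centre_in_ball dist_commute mem_ball dist_not_less_zero not_less order_le_less_trans zero_le_dist)
  ultimately have "norm (k y - k x) \<le> L * r"
    using C11_bound_lipschitz[OF assms(1,2)] C11_bound_nonneg[OF assms(1)]
    by (meson less_imp_le mult_left_mono order_trans)
  then show ?thesis using norm_triangle_sub[of "k y" "k x"] by simp
qed

lemma C11_bound_continuous_on:
  assumes "C11_bound L U f" shows "continuous_on U f"
proof -
  have "L-lipschitz_on U f"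
    using assms by (auto intro!: lipschitz_onI simp: dist_norm C11_bound_lipschitz C11_bound_nonneg)
  then show ?thesis by (rule lipschitz_on_continuous_on)
qed

lemma locally_C11_isCont:
  assumes "locally_C11 S f" "x \<in> S" shows "isCont f x"
proof -
  obtain r L where "r > 0" "C11_bound L (ball x r) f" using locally_C11_obtain[OF assms] by metis
  then show ?thesis
    using C11_bound_continuous_on continuous_on_interior by fastforce
qed

lemma locally_C11_continuous_on:
  "locally_C11 S f \<Longrightarrow> continuous_on S f"
  using locally_C11_isCont continuous_at_imp_continuous_on by blast

lemma locally_C11_add:
  assumes "locally_C11 S f" "locally_C11 S g"
  shows "locally_C11 S (\<lambda>x. f x + g x)"
  unfolding locally_C11_def
proof
  fix x assume x: "x \<in> S"
  obtain r L where f: "r > 0" "ball x r \<subseteq> S" "C11_bound L (ball x r) f"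
    using locally_C11_obtain[OF assms(1) x] by metis
  obtain s M where g: "s > 0" "ball x s \<subseteq> S" "C11_bound M (ball x s) g"
    using locally_C11_obtain[OF assms(2) x] by metis
  show "\<exists>r>0. \<exists>L. ball x r \<subseteq> S \<and> C11_bound L (ball x r) (\<lambda>x. f x + g x)"
  proof (intro exI conjI)
    show "min r s > 0" "ball x (min r s) \<subseteq> S" using f g by auto
    show "C11_bound (L + M) (ball x (min r s)) (\<lambda>x. f x + g x)"
      by (intro C11_bound_add C11_bound_mono[OF f(3)] C11_bound_mono[OF g(3)]) auto
  qed
qed

lemma locally_C11_compose:
  assumes "locally_C11 S f" "locally_C11 T g" "f ` S \<subseteq> T"
  shows "locally_C11 S (\<lambda>x. g (f x))"
  unfolding locally_C11_def
proof
  fix x assume x: "x \<in> S"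
  obtain r L where f: "r > 0" "ball x r \<subseteq> S" "C11_bound L (ball x r) f"
    using locally_C11_obtain[OF assms(1) x] by metis
  have fx: "f x \<in> T" using x assms(3) by blast
  obtain s M where g: "s > 0" "C11_bound M (ball (f x) s) g"
    using locally_C11_obtain[OF assms(2) fx] by metis
  obtain d where d: "d > 0" "f ` ball x d \<subseteq> ball (f x) s"
    using locally_C11_isCont[OF assms(1) x] g(1) unfolding continuous_at_ball by blast
  show "\<exists>r>0. \<exists>L. ball x r \<subseteq> S \<and> C11_bound L (ball x r) (\<lambda>x. g (f x))"
  proof (intro exI conjI)
    show "min r d > 0" "ball x (min r d) \<subseteq> S" using f d by auto
    show "C11_bound (M * (L + L\<^sup>2)) (ball x (min r d)) (\<lambda>x. g (f x))"
      using d by (intro C11_bound_compose[OF C11_bound_mono[OF f(3)] g(2)]) auto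
  qed
qed

lemma locally_C11_bilinear:
  assumes B: "bounded_bilinear B" and "locally_C11 S f" "locally_C11 S g"
  shows "locally_C11 S (\<lambda>x. B (f x) (g x))"
  unfolding locally_C11_def
proof
  fix x assume x: "x \<in> S"
  obtain r L where f: "r > 0" "ball x r \<subseteq> S" "C11_bound L (ball x r) f"
    using locally_C11_obtain[OF assms(2) x] by metis
  obtain s M where g: "s > 0" "ball x s \<subseteq> S" "C11_bound M (ball x s) g"
    using locally_C11_obtain[OF assms(3) x] by metis
  let ?U = "ball x (min r s)"

  have fU: "C11_bound L ?U f" and gU: "C11_bound M ?U g"
    by (auto intro: C11_bound_mono[OF f(3)] C11_bound_mono[OF g(3)])
  obtain N where "C11_bound N ?U (\<lambda>x. B (f x) (g x))"
    using C11_bound_bilinear[OF B fU gU C11_bound_ball_bounded[OF fU] C11_bound_ball_bounded[OF gU]]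
    by blast
  then show "\<exists>r>0. \<exists>L. ball x r \<subseteq> S \<and> C11_bound L (ball x r) (\<lambda>x. B (f x) (g x))"
    using f g by (intro exI[of _ "min r s"]) auto
qed

lemma locally_C11_bounded_linear:
  assumes "bounded_linear k" "open S"
  shows "locally_C11 S k"
  unfolding locally_C11_def
proof
  interpret bounded_linear k by fact
  obtain K where K: "K > 0" "\<And>x. norm (k x) \<le> norm x * K" using pos_bounded by blast
  have *: "C11_bound K U k" for U
  proof (rule C11_boundI)
    show "0 \<le> K" using K by simp
    fix a b m
    show "norm (k a - k b) \<le> K * norm (a - b)"
      using K(2)[of "a - b"] by (simp add: diff mult.commute)
    have "norm (k a + k b - 2 *\<^sub>R k m) \<le> K * norm (a + b - 2 *\<^sub>R m)"
      using K(2)[of "a + b - 2 *\<^sub>R m"] by (simp add: diff add scaleR mult.commute)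
    also have "\<dots> \<le> K * (norm (a + b - 2 *\<^sub>R m) + (norm (a - m))\<^sup>2 + (norm (b - m))\<^sup>2)"
      using K(1) by (intro mult_left_mono) auto
    finally show "norm (k a + k b - 2 *\<^sub>R k m) \<le> \<dots>" .
  qed
  fix x assume "x \<in> S"
  then obtain e where "e > 0" "ball x e \<subseteq> S" using assms(2) openE by blast
  then show "\<exists>r>0. \<exists>L. ball x r \<subseteq> S \<and> C11_bound L (ball x r) k" using * by blast
qed

lemma locally_C11_subset:
  assumes "locally_C11 S f" "open T" "T \<subseteq> S"
  shows "locally_C11 T f"
  unfolding locally_C11_def
proof
  fix x assume x: "x \<in> T"
  obtain r L where f: "r > 0" "C11_bound L (ball x r) f"
    using locally_C11_obtain[OF assms(1), of x] x assms(3) by (metis subsetD)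
  obtain e where e: "e > 0" "ball x e \<subseteq> T" using assms(2) x openE by blast
  show "\<exists>r>0. \<exists>L. ball x r \<subseteq> T \<and> C11_bound L (ball x r) f"
    using e f by (intro exI[of _ "min r e"] conjI exI[of _ L] C11_bound_mono[OF f(2)]) auto
qed

text \<open>A Lebesgue number argument: the half balls cover \<open>K\<close>, so around every point
  of \<open>K\<close> a common radius fits into one of finitely many full balls. It supplies the
  constants on tubes around compact pieces of trajectories.\<close>

lemma locally_C11_uniform:
  assumes C: "locally_C11 S f" and K: "compact K" "K \<subseteq> S"
  shows "\<exists>r>0. \<exists>L\<ge>0. \<forall>x\<in>K. ball x r \<subseteq> S \<and> C11_bound L (ball x r) f"
proof -
  have "\<forall>x\<in>K. \<exists>r L. r > 0 \<and> ball x r \<subseteq> S \<and> C11_bound L (ball x r) f"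
    using C K(2) unfolding locally_C11_def by (meson subset_iff)
  then obtain r L where rL: "\<And>x. x \<in> K \<Longrightarrow> r x > 0 \<and> ball x (r x) \<subseteq> S \<and> C11_bound (L x) (ball x (r x)) f"
    by metis
  have "K \<subseteq> (\<Union>x\<in>K. ball x (r x / 2))" using rL by force
  from compactE_image[OF K(1) _ this] obtain D where D: "D \<subseteq> K" "finite D" "K \<subseteq> (\<Union>x\<in>D. ball x (r x / 2))"
    by auto
  \<comment> \<open>The inserted 1 and 0 keep minimum and maximum meaningful when \<open>K\<close>,
    and hence \<open>D\<close>, is empty; 0 also makes \<open>?L\<close> nonnegative.\<close>
  let ?r = "Min (insert 1 ((\<lambda>x. r x / 2) ` D))" and ?L = "Max (insert 0 (L ` D))"
  have "ball x ?r \<subseteq> S \<and> C11_bound ?L (ball x ?r) f" if "x \<in> K" for x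
  proof -
    obtain d where d: "d \<in> D" "dist d x < r d / 2" using D \<open>x \<in> K\<close> by auto
    have "?r \<le> r d / 2" using d D by (intro Min_le) auto
    have sub: "ball x ?r \<subseteq> ball d (r d)"
    proof
      fix y assume "y \<in> ball x ?r"
      then have "dist x y < ?r" by (simp only: mem_ball)
      also note \<open>?r \<le> r d / 2\<close>
      finally show "y \<in> ball d (r d)" using d(2) dist_triangle[of d y x] by simp
    qed
    have "L d \<le> ?L" using d D by (intro Max_ge) auto
    then show ?thesis
      using sub rL[of d] d D C11_bound_mono[of "L d" "ball d (r d)" f ?L "ball x ?r"] by blast
  qed
  moreover have "?r > 0" using D rL by (subst Min_gr_iff) auto
  moreover have "?L \<ge> 0" using D by (intro Max_ge) auto
  ultimately show ?thesis by blast
qed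

section \<open>Twice continuously differentiable maps are locally C11\<close>

lemma Ck_Suc_lipschitz:
  fixes f :: "'a::euclidean_space \<Rightarrow> 'b::real_normed_vector"
  assumes f: "Ck_on (Suc 0) S f" and K: "compact K" "convex K" "K \<subseteq> S"
  shows "\<exists>L\<ge>0. \<forall>x\<in>K. \<forall>y\<in>K. norm (f x - f y) \<le> L * norm (x - y)"
proof -
  let ?D = "\<lambda>x. frechet_derivative f (at x)"
  have dif: "(f has_derivative ?D x) (at x)" if "x \<in> K" for x
    using f K that frechet_derivative_works by auto
  have "\<exists>M. \<forall>x\<in>K. norm (?D x b) \<le> M" for b
  proof -
    have "continuous_on S (\<lambda>x. ?D x b)" using f by simp
    then have "continuous_on K (\<lambda>x. ?D x b)" using K(3) by (rule continuous_on_subset)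
    then have "compact ((\<lambda>x. ?D x b) ` K)" using K compact_continuous_image by blast
    then have "bounded ((\<lambda>x. ?D x b) ` K)" by (rule compact_imp_bounded)
    then show ?thesis unfolding bounded_iff by blast
  qed
  then obtain M where M: "\<And>b x. x \<in> K \<Longrightarrow> norm (?D x b) \<le> M b" by metis
  \<comment> \<open>\<open>Ck_on\<close> gives continuity one direction at a time. Expanding a
    vector in the basis turns these bounds into one on the operator norm, as the mean value
    inequality requires.\<close>
  let ?L = "\<Sum>b\<in>Basis. \<bar>M b\<bar>"
  have on: "norm (?D x v) \<le> ?L * norm v" if "x \<in> K" for x v
  proof -
    interpret D: bounded_linear "?D x" using dif[OF that] has_derivative_bounded_linear by blast
    have "?D x v = ?D x (\<Sum>b\<in>Basis. (v \<bullet> b) *\<^sub>R b)" by (simp add: euclidean_representation)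
    also have "\<dots> = (\<Sum>b\<in>Basis. (v \<bullet> b) *\<^sub>R ?D x b)" by (simp add: D.sum D.scaleR)
    also have "norm \<dots> \<le> (\<Sum>b\<in>Basis. norm v * \<bar>M b\<bar>)"
    proof (rule sum_norm_le)
      fix b :: 'a assume "b \<in> Basis"
      then show "norm ((v \<bullet> b) *\<^sub>R ?D x b) \<le> norm v * \<bar>M b\<bar>"
        using M[OF that, of b] Basis_le_norm by (auto intro!: mult_mono)
    qed
    finally show ?thesis by (simp only: sum_distrib_left[symmetric] mult.commute)
  qed
  have "norm (f x - f y) \<le> ?L * norm (x - y)" if "x \<in> K" "y \<in> K" for x y
    using K(2) that
    by (intro differentiable_bound[of K f ?D ?L])
       (auto intro: has_derivative_at_withinI dif onorm_le on simp: mult.commute)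
  then show ?thesis by (intro exI[of _ ?L]) (auto intro: sum_nonneg)
qed

text \<open>An arbitrary triple is reduced to a symmetric one: \<open>b\<close> is replaced by the
  reflection \<open>c\<close> of \<open>a\<close> in \<open>m\<close>, at the cost of a Lipschitz
  term in b - c = a + b - 2m. For a symmetric triple the mean value inequality is applied to s ->
  f(m + s k) + f(m - s k), whose derivative is a difference of derivatives of \<open>f\<close> at
  two points at distance 2 s |k|.\<close>

lemma Ck_2_locally_C11:
  fixes f :: "'a::euclidean_space \<Rightarrow> 'b::real_normed_vector"
  assumes f: "Ck_on (Suc (Suc 0)) S f" and S: "open S"
  shows "locally_C11 S f"
  unfolding locally_C11_def
proof
  fix x assume "x \<in> S"
  then obtain R where R: "R > 0" "cball x R \<subseteq> S" using S open_contains_cball by blast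
  define K where "K = cball x R"
  have K: "compact K" "convex K" "K \<subseteq> S" using R by (auto simp: K_def)
  let ?D = "\<lambda>x. frechet_derivative f (at x)"
  have dif: "(f has_derivative ?D x) (at x)" if "x \<in> K" for x
    using f K that frechet_derivative_works by auto
  have "Ck_on (Suc 0) S f"
    using f by (auto intro!: continuous_at_imp_continuous_on differentiable_imp_continuous_within)
  from Ck_Suc_lipschitz[OF this K] obtain L
    where L: "L \<ge> 0" "\<And>x y. x \<in> K \<Longrightarrow> y \<in> K \<Longrightarrow> norm (f x - f y) \<le> L * norm (x - y)"
    by blast
  have "\<exists>L\<ge>0. \<forall>x\<in>K. \<forall>y\<in>K. norm (?D x b - ?D y b) \<le> L * norm (x - y)" for b
    by (rule Ck_Suc_lipschitz[OF _ K]) (use f in simp)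
  then obtain M where M: "\<And>b. M b \<ge> 0"
     "\<And>b x y. x \<in> K \<Longrightarrow> y \<in> K \<Longrightarrow> norm (?D x b - ?D y b) \<le> M b * norm (x - y)" by metis
  let ?M = "\<Sum>b\<in>Basis. M b"
  have M0: "?M \<ge> 0" using M(1) by (intro sum_nonneg) auto
  have D2: "norm (?D x v - ?D y v) \<le> ?M * norm (x - y) * norm v" if "x \<in> K" "y \<in> K" for x y v
  proof -
    interpret D: bounded_linear "\<lambda>v. ?D x v - ?D y v"
      by (intro bounded_linear_sub has_derivative_bounded_linear[OF dif] that)
    have "?D x v - ?D y v = (\<lambda>v. ?D x v - ?D y v) (\<Sum>b\<in>Basis. (v \<bullet> b) *\<^sub>R b)"
      by (simp add: euclidean_representation)
    also have "\<dots> = (\<Sum>b\<in>Basis. (v \<bullet> b) *\<^sub>R (?D x b - ?D y b))" by (simp only: D.sum D.scaleR)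
    also have "norm \<dots> \<le> (\<Sum>b\<in>Basis. norm v * (M b * norm (x - y)))"
    proof (rule sum_norm_le)
      fix b :: 'a assume "b \<in> Basis"
      then show "norm ((v \<bullet> b) *\<^sub>R (?D x b - ?D y b)) \<le> norm v * (M b * norm (x - y))"
        using M(2)[OF that, of b] Basis_le_norm by (auto intro!: mult_mono)
    qed
    also have "\<dots> = ?M * norm (x - y) * norm v"
      by (simp add: sum_distrib_right sum_distrib_left mult_ac)
    finally show ?thesis .
  qed
  have sym: "norm (f (m + k) + f (m - k) - 2 *\<^sub>R f m) \<le> 2 * ?M * (norm k)\<^sup>2"
    if mk: "m + k \<in> K" "m - k \<in> K" for m k
  proof -
    define q where "q s = f (m + s *\<^sub>R k) + f (m - s *\<^sub>R k)" for s :: real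
    have inK: "m + s *\<^sub>R k \<in> K" "m - s *\<^sub>R k \<in> K" if "s \<in> {0..1}" for s
    proof -
      \<comment> \<open>The points m + s k and m - s k are convex combinations of m + k and m - k
        with weights (1 + s)/2 and (1 - s)/2.\<close>
      have e: "((1 + s) / 2) *\<^sub>R (m + k) + ((1 - s) / 2) *\<^sub>R (m - k)
         = ((1 + s) / 2 + (1 - s) / 2) *\<^sub>R m + ((1 + s) / 2 - (1 - s) / 2) *\<^sub>R k"
        "((1 - s) / 2) *\<^sub>R (m + k) + ((1 + s) / 2) *\<^sub>R (m - k)
         = ((1 + s) / 2 + (1 - s) / 2) *\<^sub>R m - ((1 + s) / 2 - (1 - s) / 2) *\<^sub>R k"
        by (simp_all only: scaleR_left_distrib scaleR_left_diff_distrib scaleR_right_distrib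
            scaleR_right_diff_distrib) simp_all
      have c: "(1 + s) / 2 + (1 - s) / 2 = 1" "(1 + s) / 2 - (1 - s) / 2 = s"
        by (simp_all add: field_simps)
      have "((1 + s) / 2) *\<^sub>R (m + k) + ((1 - s) / 2) *\<^sub>R (m - k) \<in> K"
        "((1 - s) / 2) *\<^sub>R (m + k) + ((1 + s) / 2) *\<^sub>R (m - k) \<in> K"
        by (rule convexD[OF K(2) mk]; use that in \<open>simp add: add_divide_distrib[symmetric]\<close>)+
      then show "m + s *\<^sub>R k \<in> K" "m - s *\<^sub>R k \<in> K"
        unfolding e c scaleR_one by blast+
    qed
    have q': "(q has_derivative (\<lambda>h. ?D (m + s *\<^sub>R k) (h *\<^sub>R k) + ?D (m - s *\<^sub>R k) (- (h *\<^sub>R k)))) (at s within {0..1})"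
      if "s \<in> {0..1}" for s
    proof -
      have "((\<lambda>s. m + s *\<^sub>R k) has_derivative (\<lambda>h. h *\<^sub>R k)) (at s within {0..1})"
        "((\<lambda>s. m - s *\<^sub>R k) has_derivative (\<lambda>h. - (h *\<^sub>R k))) (at s within {0..1})"
        by (auto intro!: derivative_eq_intros)
      from has_derivative_add[OF has_derivative_compose[OF this(1) dif[OF inK(1)[OF that]]]
          has_derivative_compose[OF this(2) dif[OF inK(2)[OF that]]]]
      show ?thesis unfolding q_def .
    qed
    have "norm (q 1 - q 0) \<le> (2 * ?M * (norm k)\<^sup>2) * norm (1 - 0 :: real)"
    proof (rule differentiable_bound[OF _ q'])
      fix s :: real assume s: "s \<in> {0..1}"
      have lin: "linear (?D z)" if "z \<in> K" for z
        using dif[OF that] has_derivative_linear by blast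
      show "onorm (\<lambda>h. ?D (m + s *\<^sub>R k) (h *\<^sub>R k) + ?D (m - s *\<^sub>R k) (- (h *\<^sub>R k))) \<le> 2 * ?M * (norm k)\<^sup>2"
      proof (rule onorm_le)
        fix h :: real
        have "?D (m + s *\<^sub>R k) (h *\<^sub>R k) + ?D (m - s *\<^sub>R k) (- (h *\<^sub>R k))
           = ?D (m + s *\<^sub>R k) (h *\<^sub>R k) - ?D (m - s *\<^sub>R k) (h *\<^sub>R k)"
          using linear_neg[OF lin[OF inK(2)[OF s]]] by simp
        also have "norm \<dots> \<le> ?M * norm ((m + s *\<^sub>R k) - (m - s *\<^sub>R k)) * norm (h *\<^sub>R k)"
          by (intro D2 inK s)
        also have "(m + s *\<^sub>R k) - (m - s *\<^sub>R k) = (2 * s) *\<^sub>R k" by (simp add: scaleR_2 flip: scaleR_scaleR)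
        also have "?M * norm ((2 * s) *\<^sub>R k) * norm (h *\<^sub>R k) \<le> ?M * (2 * norm k) * norm (h *\<^sub>R k)"
          using s by (intro mult_right_mono mult_left_mono M0) (auto intro: mult_left_le_one_le)
        finally show "norm (?D (m + s *\<^sub>R k) (h *\<^sub>R k) + ?D (m - s *\<^sub>R k) (- (h *\<^sub>R k)))
           \<le> 2 * ?M * (norm k)\<^sup>2 * norm h"
          by (simp add: power2_eq_square mult_ac)
      qed
    qed auto
    then show ?thesis by (simp add: q_def scaleR_2)
  qed
  \<comment> \<open>A third of the radius suffices for the reflection of one point of the ball in
    another to stay in \<open>K\<close>.\<close>
  have "C11_bound (L + 2 * ?M) (ball x (R / 3)) f"
  proof (rule C11_boundI)
    show "0 \<le> L + 2 * ?M" using L M0 by simp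
    fix a b m assume ab: "a \<in> ball x (R/3)" "b \<in> ball x (R/3)"
    then have abK: "a \<in> K" "b \<in> K" using R by (auto simp: K_def)
    show "norm (f a - f b) \<le> (L + 2 * ?M) * norm (a - b)"
      using L(2)[OF abK] M0 by (simp add: distrib_right add_increasing2)
    assume m: "m \<in> ball x (R/3)"
    define c where "c = 2 *\<^sub>R m - a"
    have "dist x c \<le> dist x m + dist a m"
      unfolding c_def dist_norm scaleR_2 using norm_triangle_ineq[of "x - m" "a - m"] by (simp add: algebra_simps)
    also have "\<dots> \<le> dist x m + (dist x a + dist x m)" by (metis add_left_mono dist_commute dist_triangle2)
    finally have c: "c \<in> K" using ab m by (simp add: K_def)
    have "norm (f a + f c - 2 *\<^sub>R f m) \<le> 2 * ?M * (norm (a - m))\<^sup>2"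
    proof -
      have "m + (a - m) = a" "m - (a - m) = c" by (simp_all add: c_def scaleR_2)
      then show ?thesis using sym[of m "a - m"] abK c by simp
    qed
    moreover have "norm (f b - f c) \<le> L * norm (a + b - 2 *\<^sub>R m)"
      using L(2)[OF abK(2) c] by (simp add: c_def algebra_simps)
    moreover have "f a + f b - 2 *\<^sub>R f m = (f a + f c - 2 *\<^sub>R f m) + (f b - f c)" by simp
    ultimately have "norm (f a + f b - 2 *\<^sub>R f m) \<le> 2 * ?M * (norm (a - m))\<^sup>2 + L * norm (a + b - 2 *\<^sub>R m)"
      by (metis add_mono norm_triangle_le)
    also have "\<dots> \<le> (L + 2 * ?M) * (norm (a + b - 2 *\<^sub>R m) + (norm (a - m))\<^sup>2 + (norm (b - m))\<^sup>2)"
      using L M0 by (simp add: algebra_simps)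
    finally show "norm (f a + f b - 2 *\<^sub>R f m)
       \<le> (L + 2 * ?M) * (norm (a + b - 2 *\<^sub>R m) + (norm (a - m))\<^sup>2 + (norm (b - m))\<^sup>2)" .
  qed
  moreover have "ball x (R/3) \<subseteq> S" using R by auto
  ultimately show "\<exists>r>0. \<exists>L. ball x r \<subseteq> S \<and> C11_bound L (ball x r) f" using R by (meson divide_pos_pos zero_less_numeral)
qed

section \<open>Gradients of \<open>C\<^sup>1\<^sup>,\<^sup>1\<close> functions\<close>

text \<open>Both sums are quadratically close to 2 f(m), because the two pairs share the midpoint
  \<open>m\<close>. Applied to the diagonals of a parallelogram, this gives additivity of
  directional derivatives and also the Lipschitz estimate for the gradient.\<close>

lemma C11_bound_four_point:
  assumes f: "C11_bound L U f" and U: "a \<in> U" "b \<in> U" "c \<in> U" "d \<in> U" "m \<in> U"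
    and m: "a + b = 2 *\<^sub>R m" "c + d = 2 *\<^sub>R m"
    and e: "norm (a - m) \<le> e" "norm (b - m) \<le> e" "norm (c - m) \<le> e" "norm (d - m) \<le> e"
  shows "norm ((f a + f b) - (f c + f d)) \<le> 4 * L * e\<^sup>2"
proof -
  have e2: "(norm (z - m))\<^sup>2 \<le> e\<^sup>2" if "norm (z - m) \<le> e" for z
    using power_mono[OF that norm_ge_zero] .
  have *: "norm (f z + f w - 2 *\<^sub>R f m) \<le> L * (2 * e\<^sup>2)"
    if "z \<in> U" "w \<in> U" "z + w = 2 *\<^sub>R m" "norm (z - m) \<le> e" "norm (w - m) \<le> e" for z w
  proof -
    have "norm (f z + f w - 2 *\<^sub>R f m) \<le> L * ((norm (z - m))\<^sup>2 + (norm (w - m))\<^sup>2)"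
      using C11_bound_second[OF f that(1,2) U(5)] that(3) by simp
    also have "\<dots> \<le> L * (2 * e\<^sup>2)"
      using e2[OF that(4)] e2[OF that(5)] C11_bound_nonneg[OF f] by (intro mult_left_mono) auto
    finally show ?thesis .
  qed
  have "norm ((f a + f b) - (f c + f d)) = norm ((f a + f b - 2 *\<^sub>R f m) - (f c + f d - 2 *\<^sub>R f m))"
    by simp
  also have "\<dots> \<le> L * (2 * e\<^sup>2) + L * (2 * e\<^sup>2)"
    using norm_triangle_ineq4 *[OF U(1,2) m(1) e(1,2)] *[OF U(3,4) m(2) e(3,4)]
    by (meson add_mono order_trans)
  finally show ?thesis by simp
qed

text \<open>Additivity gives integer multiples. For real \<open>c\<close>, replacing n c by its
  integer part changes both \<open>p ((n * c) x)\<close> and n c p(x) by at most a fixed amount, so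
  n times the defect of homogeneity is bounded in \<open>n\<close> and the defect vanishes.\<close>

lemma additive_bounded_imp_linear:
  fixes p :: "'a::real_normed_vector \<Rightarrow> real"
  assumes add: "\<And>x y. p (x + y) = p x + p y" and bd: "\<And>x. \<bar>p x\<bar> \<le> L * norm x"
  shows "linear p"
proof (rule linearI)
  show "p (x + y) = p x + p y" for x y by (rule add)
  interpret p: Modules.additive p by unfold_locales (rule add)
  have nat: "p (real n *\<^sub>R x) = real n * p x" for n x
    by (induction n) (simp_all add: add p.zero algebra_simps)
  have int: "p (of_int z *\<^sub>R x) = of_int z * p x" for z x
  proof (cases "z \<ge> 0")
    case True
    then show ?thesis using nat[of "nat z" x] by simp
  next
    case False
    then have "p (- (of_int z *\<^sub>R x)) = - (of_int z * p x)" using nat[of "nat (- z)" x] by simp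
    then show ?thesis by (simp add: p.minus)
  qed
  show "p (c *\<^sub>R x) = c *\<^sub>R p x" for c x
  proof -
    let ?d = "p (c *\<^sub>R x) - c * p x"
    have "real n * \<bar>?d\<bar> \<le> 2 * (L * norm x)" for n
    proof -
      define z where "z = \<lfloor>real n * c\<rfloor>"
      have z: "\<bar>real n * c - of_int z\<bar> \<le> 1" unfolding z_def by linarith
      have L: "0 \<le> L * norm x" using bd[of x] by linarith
      have "real n * ?d = p ((real n * c) *\<^sub>R x) - real n * c * p x"
        using nat[of n "c *\<^sub>R x"] by (simp add: algebra_simps)
      also have "(real n * c) *\<^sub>R x = (real n * c - of_int z) *\<^sub>R x + of_int z *\<^sub>R x"
        by (simp add: algebra_simps)
      also have "p \<dots> - real n * c * p x
          = p ((real n * c - of_int z) *\<^sub>R x) - (real n * c - of_int z) * p x"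
        by (simp add: add int left_diff_distrib)
      finally have "\<bar>real n * ?d\<bar> \<le> \<bar>p ((real n * c - of_int z) *\<^sub>R x)\<bar> + \<bar>(real n * c - of_int z) * p x\<bar>"
        by linarith
      also have "\<bar>p ((real n * c - of_int z) *\<^sub>R x)\<bar> \<le> \<bar>real n * c - of_int z\<bar> * (L * norm x)"
        using bd[of "(real n * c - of_int z) *\<^sub>R x"] by (simp add: mult_ac)
      also have "\<dots> \<le> 1 * (L * norm x)" by (rule mult_right_mono[OF z L])
      also have "\<bar>(real n * c - of_int z) * p x\<bar> \<le> 1 * (L * norm x)"
        unfolding abs_mult by (rule mult_mono[OF z bd]) (use L in auto)
      finally show ?thesis by (simp add: abs_mult)
    qed
    then have "\<bar>?d\<bar> \<le> 0"
      by (metis abs_ge_zero ex_less_of_nat_mult linorder_not_less order_le_less)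
    then show ?thesis by simp
  qed
qed

text \<open>The derivative is constructed as the limit \<open>p\<close> of dyadic difference
  quotients. Each halving of the increment changes the quotient by at most L |k|^2 / 2 times
  (1/2)^n, and the geometric sum of these changes is exactly the Taylor error. Additivity of
  \<open>p\<close> comes from the four-point estimate at scale 2^(-n), whose error is quadratic in
  the scale while the quotient divides by the scale only once.\<close>

lemma C11_bound_Taylor:
  fixes f :: "'a::euclidean_space \<Rightarrow> real"
  assumes f: "C11_bound L (ball y s) f" and s: "s > 0"
  obtains D where "\<And>k. norm k < s \<Longrightarrow> \<bar>f (y + k) - f y - k \<bullet> D\<bar> \<le> L * (norm k)\<^sup>2"
proof -
  have L: "0 \<le> L" by (rule C11_bound_nonneg[OF f])
  have y: "y \<in> ball y s" using s by simp
  define q where "q n k = 2 ^ n * (f (y + (1 / 2 ^ n) *\<^sub>R k) - f y)" for n :: nat and k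
  have inb: "y + c *\<^sub>R k \<in> ball y s" if "norm k < s" "0 \<le> c" "c \<le> 1" for c :: real and k
    using that mult_left_le_one_le[of "norm k" c] by (simp add: dist_norm)
  have step: "\<bar>q (Suc n) k - q n k\<bar> \<le> L * (norm k)\<^sup>2 / 2 * (1/2) ^ n" if k: "norm k < s" for n k
  proof -
    define e where "e = (1 / 2 ^ n) *\<^sub>R k"
    have e: "y + e \<in> ball y s" unfolding e_def by (rule inb[OF k]) auto
    have e2: "y + (1/2) *\<^sub>R e \<in> ball y s" unfolding e_def scaleR_scaleR
      by (rule inb[OF k]) (use one_le_power[of "2::real" "Suc n"] in \<open>auto simp: field_simps\<close>)
    have "norm (f y + f (y + e) - 2 *\<^sub>R f (y + (1/2) *\<^sub>R e)) \<le> L * (norm (y + (y + e) - 2 *\<^sub>R (y + (1/2) *\<^sub>R e))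
       + (norm (y - (y + (1/2) *\<^sub>R e)))\<^sup>2 + (norm (y + e - (y + (1/2) *\<^sub>R e)))\<^sup>2)"
      by (rule C11_bound_second[OF f y e e2])
    also have "y + (y + e) - 2 *\<^sub>R (y + (1/2) *\<^sub>R e) = 0" by (simp add: scaleR_2 scaleR_add_right)
    also have "y - (y + (1/2) *\<^sub>R e) = - ((1/2) *\<^sub>R e)" by simp
    also have "y + e - (y + (1/2) *\<^sub>R e) = (1/2) *\<^sub>R e"
      by (simp add: algebra_simps flip: scaleR_left_distrib)
    finally have "\<bar>f y + f (y + e) - 2 * f (y + (1/2) *\<^sub>R e)\<bar> \<le> L * (norm e)\<^sup>2 / 2"
      by (simp add: power_divide)
    moreover have "q (Suc n) k - q n k = - (2 ^ n * (f y + f (y + e) - 2 * f (y + (1/2) *\<^sub>R e)))"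
      unfolding q_def e_def by (simp add: algebra_simps)
    ultimately have "\<bar>q (Suc n) k - q n k\<bar> \<le> 2 ^ n * (L * (norm e)\<^sup>2 / 2)"
      by (simp add: abs_mult)
    also have "\<dots> = L * (norm k)\<^sup>2 / 2 * (1/2) ^ n"
      unfolding e_def by (simp add: power_divide power2_eq_square field_simps)
    finally show ?thesis .
  qed
  have lim: "\<exists>l. (\<lambda>n. q n k) \<longlonglongrightarrow> l \<and> \<bar>l - q 0 k\<bar> \<le> L * (norm k)\<^sup>2" if k: "norm k < s" for k
  proof -
    let ?b = "\<lambda>n::nat. L * (norm k)\<^sup>2 / 2 * (1/2) ^ n"
    have b: "?b sums (L * (norm k)\<^sup>2 / 2 * (1 / (1 - 1/2)))"
      by (intro sums_mult geometric_sums) simp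
    have sm: "summable (\<lambda>n. q (Suc n) k - q n k)"
      by (rule summable_comparison_test'[where N=0, OF sums_summable[OF b]]) (use step[OF k] in simp)
    have "(\<lambda>n. q n k - q 0 k) \<longlonglongrightarrow> (\<Sum>n. q (Suc n) k - q n k)"
      using summable_LIMSEQ[OF sm] by (simp add: sum_lessThan_telescope[of "\<lambda>n. q n k"])
    then have "(\<lambda>n. (q n k - q 0 k) + q 0 k) \<longlonglongrightarrow> (\<Sum>n. q (Suc n) k - q n k) + q 0 k"
      by (intro tendsto_add tendsto_const)
    moreover have "\<bar>(\<Sum>n. q (Suc n) k - q n k)\<bar> \<le> (\<Sum>n. ?b n)"
      using norm_suminf_le[of "\<lambda>n. q (Suc n) k - q n k" ?b] step[OF k] sums_summable[OF b] by simp
    ultimately show ?thesis using sums_unique[OF b]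
      by (intro exI[of _ "(\<Sum>n. q (Suc n) k - q n k) + q 0 k"]) simp
  qed
  have small: "\<exists>N. \<forall>n\<ge>N. (1 / 2 ^ n) * norm k < s" for k :: 'a
  proof -
    have "(\<lambda>n. (1 / 2) ^ n * norm k) \<longlonglongrightarrow> 0 * norm k"
      by (intro tendsto_mult LIMSEQ_power_zero tendsto_const) simp
    then have "\<forall>\<^sub>F n in sequentially. (1 / 2) ^ n * norm k < s"
      using s by (intro order_tendstoD) auto
    then show ?thesis by (simp add: eventually_sequentially power_divide)
  qed
  \<comment> \<open>For \<open>k\<close> outside the ball the quotients of k / 2^N are an index
    shift of those of \<open>k\<close>, so \<open>p\<close> is defined on the whole space.\<close>
  have conv: "convergent (\<lambda>n. q n k)" for k
  proof -
    obtain N where N: "(1 / 2 ^ N) * norm k < s" using small by blast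
    obtain l where "(\<lambda>n. q n ((1 / 2 ^ N) *\<^sub>R k)) \<longlonglongrightarrow> l"
      using lim[of "(1 / 2 ^ N) *\<^sub>R k"] N by auto
    then have "(\<lambda>n. 2 ^ N * q n ((1 / 2 ^ N) *\<^sub>R k)) \<longlonglongrightarrow> 2 ^ N * l"
      by (intro tendsto_mult tendsto_const)
    moreover have "2 ^ N * q n ((1 / 2 ^ N) *\<^sub>R k) = q (n + N) k" for n
      unfolding q_def by (simp add: power_add mult_ac)
    ultimately have "(\<lambda>n. q (n + N) k) \<longlonglongrightarrow> 2 ^ N * l" by simp
    from LIMSEQ_offset[OF this] show ?thesis by (auto simp: convergent_def)
  qed
  define p where "p k = lim (\<lambda>n. q n k)" for k
  have p: "(\<lambda>n. q n k) \<longlonglongrightarrow> p k" for k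
    using conv unfolding p_def convergent_LIMSEQ_iff by blast
  have p0: "\<bar>f (y + k) - f y - p k\<bar> \<le> L * (norm k)\<^sup>2" if k: "norm k < s" for k
  proof -
    obtain l where "(\<lambda>n. q n k) \<longlonglongrightarrow> l" "\<bar>l - q 0 k\<bar> \<le> L * (norm k)\<^sup>2" using lim[OF k] by blast
    then have "\<bar>p k - q 0 k\<bar> \<le> L * (norm k)\<^sup>2" using p LIMSEQ_unique by blast
    then show ?thesis by (simp add: q_def abs_minus_commute)
  qed
  have pL: "\<bar>p k\<bar> \<le> L * norm k" for k
  proof -
    obtain N where N: "\<forall>n\<ge>N. (1 / 2 ^ n) * norm k < s" using small by blast
    have "\<bar>q n k\<bar> \<le> L * norm k" if "n \<ge> N" for n
    proof -
      have "y + (1 / 2 ^ n) *\<^sub>R k \<in> ball y s" using N that by (simp add: dist_norm)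
      from C11_bound_lipschitz[OF f this y]
      have "2 ^ n * \<bar>f (y + (1 / 2 ^ n) *\<^sub>R k) - f y\<bar> \<le> 2 ^ n * (L * ((1 / 2 ^ n) * norm k))"
        by (intro mult_left_mono) simp_all
      then show ?thesis by (simp add: q_def abs_mult)
    qed
    then show ?thesis using tendsto_rabs[OF p[of k]] by (intro LIMSEQ_le_const2) auto
  qed
  have "p (k + l) = p k + p l" for k l
  proof -
    let ?M = "norm k + norm l"
    \<comment> \<open>The vector is a device to apply \<open>small\<close> to the number
      \<open>?M\<close>: a multiple of a unit vector that has norm \<open>?M\<close>.\<close>
    obtain N where N: "\<forall>n\<ge>N. (1 / 2 ^ n) * ?M < s" using small[of "?M *\<^sub>R (SOME b. b \<in> Basis)"]
      by (auto simp: some_in_eq)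
    have bound: "norm (q n (k + l) - (q n k + q n l)) \<le> 4 * L * ?M\<^sup>2 * (1/2) ^ n" if n: "n \<ge> N" for n
    proof -
      define c :: real where "c = 1 / 2 ^ n"
      have c: "c > 0" "c * ?M < s" using N n by (auto simp: c_def)
      have inn: "y + v \<in> ball y s" if "norm v \<le> c * ?M" for v
        using that c by (simp add: dist_norm)
      have nk: "norm k \<le> ?M" "norm l \<le> ?M" "norm (k + l) \<le> ?M" "norm (k - l) \<le> ?M"
        by (simp_all add: norm_triangle_ineq norm_triangle_ineq4)
      have half: "norm ((c / 2) *\<^sub>R v) \<le> c * ?M" if "norm v \<le> ?M" for v :: 'a
      proof -
        have "norm ((c / 2) *\<^sub>R v) = c / 2 * norm v" using c by simp
        also have "\<dots> \<le> c * ?M" by (intro mult_mono) (use that c in auto)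
        finally show ?thesis .
      qed
      have full: "norm (c *\<^sub>R v) \<le> c * ?M" if "norm v \<le> ?M" for v :: 'a
        using that c mult_left_mono[OF that, of c] by simp
      let ?m = "y + (c / 2) *\<^sub>R (k + l)"
      have "norm ((f (y + c *\<^sub>R (k + l)) + f y) - (f (y + c *\<^sub>R k) + f (y + c *\<^sub>R l))) \<le> 4 * L * (c * ?M)\<^sup>2"
      proof (rule C11_bound_four_point[OF f])
        show "y + c *\<^sub>R (k + l) \<in> ball y s" "y + c *\<^sub>R k \<in> ball y s" "y + c *\<^sub>R l \<in> ball y s"
          by (intro inn full nk)+
        show "?m \<in> ball y s" by (intro inn half nk)
        show "y + c *\<^sub>R (k + l) + y = 2 *\<^sub>R ?m" "y + c *\<^sub>R k + (y + c *\<^sub>R l) = 2 *\<^sub>R ?m"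
          by (simp_all add: scaleR_2 algebra_simps flip: scaleR_left_distrib)
        have "y + c *\<^sub>R (k + l) - ?m = (c / 2) *\<^sub>R (k + l)" "y - ?m = - ((c / 2) *\<^sub>R (k + l))"
          "y + c *\<^sub>R k - ?m = (c / 2) *\<^sub>R (k - l)" "y + c *\<^sub>R l - ?m = - ((c / 2) *\<^sub>R (k - l))"
          by (simp_all add: algebra_simps flip: scaleR_left_diff_distrib scaleR_left_distrib)
        then show "norm (y + c *\<^sub>R (k + l) - ?m) \<le> c * ?M" "norm (y - ?m) \<le> c * ?M"
          "norm (y + c *\<^sub>R k - ?m) \<le> c * ?M" "norm (y + c *\<^sub>R l - ?m) \<le> c * ?M"
          using half nk by (simp_all only: norm_minus_cancel)
      qed (rule y)
      then have "2 ^ n * norm ((f (y + c *\<^sub>R (k + l)) + f y) - (f (y + c *\<^sub>R k) + f (y + c *\<^sub>R l)))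
         \<le> 2 ^ n * (4 * L * (c * ?M)\<^sup>2)" by (intro mult_left_mono) simp_all
      also have "\<dots> = 4 * L * ?M\<^sup>2 * (1/2) ^ n"
        by (simp add: c_def power2_eq_square power_divide)
      also have "2 ^ n * norm ((f (y + c *\<^sub>R (k + l)) + f y) - (f (y + c *\<^sub>R k) + f (y + c *\<^sub>R l)))
         = norm (2 ^ n * ((f (y + c *\<^sub>R (k + l)) + f y) - (f (y + c *\<^sub>R k) + f (y + c *\<^sub>R l))))"
        by (simp add: abs_mult)
      also have "2 ^ n * ((f (y + c *\<^sub>R (k + l)) + f y) - (f (y + c *\<^sub>R k) + f (y + c *\<^sub>R l)))
        = q n (k + l) - (q n k + q n l)"
        by (simp add: q_def c_def algebra_simps)
      finally show ?thesis .
    qed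
    have z: "(\<lambda>n. 4 * L * ?M\<^sup>2 * (1/2) ^ n) \<longlonglongrightarrow> 0"
      by (intro tendsto_mult_right_zero LIMSEQ_power_zero) simp
    have "\<forall>\<^sub>F n in sequentially. norm (q n (k + l) - (q n k + q n l)) \<le> 4 * L * ?M\<^sup>2 * (1/2) ^ n"
      unfolding eventually_sequentially using bound by blast
    then have "(\<lambda>n. q n (k + l) - (q n k + q n l)) \<longlonglongrightarrow> 0"
      using z by (rule Lim_null_comparison)
    moreover have "(\<lambda>n. q n (k + l) - (q n k + q n l)) \<longlonglongrightarrow> p (k + l) - (p k + p l)"
      by (intro tendsto_intros p)
    ultimately have "p (k + l) - (p k + p l) = 0" using LIMSEQ_unique by blast
    then show ?thesis by simp
  qed
  then have lin: "linear p" using pL by (rule additive_bounded_imp_linear)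
  show thesis
  proof
    fix k :: 'a assume k: "norm k < s"
    have "p k = p (\<Sum>b\<in>Basis. (k \<bullet> b) *\<^sub>R b)" by (simp add: euclidean_representation)
    also have "\<dots> = k \<bullet> (\<Sum>b\<in>Basis. p b *\<^sub>R b)"
      by (simp add: linear_sum[OF lin] linear_scale[OF lin] inner_sum_right mult.commute)
    finally show "\<bar>f (y + k) - f y - k \<bullet> (\<Sum>b\<in>Basis. p b *\<^sub>R b)\<bar> \<le> L * (norm k)\<^sup>2"
      using p0[OF k] by simp
  qed
qed

lemma GDERIV_quadratic_error:
  assumes "s > 0" and "\<And>k. norm k < s \<Longrightarrow> \<bar>f (y + k) - f y - k \<bullet> D\<bar> \<le> L * (norm k)\<^sup>2"
  shows "GDERIV f y :> D"
  unfolding gderiv_def has_derivative_at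
proof
  show "bounded_linear (\<lambda>h. h \<bullet> D)" by (rule bounded_linear_inner_left)
  show "(\<lambda>h. norm (f (y + h) - f y - h \<bullet> D) / norm h) \<midarrow>0\<rightarrow> 0"
  proof (rule Lim_null_comparison)
    have "((\<lambda>h::'a. L * norm h) \<longlongrightarrow> L * norm (0::'a)) (at 0)"
      by (intro tendsto_mult tendsto_const tendsto_norm tendsto_ident_at)
    then show "((\<lambda>h::'a. L * norm h) \<longlongrightarrow> 0) (at 0)" by simp
    show "\<forall>\<^sub>F h in at 0. norm (norm (f (y + h) - f y - h \<bullet> D) / norm h) \<le> L * norm h"
      unfolding eventually_at
    proof (intro exI[of _ s] conjI ballI impI)
      fix h :: 'a assume "h \<noteq> 0 \<and> dist h 0 < s"
      then show "norm (norm (f (y + h) - f y - h \<bullet> D) / norm h) \<le> L * norm h"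
        using assms(2)[of h] by (simp add: power2_eq_square field_simps)
    qed (use assms in auto)
  qed
qed

text \<open>For the Lipschitz estimate the difference of the gradients at \<open>y\<close> and
  \<open>z\<close> is tested against the vector \<open>k\<close> in its own direction, of length e =
  |y - z|. The pairs y + k, z and z + k, y have the same midpoint, which costs 4 L e^2; the two
  Taylor errors cost L e^2 each. Division by \<open>e\<close> leaves 6 L e. The radius s/8 keeps all
  these points in the ball where \<open>f\<close> is controlled.\<close>

lemma locally_C11_grad:
  fixes f :: "'a::euclidean_space \<Rightarrow> real"
  assumes "locally_C11 S f" "x \<in> S"
  shows "\<exists>r>0. \<exists>L\<ge>0. ball x r \<subseteq> S \<and> (\<forall>y\<in>ball x r. GDERIV f y :> grad f y) \<and>
    (\<forall>y\<in>ball x r. \<forall>k. norm k < r \<longrightarrow> \<bar>f (y + k) - f y - k \<bullet> grad f y\<bar> \<le> L * (norm k)\<^sup>2) \<and>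
    L-lipschitz_on (ball x r) (grad f)"
proof -
  obtain s L where s: "s > 0" "ball x s \<subseteq> S" and f: "C11_bound L (ball x s) f"
    using locally_C11_obtain[OF assms] by metis
  have L: "0 \<le> L" by (rule C11_bound_nonneg[OF f])
  have tay: "GDERIV f y :> grad f y \<and> (\<forall>k. norm k < s / 2 \<longrightarrow> \<bar>f (y + k) - f y - k \<bullet> grad f y\<bar> \<le> L * (norm k)\<^sup>2)"
    if y: "y \<in> ball x (s / 2)" for y
  proof -
    have "ball y (s / 2) \<subseteq> ball x s"
    proof
      fix z assume "z \<in> ball y (s / 2)"
      then show "z \<in> ball x s" using y dist_triangle[of x z y] by simp
    qed
    then have "C11_bound L (ball y (s / 2)) f" by (intro C11_bound_mono[OF f]) auto
    from C11_bound_Taylor[OF this] obtain D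
      where D: "\<And>k. norm k < s / 2 \<Longrightarrow> \<bar>f (y + k) - f y - k \<bullet> D\<bar> \<le> L * (norm k)\<^sup>2" using s by auto
    then have G: "GDERIV f y :> D" using s by (intro GDERIV_quadratic_error[of "s / 2"]) auto
    then have "grad f y = D" by (rule GDERIV_grad)
    then show ?thesis using D G by blast
  qed
  let ?r = "s / 8"
  show ?thesis
  proof (rule exI[of _ ?r], rule conjI, use s in simp, rule exI[of _ "6 * L"], intro conjI ballI allI impI)
    show "0 \<le> 6 * L" "ball x ?r \<subseteq> S" using s L by auto
    show "GDERIV f y :> grad f y" if "y \<in> ball x ?r" for y using tay[of y] that s by auto
    show "\<bar>f (y + k) - f y - k \<bullet> grad f y\<bar> \<le> 6 * L * (norm k)\<^sup>2" if "y \<in> ball x ?r" "norm k < ?r" for y k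
    proof -
      have "\<bar>f (y + k) - f y - k \<bullet> grad f y\<bar> \<le> L * (norm k)\<^sup>2" using tay[of y] that s by auto
      also have "\<dots> \<le> 6 * L * (norm k)\<^sup>2" using L by (intro mult_right_mono) auto
      finally show ?thesis .
    qed
    show "(6 * L)-lipschitz_on (ball x ?r) (grad f)"
    proof (rule lipschitz_onI)
      show "0 \<le> 6 * L" using L by simp
      fix y z assume yz: "y \<in> ball x ?r" "z \<in> ball x ?r"
      define e where "e = norm (y - z)"
      have "e \<le> dist x y + dist x z" unfolding e_def by (metis dist_commute dist_norm dist_triangle2)
      then have e: "0 \<le> e" "e < s / 4" using yz by (auto simp: e_def)
      define k where "k = e *\<^sub>R sgn (grad f y - grad f z)"
      have k: "norm k \<le> e" using e by (simp add: k_def norm_sgn)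
      let ?m = "(1/2) *\<^sub>R (y + z + k)"
      have dm: "y + k - ?m = (1/2) *\<^sub>R (y - z + k)" "z - ?m = - ((1/2) *\<^sub>R (y - z + k))"
        "z + k - ?m = (1/2) *\<^sub>R (z - y + k)" "y - ?m = - ((1/2) *\<^sub>R (z - y + k))"
        by (simp_all add: algebra_simps flip: scaleR_left_distrib)
      have n: "norm (y - z + k) \<le> 2 * e" "norm (z - y + k) \<le> 2 * e"
        using norm_triangle_ineq[of "y - z" k] norm_triangle_ineq[of "z - y" k] k
        by (simp_all add: e_def norm_minus_commute)
      have nm: "norm (y + k - ?m) \<le> e" "norm (z - ?m) \<le> e" "norm (z + k - ?m) \<le> e" "norm (y - ?m) \<le> e"
        unfolding dm using n by simp_all
      have inb: "w \<in> ball x s" if "norm (w - z) \<le> s / 2" for w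
        using that yz s dist_triangle[of x w z] by (simp add: dist_norm norm_minus_commute)
      have yk: "norm (y + k - z) \<le> s / 2" "norm (z + k - z) \<le> s / 2" "norm (y - z) \<le> s / 2"
        using k e n s by (simp_all add: algebra_simps e_def)
      have "norm ((f (y + k) + f z) - (f (z + k) + f y)) \<le> 4 * L * e\<^sup>2"
      proof (rule C11_bound_four_point[OF f, where m = ?m])
        show "y + k \<in> ball x s" "z + k \<in> ball x s" "y \<in> ball x s" by (intro inb yk)+
        show "z \<in> ball x s" using s by (intro inb) simp
        show "?m \<in> ball x s" using nm(2) e by (intro inb) (simp add: norm_minus_commute)
        show "y + k + z = 2 *\<^sub>R ?m" "z + k + y = 2 *\<^sub>R ?m" by simp_all
      qed (use nm in auto)
      moreover have "(norm k)\<^sup>2 \<le> e\<^sup>2" using k by (intro power_mono) auto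
      then have kk: "L * (norm k)\<^sup>2 \<le> L * e\<^sup>2" using L by (rule mult_left_mono)
      have "\<bar>f (w + k) - f w - k \<bullet> grad f w\<bar> \<le> L * e\<^sup>2" if "w \<in> ball x ?r" for w
        using tay[of w] that k e kk s by (auto intro: order_trans[rotated])
      note this[OF yz(1)] this[OF yz(2)]
      ultimately have "k \<bullet> grad f y - k \<bullet> grad f z \<le> 6 * (L * e\<^sup>2)"
        by (simp add: mult.assoc)
      moreover have "k \<bullet> grad f y - k \<bullet> grad f z = e * norm (grad f y - grad f z)"
        unfolding k_def inner_diff_right[symmetric]
        by (cases "grad f y = grad f z")
          (simp_all add: sgn_div_norm power2_norm_eq_inner[symmetric] power2_eq_square)
      ultimately have "e * norm (grad f y - grad f z) \<le> e * (6 * L * e)"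
        by (simp add: power2_eq_square mult_ac)
      then show "dist (grad f y) (grad f z) \<le> 6 * L * dist y z"
        using e(1) by (cases "e = 0") (auto simp: dist_norm e_def)
    qed
  qed
qed

section \<open>Gronwall estimates, exponential tails and iterated contractions\<close>

text \<open>The square of the norm is used because the norm is not differentiable at zeros of
  \<open>w\<close>. By 2 c |w| <= c^2 + |w|^2 its derivative is at most (2 L + 1) |w|^2 + c^2, so
  \<open>q\<close> is nonincreasing. The bound on \<open>w'\<close> is asked on the open interval
  only, which is what a bootstrap argument knows before its last time.\<close>

lemma gronwall:
  fixes w :: "real \<Rightarrow> 'a::real_inner"
  assumes der: "\<And>t. t \<in> {0..T} \<Longrightarrow> (w has_vector_derivative w' t) (at t within {0..T})"
    and bd: "\<And>t. 0 < t \<Longrightarrow> t < T \<Longrightarrow> norm (w' t) \<le> L * norm (w t) + c"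
    and nonneg: "0 \<le> L" "0 \<le> c" "0 \<le> T"
  shows "norm (w T) \<le> exp ((2 * L + 1) * T) * (norm (w 0) + c * (1 + T))"
proof -
  let ?k = "2 * L + 1"
  define q where "q t = exp (- ?k * t) * (w t \<bullet> w t) - c\<^sup>2 * t" for t
  have contw: "continuous_on {0..T} w"
    using der has_vector_derivative_continuous by (fastforce simp: continuous_on_eq_continuous_within)
  have "q T \<le> q 0"
  proof (rule DERIV_nonpos_imp_decreasing_open[where f = q and a = 0 and b = T])
    show "continuous_on {0..T} q" unfolding q_def by (intro continuous_intros contw)
    fix t assume t: "0 < t" "t < T"
    have "(w has_vector_derivative w' t) (at t)"
      using der[of t] t by (simp add: at_within_Icc_at)
    then have w: "(w has_derivative (\<lambda>h. h *\<^sub>R w' t)) (at t)"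
      by (simp add: has_vector_derivative_def)
    have "((\<lambda>t. w t \<bullet> w t) has_real_derivative 2 * (w t \<bullet> w' t)) (at t)"
      unfolding has_field_derivative_def
      by (rule has_derivative_eq_rhs[OF has_derivative_inner[OF w w]])
         (auto simp: inner_commute fun_eq_iff)
    then have d: "(q has_real_derivative (exp (- ?k * t) * (2 * (w t \<bullet> w' t)) - ?k * exp (- ?k * t) * (w t \<bullet> w t) - c\<^sup>2)) (at t)"
      unfolding q_def by (auto intro!: derivative_eq_intros simp: algebra_simps)
    let ?n = "norm (w t)"
    have "w t \<bullet> w' t \<le> ?n * norm (w' t)" by (rule norm_cauchy_schwarz)
    also have "\<dots> \<le> ?n * (L * ?n + c)" by (intro mult_left_mono bd t) auto
    finally have "2 * (w t \<bullet> w' t) - ?k * (w t \<bullet> w t) \<le> 2 * (?n * (L * ?n + c)) - ?k * ?n\<^sup>2"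
      by (simp add: power2_norm_eq_inner)
    also have "\<dots> = c\<^sup>2 - (c - ?n)\<^sup>2" by (simp add: power2_eq_square algebra_simps)
    also have "\<dots> \<le> c\<^sup>2" by simp
    finally have "exp (- ?k * t) * (2 * (w t \<bullet> w' t) - ?k * (w t \<bullet> w t)) \<le> exp (- ?k * t) * c\<^sup>2"
      by (intro mult_left_mono) auto
    also have "\<dots> \<le> 1 * c\<^sup>2"
    proof (rule mult_right_mono)
      show "exp (- ?k * t) \<le> 1" using nonneg t by (simp add: mult_nonpos_nonneg)
    qed simp
    finally show "\<exists>y. (q has_real_derivative y) (at t) \<and> y \<le> 0"
      using d by (intro exI[of _ "exp (- ?k * t) * (2 * (w t \<bullet> w' t)) - ?k * exp (- ?k * t) * (w t \<bullet> w t) - c\<^sup>2"])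
        (simp add: algebra_simps)
  qed (rule nonneg(3))
  then have "exp (- ?k * T) * (norm (w T))\<^sup>2 \<le> (norm (w 0))\<^sup>2 + c\<^sup>2 * T"
    by (simp add: q_def power2_norm_eq_inner)
  then have le: "exp (?k * T) * (exp (- ?k * T) * (norm (w T))\<^sup>2) \<le> exp (?k * T) * ((norm (w 0))\<^sup>2 + c\<^sup>2 * T)"
    by (rule mult_left_mono) simp
  have "(norm (w T))\<^sup>2 \<le> exp (?k * T) * ((norm (w 0))\<^sup>2 + c\<^sup>2 * T)"
  proof -
    have "exp (?k * T) * exp (- ?k * T) = 1" by (simp add: mult_exp_exp algebra_simps)
    then have "exp (?k * T) * (exp (- ?k * T) * (norm (w T))\<^sup>2) = (norm (w T))\<^sup>2"
      by (simp only: mult.assoc[symmetric] mult_1)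
    with le show ?thesis by (simp only:)
  qed
  also have "\<dots> \<le> (exp (?k * T))\<^sup>2 * (norm (w 0) + c * (1 + T))\<^sup>2"
  proof (rule mult_mono)
    have "1 \<le> exp (?k * T)" using nonneg by simp
    then show "exp (?k * T) \<le> (exp (?k * T))\<^sup>2" by (simp add: power2_eq_square)
    have "T \<le> (1 + T)\<^sup>2" using nonneg(3) by (simp add: power2_eq_square algebra_simps)
    then have "c\<^sup>2 * T \<le> (c * (1 + T))\<^sup>2"
      by (simp add: power_mult_distrib mult_left_mono)
    moreover have "0 \<le> 2 * norm (w 0) * (c * (1 + T))" using nonneg by simp
    ultimately show "(norm (w 0))\<^sup>2 + c\<^sup>2 * T \<le> (norm (w 0) + c * (1 + T))\<^sup>2"
      unfolding power2_sum by linarith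
  qed (use nonneg in auto)
  finally have "(norm (w T))\<^sup>2 \<le> (exp (?k * T) * (norm (w 0) + c * (1 + T)))\<^sup>2"
    by (simp add: power_mult_distrib)
  then show ?thesis by (rule power2_le_imp_le) (use nonneg in simp)
qed

text \<open>The set of failures is closed, so there would be a first failure; there
  \<open>step\<close> applies and contradicts it. The case t = 0 is contained in
  \<open>step\<close>, with nothing assumed.\<close>

lemma continuous_bootstrap_less:
  fixes d :: "real \<Rightarrow> real"
  assumes cont: "continuous_on {0..T} d"
    and step: "\<And>t. t \<in> {0..T} \<Longrightarrow> (\<And>s. 0 \<le> s \<Longrightarrow> s < t \<Longrightarrow> d s < \<rho>) \<Longrightarrow> d t < \<rho>"
    and t: "t \<in> {0..T}"
  shows "d t < \<rho>"
proof (rule ccontr)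
  define A where "A = {t \<in> {0..T}. \<rho> \<le> d t}"
  assume "\<not> d t < \<rho>"
  then have ne: "A \<noteq> {}" using t by (auto simp: A_def)
  have bb: "bdd_below A" unfolding A_def by (auto intro: bdd_belowI[of _ 0])
  have "closed A" unfolding A_def
    by (intro continuous_closed_preimage_constant continuous_on_closed_Collect_le cont continuous_intros)
  then have inA: "Inf A \<in> A" using closed_contains_Inf[OF ne bb] by blast
  have "d (Inf A) < \<rho>"
  proof (rule step)
    show "Inf A \<in> {0..T}" using inA by (simp add: A_def)
    fix s assume s: "0 \<le> s" "s < Inf A"
    then have "s \<notin> A" using cInf_lower[OF _ bb] by force
    then show "d s < \<rho>" using s inA by (auto simp: A_def)
  qed
  then show False using inA by (simp add: A_def)
qed

text \<open>The integral over the half-line is a gauge integral and not a limit by definition. The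
  exponential majorant makes the tail integrable and bounds it by (M / \<nu>) exp(- \<nu>
  T).\<close>

lemma exp_bound_integral_tendsto:
  fixes f :: "real \<Rightarrow> real"
  assumes cont: "continuous_on {0..} f" and bd: "\<And>t. t \<ge> 0 \<Longrightarrow> \<bar>f t\<bar> \<le> M * exp (- \<nu> * t)" and \<nu>: "\<nu> > 0"
  shows "((\<lambda>T. integral {0..T} f) \<longlongrightarrow> integral {0..} f) at_top"
proof -
  have E: "((\<lambda>t. M * exp (- \<nu> * t)) has_integral M * (exp (- \<nu> * T) / \<nu>)) {T..}" for T
    by (intro has_integral_mult_right has_integral_exp_minus_to_infinity \<nu>)
  have int: "f integrable_on {T..}" if "T \<ge> 0" for T
  proof (rule integrable_on_all_intervals_integrable_bound)
    show "(\<lambda>x. if x \<in> {T..} then f x else 0) integrable_on cbox a b" for a b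
    proof -
      have "{T..} \<inter> cbox a b = {max T a..b}" by auto
      moreover have "f integrable_on {max T a..b}"
        using that by (intro integrable_continuous_real continuous_on_subset[OF cont]) auto
      ultimately show ?thesis unfolding integrable_restrict_Int by simp
    qed
    show "norm (f x) \<le> M * exp (- \<nu> * x)" if "x \<in> {T..}" for x using that \<open>T \<ge> 0\<close> bd by auto
    show "(\<lambda>t. M * exp (- \<nu> * t)) integrable_on {T..}" using E by blast
  qed
  have diff: "\<bar>integral {0..T} f - integral {0..} f\<bar> \<le> M / \<nu> * exp (- \<nu> * T)" if T: "T \<ge> 0" for T
  proof -
    have "(f has_integral (integral {0..T} f + integral {T..} f)) ({0..T} \<union> {T..})"
    proof (rule has_integral_Un)
      show "(f has_integral integral {0..T} f) {0..T}"
        by (intro integrable_integral integrable_continuous_real continuous_on_subset[OF cont]) auto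
      show "(f has_integral integral {T..} f) {T..}" by (intro integrable_integral int T)
      have "{0..T} \<inter> {T..} = {T}" using T by auto
      then show "negligible ({0..T} \<inter> {T..})" by simp
    qed
    moreover have "{0..T} \<union> {T..} = {0..}" using T by auto
    ultimately have "integral {0..} f = integral {0..T} f + integral {T..} f"
      using integral_unique by metis
    moreover have "norm (integral {T..} f) \<le> integral {T..} (\<lambda>t. M * exp (- \<nu> * t))"
      using T bd E int by (intro integral_norm_bound_integral) auto
    ultimately show ?thesis using integral_unique[OF E, of T] by simp
  qed
  have "((\<lambda>T. M / \<nu> * exp (- \<nu> * T)) \<longlongrightarrow> 0) at_top"
    using \<nu> by real_asymp
  then have "((\<lambda>T. integral {0..T} f - integral {0..} f) \<longlongrightarrow> 0) at_top"
    by (rule Lim_null_comparison[rotated]) (use diff in \<open>auto simp: eventually_at_top_linorder\<close>)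
  then show ?thesis using Lim_null by blast
qed

text \<open>
  Doubling the step \<open>d\<close> repeatedly changes \<open>2\<^sup>k (\<Phi> (a + d) - \<Phi> a)\<close> only quadratically, so
  \<open>\<Phi>\<close> being small at distance \<open>R\<close> from \<open>a\<close> makes its Lipschitz constant small.
\<close>

lemma C11_bound_contraction:
  fixes \<Phi> :: "'a::real_normed_vector \<Rightarrow> 'a"
  assumes \<Phi>: "C11_bound L (ball 0 r) \<Phi>" and r: "r > 0"
    and small: "\<And>x. x \<in> ball 0 r \<Longrightarrow> norm (\<Phi> x) \<le> norm x / 16"
  shows "\<exists>\<rho>>0. \<rho> \<le> r \<and> (\<forall>a\<in>ball 0 \<rho>. \<forall>b\<in>ball 0 \<rho>. norm (\<Phi> a - \<Phi> b) \<le> norm (a - b) / 2)"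
proof -
  have L: "0 \<le> L" by (rule C11_bound_nonneg[OF \<Phi>])
  \<comment> \<open>R <= r/4 keeps all points used, of norm below 3 R, in the ball of radius
    \<open>r\<close>. The second bound gives 8 L R <= 1, so that a quadratic error L N^2 with N < 2
    R is at most N/4.\<close>
  define R where "R = min (r / 4) (1 / (8 * (L + 1)))"
  have R: "R > 0" "4 * R \<le> r" using r L by (auto simp: R_def)
  have "R \<le> 1 / (8 * (L + 1))" by (simp add: R_def)
  then have LR: "8 * (L * R) \<le> 1" using L R(1) by (simp add: field_simps)
  show ?thesis
  proof (intro exI[of _ "R / 2"] conjI ballI)
    show "R / 2 > 0" "R / 2 \<le> r" using R by auto
    fix a b :: 'a assume ab: "a \<in> ball 0 (R / 2)" "b \<in> ball 0 (R / 2)"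
    show "norm (\<Phi> a - \<Phi> b) \<le> norm (a - b) / 2"
    proof (cases "a = b")
      case False
      define d where "d = b - a"
      have d: "norm d > 0" "norm d < R"
        using False ab norm_triangle_ineq4[of b a] by (auto simp: d_def)
      have a: "norm a < R" using ab R by auto
      \<comment> \<open>The first doubling that reaches length \<open>R\<close>. As it is the first,
        the length is still below 2 R; as |d| < R, at least one doubling takes place.\<close>
      define k where "k = (LEAST k. R \<le> 2 ^ k * norm d)"
      obtain k' :: nat where "R / norm d < 2 ^ k'" using real_arch_pow[of 2 "R / norm d"] by auto
      then have "R \<le> 2 ^ k' * norm d" using d by (simp add: field_simps)
      then have k1: "R \<le> 2 ^ k * norm d" unfolding k_def by (rule LeastI)
      have "k \<noteq> 0"
      proof
        assume "k = 0"
        then show False using k1 d by simp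
      qed
      then obtain j where j: "k = Suc j" using not0_implies_Suc by blast
      have "\<not> R \<le> 2 ^ j * norm d" using not_less_Least[of j "\<lambda>k. R \<le> 2 ^ k * norm d"] j by (simp add: k_def)
      then have k2: "2 ^ k * norm d < 2 * R" by (simp add: j)
      have inb: "a + 2 ^ i *\<^sub>R d \<in> ball 0 r" if "i \<le> k" for i
      proof -
        have "2 ^ i * norm d \<le> 2 ^ k * norm d" using that by (intro mult_right_mono power_increasing) auto
        then show ?thesis using k2 a R norm_triangle_ineq[of a "2 ^ i *\<^sub>R d"] by simp
      qed
      have ina: "a \<in> ball 0 r" using a R by simp
      have E: "norm (\<Phi> (a + 2 ^ i *\<^sub>R d) - \<Phi> a - 2 ^ i *\<^sub>R (\<Phi> (a + d) - \<Phi> a)) \<le> L * (2 ^ i * norm d)\<^sup>2"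
        if "i \<le> k" for i
        using that
      proof (induction i)
        case (Suc i)
        define e where "e = 2 ^ i *\<^sub>R d"
        have e2: "a + 2 ^ Suc i *\<^sub>R d = a + 2 *\<^sub>R e" by (simp add: e_def)
        have "norm (\<Phi> (a + 2 *\<^sub>R e) + \<Phi> a - 2 *\<^sub>R \<Phi> (a + e))
          \<le> L * (norm (a + 2 *\<^sub>R e + a - 2 *\<^sub>R (a + e)) + (norm (a + 2 *\<^sub>R e - (a + e)))\<^sup>2 + (norm (a - (a + e)))\<^sup>2)"
          using inb[of "Suc i"] inb[of i] Suc.prems ina
          unfolding e2 by (intro C11_bound_second[OF \<Phi>]) (auto simp: e_def)
        also have "\<dots> = L * (2 * (norm e)\<^sup>2)"
        proof -
          have "a + 2 *\<^sub>R e + a - 2 *\<^sub>R (a + e) = 0" "a + 2 *\<^sub>R e - (a + e) = e" "a - (a + e) = - e"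
            by (simp_all add: scaleR_2)
          then show ?thesis by simp
        qed
        finally have A: "norm (\<Phi> (a + 2 *\<^sub>R e) + \<Phi> a - 2 *\<^sub>R \<Phi> (a + e)) \<le> L * (2 * (norm e)\<^sup>2)" .
        have B: "norm (2 *\<^sub>R (\<Phi> (a + e) - \<Phi> a - 2 ^ i *\<^sub>R (\<Phi> (a + d) - \<Phi> a))) \<le> 2 * (L * (norm e)\<^sup>2)"
          using Suc by (simp add: e_def)
        have "\<Phi> (a + 2 ^ Suc i *\<^sub>R d) - \<Phi> a - 2 ^ Suc i *\<^sub>R (\<Phi> (a + d) - \<Phi> a)
          = (\<Phi> (a + 2 *\<^sub>R e) + \<Phi> a - 2 *\<^sub>R \<Phi> (a + e)) + 2 *\<^sub>R (\<Phi> (a + e) - \<Phi> a - 2 ^ i *\<^sub>R (\<Phi> (a + d) - \<Phi> a))"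
          unfolding e2 by (simp add: scaleR_2 scaleR_diff_right)
        also have "norm \<dots> \<le> L * (2 * (norm e)\<^sup>2) + 2 * (L * (norm e)\<^sup>2)"
          by (intro norm_triangle_le add_mono A B)
        also have "\<dots> = L * (2 ^ Suc i * norm d)\<^sup>2"
          by (simp add: e_def power_mult_distrib)
        finally show ?case .
      qed (use L in simp)
      let ?D = "2 ^ k *\<^sub>R (\<Phi> (a + d) - \<Phi> a)" and ?N = "2 ^ k * norm d"
      have "2 ^ k * norm (\<Phi> (a + d) - \<Phi> a) = norm ?D" by simp
      \<comment> \<open>With N = 2^k |d| >= R, the values of \<Phi> contribute at most 3R/16 + R/16
        <= N/4, and the doubling error at most N/4 again; together they give the factor 1/2.\<close>
      also have "?D = \<Phi> (a + 2 ^ k *\<^sub>R d) - \<Phi> a - (\<Phi> (a + 2 ^ k *\<^sub>R d) - \<Phi> a - ?D)" by simp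
      also have "norm \<dots> \<le> (norm (\<Phi> (a + 2 ^ k *\<^sub>R d)) + norm (\<Phi> a)) + L * ?N\<^sup>2"
        by (intro order_trans[OF norm_triangle_ineq4] add_mono norm_triangle_ineq4 E) simp
      also have "\<dots> \<le> (3 * R / 16 + R / 16) + L * ?N\<^sup>2"
      proof -
        have "norm (\<Phi> (a + 2 ^ k *\<^sub>R d)) \<le> norm (a + 2 ^ k *\<^sub>R d) / 16" by (intro small inb) simp
        also have "norm (a + 2 ^ k *\<^sub>R d) \<le> 3 * R" using k2 a norm_triangle_ineq[of a "2 ^ k *\<^sub>R d"] by simp
        finally show ?thesis using small[OF ina] a by simp
      qed
      also have "L * ?N\<^sup>2 = L * ?N * ?N" by (simp only: power2_eq_square mult.assoc)
      also have "L * ?N * ?N \<le> L * (2 * R) * ?N"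
        by (intro mult_right_mono mult_left_mono) (use k2 L in auto)
      also have "L * (2 * R) * ?N \<le> 1/4 * ?N" using LR by (intro mult_right_mono) auto
      also have "3 * R / 16 + R / 16 \<le> 1/4 * ?N" using k1 by simp
      finally have "2 ^ k * norm (\<Phi> (a + d) - \<Phi> a) \<le> 2 ^ k * (norm d / 2)" by simp
      then have "norm (\<Phi> (a + d) - \<Phi> a) \<le> norm d / 2" by simp
      then show ?thesis by (simp add: d_def norm_minus_commute)
    qed simp
  qed
qed

text \<open>Distances of iterates shrink like 2^(-i), their squares like 4^(-i). Hence the second
  differences satisfy s_(i+1) <= s_i / 2 + c q 4^(-i), with \<open>q\<close> the sum of the two
  squares; \<open>seci\<close> is the exact solution of this recursion, of order 2^(-i). The
  constants are therefore summable and the bound does not depend on \<open>n\<close>.\<close>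

lemma C11_bound_iterate_sum:
  fixes \<Phi> :: "'a::real_normed_vector \<Rightarrow> 'a" and g :: "'a \<Rightarrow> 'b::real_normed_vector"
  assumes map: "\<And>x. x \<in> U \<Longrightarrow> \<Phi> x \<in> U"
    and lip: "\<And>a b. a \<in> U \<Longrightarrow> b \<in> U \<Longrightarrow> norm (\<Phi> a - \<Phi> b) \<le> norm (a - b) / 2"
    and sec: "\<And>a b m. a \<in> U \<Longrightarrow> b \<in> U \<Longrightarrow> m \<in> U \<Longrightarrow> norm (\<Phi> a + \<Phi> b - 2 *\<^sub>R \<Phi> m)
       \<le> norm (a + b - 2 *\<^sub>R m) / 2 + c * ((norm (a - m))\<^sup>2 + (norm (b - m))\<^sup>2)"
    and c: "0 \<le> c" and g: "C11_bound M U g"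
  shows "C11_bound (2 * (M * (1 + 4 * c))) U (\<lambda>x. \<Sum>i<n. g ((\<Phi> ^^ i) x))"
proof -
  have M: "0 \<le> M" by (rule C11_bound_nonneg[OF g])
  have it: "(\<Phi> ^^ i) x \<in> U" if "x \<in> U" for i x
    using that by (induction i) (auto intro: map)
  have lipi: "norm ((\<Phi> ^^ i) a - (\<Phi> ^^ i) b) \<le> norm (a - b) / 2 ^ i" if "a \<in> U" "b \<in> U" for a b i
  proof (induction i)
    case (Suc i)
    have "norm ((\<Phi> ^^ Suc i) a - (\<Phi> ^^ Suc i) b) \<le> norm ((\<Phi> ^^ i) a - (\<Phi> ^^ i) b) / 2"
      using lip it that by simp
    also have "\<dots> \<le> norm (a - b) / 2 ^ i / 2" using Suc by simp
    finally show ?case by (simp add: mult.commute)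
  qed simp
  have seci: "norm ((\<Phi> ^^ i) a + (\<Phi> ^^ i) b - 2 *\<^sub>R (\<Phi> ^^ i) m)
      \<le> (norm (a + b - 2 *\<^sub>R m) + 4 * c * ((norm (a - m))\<^sup>2 + (norm (b - m))\<^sup>2) * (1 - 1 / 2 ^ i)) / 2 ^ i"
    if U: "a \<in> U" "b \<in> U" "m \<in> U" for a b m i
  proof (induction i)
    case (Suc i)
    let ?q = "(norm (a - m))\<^sup>2 + (norm (b - m))\<^sup>2"
    have sq: "(norm ((\<Phi> ^^ i) z - (\<Phi> ^^ i) m))\<^sup>2 \<le> (norm (z - m))\<^sup>2 / 2 ^ i / 2 ^ i" if "z \<in> U" for z
      using power_mono[OF lipi[OF that U(3)] norm_ge_zero, of i 2]
      by (simp add: power_divide power2_eq_square mult.assoc)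
    have "norm ((\<Phi> ^^ Suc i) a + (\<Phi> ^^ Suc i) b - 2 *\<^sub>R (\<Phi> ^^ Suc i) m)
      \<le> norm ((\<Phi> ^^ i) a + (\<Phi> ^^ i) b - 2 *\<^sub>R (\<Phi> ^^ i) m) / 2 + c * ((norm ((\<Phi> ^^ i) a - (\<Phi> ^^ i) m))\<^sup>2 + (norm ((\<Phi> ^^ i) b - (\<Phi> ^^ i) m))\<^sup>2)"
      using sec it U by simp
    also have "\<dots> \<le> (norm (a + b - 2 *\<^sub>R m) + 4 * c * ?q * (1 - 1 / 2 ^ i)) / 2 ^ i / 2 + c * ((norm (a - m))\<^sup>2 / 2 ^ i / 2 ^ i + (norm (b - m))\<^sup>2 / 2 ^ i / 2 ^ i)"
      by (intro add_mono divide_right_mono Suc.IH mult_left_mono sq U c) auto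
    also have "\<dots> = (norm (a + b - 2 *\<^sub>R m) + 4 * c * ?q * (1 - 1 / 2 ^ Suc i)) / 2 ^ Suc i"
      by (simp add: field_simps)
    finally show ?case .
  qed simp
  have gi: "C11_bound (M * (1 + 4 * c) * (1/2) ^ i) U (\<lambda>x. g ((\<Phi> ^^ i) x))" for i
  proof (rule C11_boundI)
    show "0 \<le> M * (1 + 4 * c) * (1/2) ^ i" using M c by simp
    fix a b m assume ab: "a \<in> U" "b \<in> U"
    have "norm (g ((\<Phi> ^^ i) a) - g ((\<Phi> ^^ i) b)) \<le> M * norm ((\<Phi> ^^ i) a - (\<Phi> ^^ i) b)"
      by (intro C11_bound_lipschitz[OF g] it ab)
    also have "\<dots> \<le> M * (norm (a - b) / 2 ^ i)" by (intro mult_left_mono lipi ab M)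
    also have "\<dots> \<le> M * (1 + 4 * c) * (norm (a - b) / 2 ^ i)"
      using M c by (intro mult_right_mono) (auto simp: algebra_simps)
    finally show "norm (g ((\<Phi> ^^ i) a) - g ((\<Phi> ^^ i) b)) \<le> M * (1 + 4 * c) * (1/2) ^ i * norm (a - b)"
      by (simp add: power_divide)
    assume m: "m \<in> U"
    let ?q = "(norm (a - m))\<^sup>2 + (norm (b - m))\<^sup>2" and ?d = "norm (a + b - 2 *\<^sub>R m)"
    have sq: "(norm ((\<Phi> ^^ i) z - (\<Phi> ^^ i) m))\<^sup>2 \<le> (norm (z - m))\<^sup>2 / 2 ^ i / 2 ^ i" if "z \<in> U" for z
      using power_mono[OF lipi[OF that m] norm_ge_zero, of i 2]
      by (simp add: power_divide power2_eq_square mult.assoc)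
    have "norm (g ((\<Phi> ^^ i) a) + g ((\<Phi> ^^ i) b) - 2 *\<^sub>R g ((\<Phi> ^^ i) m))
      \<le> M * (norm ((\<Phi> ^^ i) a + (\<Phi> ^^ i) b - 2 *\<^sub>R (\<Phi> ^^ i) m) + (norm ((\<Phi> ^^ i) a - (\<Phi> ^^ i) m))\<^sup>2 + (norm ((\<Phi> ^^ i) b - (\<Phi> ^^ i) m))\<^sup>2)"
      by (intro C11_bound_second[OF g] it ab m)
    also have "\<dots> \<le> M * ((?d + 4 * c * ?q * (1 - 1 / 2 ^ i)) / 2 ^ i + (norm (a - m))\<^sup>2 / 2 ^ i / 2 ^ i + (norm (b - m))\<^sup>2 / 2 ^ i / 2 ^ i)"
      by (intro mult_left_mono add_mono seci sq ab m M)
    also have "\<dots> \<le> M * ((1 + 4 * c) * (?d + ?q) / 2 ^ i)"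
    proof (intro mult_left_mono M)
      have "0 \<le> c * ?d" using c by simp
      moreover have "1 / 2 ^ i * ?q \<le> 1 * ?q" by (intro mult_right_mono) auto
      moreover have "4 * c * ?q * (1 - 1 / 2 ^ i) \<le> 4 * c * ?q * 1" using c by (intro mult_left_mono) auto
      ultimately have "(?d + 4 * c * ?q * (1 - 1 / 2 ^ i)) + 1 / 2 ^ i * ?q \<le> (1 + 4 * c) * (?d + ?q)"
        by (simp add: algebra_simps)
      then have "((?d + 4 * c * ?q * (1 - 1 / 2 ^ i)) + 1 / 2 ^ i * ?q) / 2 ^ i \<le> (1 + 4 * c) * (?d + ?q) / 2 ^ i"
        by (rule divide_right_mono) simp
      then show "(?d + 4 * c * ?q * (1 - 1 / 2 ^ i)) / 2 ^ i + (norm (a - m))\<^sup>2 / 2 ^ i / 2 ^ i + (norm (b - m))\<^sup>2 / 2 ^ i / 2 ^ i \<le> \<dots>"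
        by (simp add: add_divide_distrib)
    qed
    finally show "norm (g ((\<Phi> ^^ i) a) + g ((\<Phi> ^^ i) b) - 2 *\<^sub>R g ((\<Phi> ^^ i) m))
      \<le> M * (1 + 4 * c) * (1/2) ^ i * (norm (a + b - 2 *\<^sub>R m) + (norm (a - m))\<^sup>2 + (norm (b - m))\<^sup>2)"
      by (simp add: power_divide mult.assoc add.assoc)
  qed
  have "C11_bound (\<Sum>i<n. M * (1 + 4 * c) * (1/2) ^ i) U (\<lambda>x. \<Sum>i<n. g ((\<Phi> ^^ i) x))"
  proof (induction n)
    case 0
    show ?case by (simp add: C11_bound_def)
  next
    case (Suc n)
    show ?case using C11_bound_add[OF Suc gi[of n]] by simp
  qed
  moreover have "(\<Sum>i<n. M * (1 + 4 * c) * (1/2) ^ i) \<le> 2 * (M * (1 + 4 * c))"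
  proof -
    have "(\<Sum>i<n. (1/2::real) ^ i) \<le> (\<Sum>i. (1/2) ^ i)" by (intro sum_le_suminf) auto
    also have "\<dots> = 2" by (simp add: suminf_geometric)
    finally have "M * (1 + 4 * c) * (\<Sum>i<n. (1/2::real) ^ i) \<le> M * (1 + 4 * c) * 2"
      using M c by (intro mult_left_mono) auto
    also have "M * (1 + 4 * c) * (\<Sum>i<n. (1/2::real) ^ i) = (\<Sum>i<n. M * (1 + 4 * c) * (1/2) ^ i)"
      by (rule sum_distrib_left)
    finally show ?thesis by (simp only: mult_ac)
  qed
  ultimately show ?thesis by (rule C11_bound_mono) simp
qed

text \<open>The defining inequalities involve values only, so a pointwise limit inherits them with
  the same constant; no convergence of derivatives has to be shown.\<close>

lemma C11_bound_limit:
  assumes f: "\<And>n::nat. C11_bound L U (f n)" and lim: "\<And>x. x \<in> U \<Longrightarrow> (\<lambda>n. f n x) \<longlonglongrightarrow> g x"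
  shows "C11_bound L U g"
proof (rule C11_boundI)
  show "0 \<le> L" using C11_bound_nonneg[OF f] .
  fix a b m assume ab: "a \<in> U" "b \<in> U"
  have "(\<lambda>n. norm (f n a - f n b)) \<longlonglongrightarrow> norm (g a - g b)" by (intro tendsto_intros lim ab)
  then show "norm (g a - g b) \<le> L * norm (a - b)"
    by (rule LIMSEQ_le_const2) (use C11_bound_lipschitz[OF f ab] in blast)
  assume m: "m \<in> U"
  have "(\<lambda>n. norm (f n a + f n b - 2 *\<^sub>R f n m)) \<longlonglongrightarrow> norm (g a + g b - 2 *\<^sub>R g m)"
    by (intro tendsto_intros lim ab m)
  then show "norm (g a + g b - 2 *\<^sub>R g m) \<le> L * (norm (a + b - 2 *\<^sub>R m) + (norm (a - m))\<^sup>2 + (norm (b - m))\<^sup>2)"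
    by (rule LIMSEQ_le_const2) (use C11_bound_second[OF f ab m] in blast)
qed

lemma C11_bound_integral:
  fixes f :: "real \<Rightarrow> 'a::real_normed_vector \<Rightarrow> 'b::banach"
  assumes f: "\<And>t. t \<in> {0..T} \<Longrightarrow> C11_bound L U (f t)" and T: "0 \<le> T"
    and cont: "\<And>x. x \<in> U \<Longrightarrow> continuous_on {0..T} (\<lambda>t. f t x)"
  shows "C11_bound (L * T) U (\<lambda>x. integral {0..T} (\<lambda>t. f t x))"
proof (rule C11_boundI)
  show "0 \<le> L * T" using C11_bound_nonneg[OF f[of 0]] T by simp
  have int: "(\<lambda>t. f t x) integrable_on {0..T}" if "x \<in> U" for x
    using cont[OF that] by (rule integrable_continuous_real)
  fix a b m assume ab: "a \<in> U" "b \<in> U"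
  have "norm (integral {0..T} (\<lambda>t. f t a - f t b)) \<le> (L * norm (a - b)) * (T - 0)"
    using C11_bound_lipschitz[OF f ab] by (intro integral_bound T continuous_intros cont ab) auto
  then show "norm (integral {0..T} (\<lambda>t. f t a) - integral {0..T} (\<lambda>t. f t b)) \<le> L * T * norm (a - b)"
    by (simp add: integral_diff int ab mult_ac)
  assume m: "m \<in> U"
  have "norm (integral {0..T} (\<lambda>t. f t a + f t b - 2 *\<^sub>R f t m))
    \<le> (L * (norm (a + b - 2 *\<^sub>R m) + (norm (a - m))\<^sup>2 + (norm (b - m))\<^sup>2)) * (T - 0)"
    using C11_bound_second[OF f ab m] by (intro integral_bound T continuous_intros cont ab m) auto
  also have "integral {0..T} (\<lambda>t. f t a + f t b - 2 *\<^sub>R f t m)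
    = integral {0..T} (\<lambda>t. f t a) + integral {0..T} (\<lambda>t. f t b) - 2 *\<^sub>R integral {0..T} (\<lambda>t. f t m)"
    using int ab m by (simp add: integral_diff integral_add integrable_add integrable_cmul)
  finally show "norm (integral {0..T} (\<lambda>t. f t a) + integral {0..T} (\<lambda>t. f t b) - 2 *\<^sub>R integral {0..T} (\<lambda>t. f t m))
    \<le> L * T * (norm (a + b - 2 *\<^sub>R m) + (norm (a - m))\<^sup>2 + (norm (b - m))\<^sup>2)"
    by (simp add: mult_ac)
qed

section \<open>Ordinary differential equations with Lipschitz right-hand side\<close>

definition locally_lipschitz_on :: "'a::metric_space set \<Rightarrow> ('a \<Rightarrow> 'b::metric_space) \<Rightarrow> bool" where
  "locally_lipschitz_on S f \<longleftrightarrow> (\<forall>x\<in>S. \<exists>r>0. \<exists>L. L-lipschitz_on (ball x r) f)"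

section \<open>Calculus of locally Lipschitz maps\<close>

lemma locally_lipschitz_on_imp_continuous:
  assumes "locally_lipschitz_on S f"
  shows "continuous_on S f"
proof (rule continuous_at_imp_continuous_on, rule ballI)
  fix x assume "x \<in> S"
  then obtain r L where r: "r > 0" "L-lipschitz_on (ball x r) f"
    using assms unfolding locally_lipschitz_on_def by blast
  then have "continuous_on (ball x r) f" using lipschitz_on_continuous_on by blast
  then show "isCont f x" using r(1) by (simp add: continuous_on_eq_continuous_at)
qed

lemma locally_lipschitz_on_const: "locally_lipschitz_on S (\<lambda>_. a)"
  unfolding locally_lipschitz_on_def using lipschitz_on_constant zero_less_one by blast

lemma locally_lipschitz_on_add:
  fixes f g :: "'a::metric_space \<Rightarrow> 'b::real_normed_vector"
  assumes "locally_lipschitz_on S f" "locally_lipschitz_on S g"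
  shows "locally_lipschitz_on S (\<lambda>x. f x + g x)"
  unfolding locally_lipschitz_on_def
proof
  fix x assume x: "x \<in> S"
  obtain r L where f: "r > 0" "L-lipschitz_on (ball x r) f"
    using assms(1) x unfolding locally_lipschitz_on_def by blast
  obtain s M where g: "s > 0" "M-lipschitz_on (ball x s) g"
    using assms(2) x unfolding locally_lipschitz_on_def by blast
  have "(L + M)-lipschitz_on (ball x (min r s)) (\<lambda>x. f x + g x)"
    by (intro lipschitz_on_add lipschitz_on_subset[OF f(2)] lipschitz_on_subset[OF g(2)]) auto
  then show "\<exists>r>0. \<exists>L. L-lipschitz_on (ball x r) (\<lambda>x. f x + g x)"
    using f(1) g(1) by (meson min_less_iff_conj)
qed

lemma lipschitz_on_ball_bounded:
  fixes f :: "'a::metric_space \<Rightarrow> 'b::real_normed_vector"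
  assumes f: "L-lipschitz_on (ball x t) f" and y: "y \<in> ball x t"
  shows "norm (f y) \<le> norm (f x) + L * t"
proof -
  have "t > 0" using y zero_le_dist[of x y] by (simp only: mem_ball)
  then have "dist (f y) (f x) \<le> L * dist y x" using y by (intro lipschitz_onD[OF f]) auto
  also have "\<dots> \<le> L * t" using y lipschitz_on_nonneg[OF f]
    by (intro mult_left_mono) (auto simp: dist_commute)
  finally show ?thesis using norm_triangle_sub[of "f y" "f x"] by (simp add: dist_norm)
qed

lemma (in bounded_bilinear) lipschitz_on_bilinear:
  assumes f: "L-lipschitz_on U f" and g: "M-lipschitz_on U g"
    and P: "\<And>x. x \<in> U \<Longrightarrow> norm (f x) \<le> P" and Q: "\<And>x. x \<in> U \<Longrightarrow> norm (g x) \<le> Q"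
  shows "\<exists>N. N-lipschitz_on U (\<lambda>x. prod (f x) (g x))"
proof (cases "U = {}")
  case False
  obtain K where K: "K > 0" "\<And>a b. norm (prod a b) \<le> norm a * norm b * K"
    using pos_bounded by blast
  have L: "0 \<le> L" and M: "0 \<le> M" using f g lipschitz_on_nonneg by auto
  have PQ: "0 \<le> P" "0 \<le> Q"
    using False P Q by (meson equals0I norm_ge_zero order_trans)+
  have bd: "norm (prod a b) \<le> p * q * K" if "norm a \<le> p" "norm b \<le> q" for a b p q
  proof -
    have "norm a * norm b \<le> p * q"
      using that by (meson mult_mono norm_ge_zero order_trans)
    then show ?thesis using K(2)[of a b] K(1) by (meson less_imp_le mult_right_mono order_trans)
  qed
  have "(P * M * K + L * Q * K)-lipschitz_on U (\<lambda>x. prod (f x) (g x))"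
  proof (rule lipschitz_onI)
    show "0 \<le> P * M * K + L * Q * K" using L M PQ K by simp
    fix x y assume xy: "x \<in> U" "y \<in> U"
    have "prod (f x) (g x) - prod (f y) (g y) = prod (f x) (g x - g y) + prod (f x - f y) (g y)"
      by (simp add: diff_left diff_right)
    also have "norm \<dots> \<le> P * (M * dist x y) * K + (L * dist x y) * Q * K"
      using lipschitz_onD[OF f xy] lipschitz_onD[OF g xy]
      by (intro norm_triangle_le add_mono bd P Q xy) (simp_all add: dist_norm)
    finally show "dist (prod (f x) (g x)) (prod (f y) (g y)) \<le> (P * M * K + L * Q * K) * dist x y"
      by (simp add: dist_norm algebra_simps)
  qed
  then show ?thesis ..
qed (auto intro: exI[of _ 0])

lemma locally_lipschitz_on_bilinear:
  fixes B :: "'b::real_normed_vector \<Rightarrow> 'c::real_normed_vector \<Rightarrow> 'd::real_normed_vector"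
  assumes B: "bounded_bilinear B" and "locally_lipschitz_on S f" "locally_lipschitz_on S g"
  shows "locally_lipschitz_on S (\<lambda>x. B (f x) (g x))"
  unfolding locally_lipschitz_on_def
proof
  fix x assume x: "x \<in> S"
  obtain r L where f: "r > 0" "L-lipschitz_on (ball x r) f"
    using assms(2) x unfolding locally_lipschitz_on_def by blast
  obtain s M where g: "s > 0" "M-lipschitz_on (ball x s) g"
    using assms(3) x unfolding locally_lipschitz_on_def by blast
  define t where "t = min r s"
  have t: "t > 0" using f g by (simp add: t_def)
  have ft: "L-lipschitz_on (ball x t) f" and gt: "M-lipschitz_on (ball x t) g"
    by (auto intro!: lipschitz_on_subset[OF f(2)] lipschitz_on_subset[OF g(2)] simp: t_def)
  show "\<exists>r>0. \<exists>L. L-lipschitz_on (ball x r) (\<lambda>x. B (f x) (g x))"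
    using bounded_bilinear.lipschitz_on_bilinear[OF B ft gt lipschitz_on_ball_bounded[OF ft]
        lipschitz_on_ball_bounded[OF gt]] t by blast
qed

lemma locally_lipschitz_on_compact:
  fixes f :: "'a::metric_space \<Rightarrow> 'b::metric_space"
  assumes f: "locally_lipschitz_on S f" and K: "compact K" "K \<subseteq> S"
  shows "\<exists>L. L-lipschitz_on K f"
proof -
  \<comment> \<open>An autonomous map is viewed as a time-dependent one over the single time
    0.\<close>
  have "local_lipschitz {0::real} K (\<lambda>_. f)"
    unfolding local_lipschitz_def
  proof (intro ballI)
    fix x and t :: real assume "x \<in> K"
    then obtain r L where r: "r > 0" "L-lipschitz_on (ball x r) f"
      using f K(2) unfolding locally_lipschitz_on_def by blast
    then have "L-lipschitz_on (cball x (r / 2) \<inter> K) f" by (intro lipschitz_on_subset[OF r(2)]) auto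
    then show "\<exists>u>0. \<exists>L. \<forall>t\<in>cball t u \<inter> {0}. L-lipschitz_on (cball x u \<inter> K) f"
      using r(1) by (intro exI[of _ "r / 2"]) auto
  qed
  then obtain L where "\<And>t. t \<in> {0::real} \<Longrightarrow> L-lipschitz_on K f"
    by (rule local_lipschitz_compact_implies_lipschitz[OF _ K(1)]) auto
  then show ?thesis by blast
qed

text \<open>\<open>F\<close> is multiplied by a cutoff \<eta> that is 1 on \<open>K\<close> and
  falls linearly to 0 at distance \<rho>. Outside the compact neighbourhood \<open>K'\<close>
  nothing is known about \<open>F\<close>, so the increment is written with \<open>F\<close> at a
  point y of \<open>K'\<close> in the second term: if x lies outside, the first term vanishes with
  \<eta> x.\<close>

lemma lipschitz_extension_compact:
  fixes F :: "'a::euclidean_space \<Rightarrow> 'b::real_normed_vector"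
  assumes F: "locally_lipschitz_on S F" and S: "open S" and K: "compact K" "K \<subseteq> S" "K \<noteq> {}"
  shows "\<exists>G L M. L-lipschitz_on UNIV G \<and> (\<forall>x. norm (G x) \<le> M) \<and> (\<forall>x\<in>K. G x = F x)"
proof -
  obtain \<rho> where \<rho>: "\<rho> > 0" "(\<Union>x\<in>K. cball x \<rho>) \<subseteq> S"
    using compact_subset_open_imp_cball_epsilon_subset[OF K(1) S K(2)] by blast
  define K' where "K' = {x. infdist x K \<le> \<rho>}"
  have K': "compact K'" unfolding K'_def by (rule compact_infdist_le[OF K(3,1) \<rho>(1)])
  have K'S: "K' \<subseteq> S"
  proof
    fix x assume "x \<in> K'"
    moreover obtain k where "k \<in> K" "infdist x K = dist x k"
      using infdist_attains_inf[OF compact_imp_closed[OF K(1)] K(3)] by blast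
    ultimately show "x \<in> S" using \<rho>(2) by (force simp: K'_def dist_commute)
  qed
  obtain L where L: "L-lipschitz_on K' F" using locally_lipschitz_on_compact[OF F K' K'S] by blast
  have "compact (F ` K')"
    using K' K'S continuous_on_subset[OF locally_lipschitz_on_imp_continuous[OF F]]
    by (intro compact_continuous_image) auto
  then have "bounded (F ` K')" by (rule compact_imp_bounded)
  then obtain B where "B > 0" "\<forall>y\<in>F ` K'. norm y \<le> B" unfolding bounded_pos by blast
  then have B: "B > 0" "\<And>x. x \<in> K' \<Longrightarrow> norm (F x) \<le> B" by auto
  define \<eta> where "\<eta> x = max 0 (1 - infdist x K / \<rho>)" for x
  have \<eta>: "0 \<le> \<eta> x" "\<eta> x \<le> 1" for x using \<rho>(1) infdist_nonneg[of x K] by (auto simp: \<eta>_def)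
  have \<eta>0: "\<eta> x = 0" if "x \<notin> K'" for x using that \<rho>(1) by (auto simp: \<eta>_def K'_def)
  have \<eta>1: "\<eta> x = 1" if "x \<in> K" for x using that by (simp add: \<eta>_def)
  have \<eta>L: "\<bar>\<eta> x - \<eta> y\<bar> \<le> dist x y / \<rho>" for x y
  proof -
    have "\<bar>\<eta> x - \<eta> y\<bar> \<le> \<bar>infdist x K / \<rho> - infdist y K / \<rho>\<bar>" by (simp add: \<eta>_def max_def abs_minus_commute)
    also have "\<dots> = \<bar>infdist x K - infdist y K\<bar> / \<rho>" using \<rho>(1) by (simp add: diff_divide_distrib[symmetric])
    also have "\<dots> \<le> dist x y / \<rho>" using \<rho>(1) infdist_triangle_abs[of x K y] by (intro divide_right_mono) auto
    finally show ?thesis .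
  qed
  define G where "G x = \<eta> x *\<^sub>R F x" for x
  have L0: "0 \<le> L" by (rule lipschitz_on_nonneg[OF L])
  have G1: "dist (G x) (G y) \<le> (L + B / \<rho>) * dist x y" if y: "y \<in> K'" for x y
  proof -
    have e: "\<bar>\<eta> x - \<eta> y\<bar> * norm (F y) \<le> dist x y / \<rho> * B"
      using \<rho>(1) by (intro mult_mono \<eta>L B(2) y) auto
    have a: "\<eta> x * norm (F x - F y) \<le> L * dist x y"
    proof (cases "x \<in> K'")
      case True
      have "\<eta> x * norm (F x - F y) \<le> 1 * (L * dist x y)"
        using lipschitz_onD[OF L True y] by (intro mult_mono \<eta>) (auto simp: dist_norm)
      then show ?thesis by simp
    qed (use \<eta>0 L0 in simp)
    have "G x - G y = \<eta> x *\<^sub>R (F x - F y) + (\<eta> x - \<eta> y) *\<^sub>R F y"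
      by (simp add: G_def algebra_simps)
    also have "norm \<dots> \<le> \<eta> x * norm (F x - F y) + \<bar>\<eta> x - \<eta> y\<bar> * norm (F y)"
      using \<eta>(1)[of x] by (intro order_trans[OF norm_triangle_ineq]) simp
    also have "\<dots> \<le> L * dist x y + dist x y / \<rho> * B" by (intro add_mono a e)
    finally show ?thesis by (simp add: dist_norm algebra_simps)
  qed
  have "(L + B / \<rho>)-lipschitz_on UNIV G"
  proof (rule lipschitz_onI)
    show "0 \<le> L + B / \<rho>" using L0 B(1) \<rho>(1) by simp
    fix x y
    consider "y \<in> K'" | "x \<in> K'" | "x \<notin> K'" "y \<notin> K'" by blast
    then show "dist (G x) (G y) \<le> (L + B / \<rho>) * dist x y"
    proof cases
      case 1
      then show ?thesis by (rule G1)
    next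
      case 2
      from G1[OF this, of y] show ?thesis by (simp add: dist_commute)
    next
      case 3
      then show ?thesis using L0 B(1) \<rho>(1) by (simp add: G_def \<eta>0)
    qed
  qed
  moreover have "norm (G x) \<le> B" for x
  proof (cases "x \<in> K'")
    case True
    have "norm (G x) \<le> 1 * B" unfolding G_def norm_scaleR using \<eta>[of x] B(2)[OF True]
      by (intro mult_mono) auto
    then show ?thesis by simp
  qed (use \<eta>0 B(1) in \<open>simp add: G_def\<close>)
  moreover have "\<forall>x\<in>K. G x = F x" by (simp add: G_def \<eta>1)
  ultimately show ?thesis by blast
qed

text \<open>The truncation \<open>max 0 t\<close> continues the primitive to negative times, since
  bounded continuous functions on the whole line are the space of the fixed-point argument.\<close>

lemma integral_bounded_lipschitz:
  fixes H :: "real \<Rightarrow> 'a::banach"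
  assumes cont: "continuous_on UNIV H" and M: "\<And>t. norm (H t) \<le> M"
  shows "M-lipschitz_on UNIV (\<lambda>t. integral {0..max 0 t} H)"
proof -
  have *: "norm (integral {0..max 0 t} H - integral {0..max 0 s} H) \<le> M * \<bar>t - s\<bar>" if "s \<le> t" for s t
  proof -
    have int: "H integrable_on {a..b}" for a b
      by (rule integrable_continuous_real[OF continuous_on_subset[OF cont]]) simp
    have M0: "0 \<le> M" using M[of 0] norm_ge_zero order_trans by blast
    have "integral {0..max 0 s} H + integral {max 0 s..max 0 t} H = integral {0..max 0 t} H"
      using that by (intro Henstock_Kurzweil_Integration.integral_combine int) auto
    then have "integral {0..max 0 t} H - integral {0..max 0 s} H = integral {max 0 s..max 0 t} H"
      by (simp add: algebra_simps)
    also have "norm \<dots> \<le> M * (max 0 t - max 0 s)"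
      using that M by (intro integral_bound continuous_on_subset[OF cont]) auto
    also have "\<dots> \<le> M * \<bar>t - s\<bar>" using that M0 by (intro mult_left_mono) auto
    finally show ?thesis .
  qed
  show ?thesis
  proof (rule lipschitz_onI)
    show "0 \<le> M" using M[of 0] norm_ge_zero order_trans by blast
    show "dist (integral {0..max 0 t} H) (integral {0..max 0 s} H) \<le> M * dist t s" for s t
      using *[of s t] *[of t s] by (cases "s \<le> t") (auto simp: dist_norm norm_minus_commute)
  qed
qed

text \<open>
  Picard iteration for \<open>z t = exp (- k t) y t\<close>: the weight makes the integral operator a
  contraction on the whole half-line, so no continuation of local solutions is needed.
\<close>

lemma global_lipschitz_ode_exists:
  fixes G :: "'a::euclidean_space \<Rightarrow> 'a"
  assumes L: "L-lipschitz_on UNIV G" and M: "\<And>x. norm (G x) \<le> M"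
  shows "\<exists>y. y 0 = x0 \<and> (\<forall>t\<ge>0. (y has_vector_derivative G (y t)) (at t within {0..}))"
proof -
  \<comment> \<open>The contraction factor will be L / k <= 1/2. Since k >= 1, also t exp(- k t) <=
    1, which keeps the image of the operator bounded although the integral may grow
    linearly.\<close>
  define k where "k = 2 * (L + 1)"
  have L0: "0 \<le> L" by (rule lipschitz_on_nonneg[OF L])
  then have k: "k \<ge> 1" "k > 0" "L / k \<le> 1/2" by (auto simp: k_def field_simps)
  have M0: "0 \<le> M" using M[of 0] norm_ge_zero order_trans by blast
  have contG: "continuous_on UNIV G" by (rule lipschitz_on_continuous_on[OF L])
  define H where "H z s = G (exp (k * s) *\<^sub>R apply_bcontfun z s)" for z :: "real \<Rightarrow>\<^sub>C 'a" and s
  have contH: "continuous_on A (H z)" for z A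
    unfolding H_def by (rule continuous_on_compose2[OF contG]) (auto intro!: continuous_intros)
  define P where "P z t = exp (- k * max 0 t) *\<^sub>R (x0 + integral {0..max 0 t} (H z))" for z t
  have lipI: "M-lipschitz_on UNIV (\<lambda>t. integral {0..max 0 t} (H z))" for z
    by (rule integral_bounded_lipschitz[OF contH]) (simp add: H_def M)
  have Pb: "P z \<in> bcontfun" for z
  proof (rule bcontfun_normI)
    show "continuous_on UNIV (P z)" unfolding P_def
      by (intro continuous_intros lipschitz_on_continuous_on[OF lipI])
    show "norm (P z t) \<le> norm x0 + M" for t
    proof -
      let ?c = "max 0 t"
      have "norm (integral {0..?c} (H z)) \<le> M * (?c - 0)"
        by (intro integral_bound contH) (auto simp: H_def M)
      then have "norm (x0 + integral {0..?c} (H z)) \<le> norm x0 + M * ?c"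
        by (intro norm_triangle_le) simp
      then have "norm (P z t) \<le> exp (- k * ?c) * (norm x0 + M * ?c)"
        unfolding P_def by (simp add: mult_left_mono)
      also have "\<dots> = exp (- k * ?c) * norm x0 + M * (exp (- k * ?c) * ?c)" by (simp add: algebra_simps)
      also have "\<dots> \<le> 1 * norm x0 + M * 1"
      proof (intro add_mono mult_right_mono mult_left_mono)
        have "?c \<le> k * ?c" using k(1) by (simp add: mult_le_cancel_right1)
        also have "\<dots> \<le> exp (k * ?c)" using exp_ge_add_one_self[of "k * ?c"] by linarith
        finally have "exp (- k * ?c) * ?c \<le> exp (- k * ?c) * exp (k * ?c)" by (intro mult_left_mono) auto
        then show "exp (- k * ?c) * ?c \<le> 1" by (simp add: exp_minus)
        show "exp (- k * ?c) \<le> 1" using k(2) by simp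
      qed (use M0 in auto)
      finally show ?thesis by simp
    qed
  qed
  define Q where "Q z = Bcontfun (P z)" for z
  have Q: "apply_bcontfun (Q z) = P z" for z unfolding Q_def by (rule Bcontfun_inverse[OF Pb])
  have "dist (Q z) (Q w) \<le> 1/2 * dist z w" for z w
  proof (rule dist_bound)
    fix t :: real
    let ?c = "max 0 t" and ?d = "dist z w"
    have int: "H z integrable_on {0..?c}" for z by (intro integrable_continuous_real contH)
    have E: "((\<lambda>s. L * ?d * exp (k * s)) has_integral (L * ?d * exp (k * ?c) / k - L * ?d * exp (k * 0) / k)) {0..?c}"
      by (rule fundamental_theorem_of_calculus)
        (use k(2) in \<open>auto intro!: derivative_eq_intros simp flip: has_real_derivative_iff_has_vector_derivative\<close>)
    have "norm (integral {0..?c} (\<lambda>s. H z s - H w s)) \<le> integral {0..?c} (\<lambda>s. L * ?d * exp (k * s))"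
    proof (rule integral_norm_bound_integral)
      show "(\<lambda>s. H z s - H w s) integrable_on {0..?c}" by (intro integrable_diff int)
      show "(\<lambda>s. L * ?d * exp (k * s)) integrable_on {0..?c}" using E by blast
      fix s
      have "norm (H z s - H w s) \<le> L * dist (exp (k * s) *\<^sub>R apply_bcontfun z s) (exp (k * s) *\<^sub>R apply_bcontfun w s)"
        using lipschitz_onD[OF L] by (simp add: H_def dist_norm)
      also have "\<dots> = L * (exp (k * s) * dist (apply_bcontfun z s) (apply_bcontfun w s))"
        by (simp add: dist_norm flip: scaleR_diff_right)
      also have "\<dots> \<le> L * (exp (k * s) * ?d)" using L0 by (intro mult_left_mono dist_bounded) auto
      finally show "norm (H z s - H w s) \<le> L * ?d * exp (k * s)" by (simp add: mult_ac)
    qed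
    also have "\<dots> = L * ?d * exp (k * ?c) / k - L * ?d * exp (k * 0) / k" using E by (rule integral_unique)
    also have "\<dots> \<le> L * ?d * exp (k * ?c) / k" using L0 k(2) by simp
    also have "\<dots> = (L / k) * (?d * exp (k * ?c))" by simp
    also have "\<dots> \<le> 1/2 * (?d * exp (k * ?c))" by (intro mult_right_mono k) auto
    finally have le: "norm (integral {0..?c} (H z) - integral {0..?c} (H w)) \<le> 1/2 * (?d * exp (k * ?c))"
      by (simp add: integral_diff int)
    have "P z t - P w t = exp (- k * ?c) *\<^sub>R (integral {0..?c} (H z) - integral {0..?c} (H w))"
      by (simp add: P_def algebra_simps)
    then have "dist (P z t) (P w t) = exp (- k * ?c) * norm (integral {0..?c} (H z) - integral {0..?c} (H w))"
      by (simp add: dist_norm)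
    also have "\<dots> \<le> exp (- k * ?c) * (1/2 * (?d * exp (k * ?c)))" by (intro mult_left_mono le) auto
    also have "\<dots> = 1/2 * ?d" by (simp add: exp_minus)
    finally show "dist (apply_bcontfun (Q z) t) (apply_bcontfun (Q w) t) \<le> 1/2 * ?d" by (simp add: Q)
  qed
  then obtain z where z: "Q z = z" using banach_fix_type[of "1/2" Q] by auto
  define y where "y t = exp (k * t) *\<^sub>R apply_bcontfun z t" for t
  have y: "y t = x0 + integral {0..t} (\<lambda>s. G (y s))" if "t \<ge> 0" for t
  proof -
    have "apply_bcontfun z t = exp (- k * t) *\<^sub>R (x0 + integral {0..t} (H z))"
      using Q[of z] that unfolding z by (simp add: P_def)
    then have "y t = (exp (k * t) * exp (- k * t)) *\<^sub>R (x0 + integral {0..t} (H z))" by (simp add: y_def)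
    also have "exp (k * t) * exp (- k * t) = 1" by (simp add: exp_minus)
    finally show ?thesis by (simp add: H_def y_def)
  qed
  have conty: "continuous_on A (\<lambda>s. G (y s))" for A using contH[of A z] by (simp add: H_def[abs_def] y_def)
  show ?thesis
  proof (intro exI conjI allI impI)
    show "y 0 = x0" using y[of 0] by simp
    fix t :: real assume t: "t \<ge> 0"
    have "((\<lambda>t. integral {0..t} (\<lambda>s. G (y s))) has_vector_derivative G (y t)) (at t within {0..t + 1})"
      using t by (intro integral_has_vector_derivative conty) auto
    then have "((\<lambda>t. x0 + integral {0..t} (\<lambda>s. G (y s))) has_vector_derivative 0 + G (y t)) (at t within {0..t + 1})"
      by (intro has_vector_derivative_add has_vector_derivative_const)
    then have "((\<lambda>t. x0 + integral {0..t} (\<lambda>s. G (y s))) has_vector_derivative G (y t)) (at t within {0..t + 1})"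
      by simp
    then have "(y has_vector_derivative G (y t)) (at t within {0..t + 1})"
      by (rule has_vector_derivative_transform[rotated 2]) (use t y in auto)
    moreover have "at t within {0..t + 1} = at t within {0..}"
      by (rule at_within_nhd[of t "{..<t + 1}"]) auto
    ultimately show "(y has_vector_derivative G (y t)) (at t within {0..})" by simp
  qed
qed

section \<open>Cost along an exponentially stable flow\<close>

lemma GDERIV_chain:
  assumes "GDERIV v (y t) :> D" "(y has_vector_derivative y') (at t within I)"
  shows "((\<lambda>t. v (y t)) has_real_derivative (y' \<bullet> D)) (at t within I)"
proof -
  have "((\<lambda>t. v (y t)) has_derivative (\<lambda>h. (h *\<^sub>R y') \<bullet> D)) (at t within I)"
    using has_derivative_compose[of y _ t I v] assms
    unfolding gderiv_def has_vector_derivative_def by blast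
  then show ?thesis unfolding has_field_derivative_def
    by (rule has_derivative_eq_rhs) (simp add: fun_eq_iff mult.commute)
qed

text \<open>The flow is described by its properties instead of by \<open>trajectory\<close>. The
  orbits of \<open>F\<close> need not be shown unique again here: uniqueness enters only through the
  semigroup law.\<close>

locale stable_flow =
  fixes F :: "'a::euclidean_space \<Rightarrow> 'a" and S :: "'a set" and \<phi> :: "'a \<Rightarrow> real \<Rightarrow> 'a"
  assumes open_S: "open S" and zero_in: "0 \<in> S"
    and F_C11: "locally_C11 S F" and F_zero: "F 0 = 0"
    and sol: "\<And>x. x \<in> S \<Longrightarrow> solves F S x {0..} (\<phi> x)"
    and semigroup: "\<And>x s t. x \<in> S \<Longrightarrow> 0 \<le> s \<Longrightarrow> 0 \<le> t \<Longrightarrow> \<phi> (\<phi> x s) t = \<phi> x (s + t)"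
    and attract: "\<And>x. x \<in> S \<Longrightarrow> (\<phi> x \<longlongrightarrow> 0) at_top"
    and exp_stable: "\<exists>\<epsilon> C \<nu>. \<epsilon> > 0 \<and> C > 0 \<and> \<nu> > 0 \<and> ball 0 \<epsilon> \<subseteq> S \<and>
        (\<forall>x\<in>ball 0 \<epsilon>. \<forall>t\<ge>0. norm (\<phi> x t) \<le> C * exp (- \<nu> * t) * norm x)"
begin

section \<open>Regularity of the flow on compact time intervals\<close>

lemma flow_0: "x \<in> S \<Longrightarrow> \<phi> x 0 = x"
  using sol unfolding solves_def by blast

lemma flow_in: "x \<in> S \<Longrightarrow> t \<ge> 0 \<Longrightarrow> \<phi> x t \<in> S"
  using sol unfolding solves_def by simp

lemma flow_deriv:
  "x \<in> S \<Longrightarrow> t \<ge> 0 \<Longrightarrow> I \<subseteq> {0..} \<Longrightarrow> (\<phi> x has_vector_derivative F (\<phi> x t)) (at t within I)"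
  using sol unfolding solves_def by (auto intro: has_vector_derivative_within_subset)

lemma flow_cont: "x \<in> S \<Longrightarrow> I \<subseteq> {0..} \<Longrightarrow> continuous_on I (\<phi> x)"
  unfolding continuous_on_eq_continuous_within
  using flow_deriv has_vector_derivative_continuous by blast

lemma flow_zero: assumes "t \<ge> 0" shows "\<phi> 0 t = 0"
proof -
  obtain \<epsilon> C \<nu> where "\<epsilon> > 0" "\<And>y t. y \<in> ball 0 \<epsilon> \<Longrightarrow> t \<ge> 0 \<Longrightarrow> norm (\<phi> y t) \<le> C * exp (- \<nu> * t) * norm y"
    using exp_stable by blast
  from this(2)[of 0 t] this(1) assms show ?thesis by simp
qed

text \<open>In a tube around the orbit of \<open>x0\<close> the field \<open>F\<close> has uniform
  constants. The Lipschitz estimate presupposes that trajectories stay in the tube, and it confines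
  them to the tube; the bootstrap resolves this circle. The second difference \<open>?w\<close> of
  trajectories then satisfies |w'| <= L |w| + L E^2 q, and Gronwall's inequality applies once
  more.\<close>

lemma flow_C11:
  assumes x0: "x0 \<in> S" and T: "T \<ge> 0"
  shows "\<exists>r>0. \<exists>L. ball x0 r \<subseteq> S \<and> (\<forall>t\<in>{0..T}. C11_bound L (ball x0 r) (\<lambda>x. \<phi> x t))"
proof -
  have "compact (\<phi> x0 ` {0..T})" "\<phi> x0 ` {0..T} \<subseteq> S"
    using flow_cont[OF x0] flow_in[OF x0] by (auto intro!: compact_continuous_image)
  from locally_C11_uniform[OF F_C11 this] obtain r0 L where r0: "r0 > 0" and L: "L \<ge> 0"
    and loc: "\<And>t. t \<in> {0..T} \<Longrightarrow> C11_bound L (ball (\<phi> x0 t) r0) F"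
    by (metis imageI)
  define E where "E = exp ((2 * L + 1) * T)"
  have E: "E \<ge> 1" "\<And>t. t \<in> {0..T} \<Longrightarrow> exp ((2 * L + 1) * t) \<le> E"
    using L T by (auto simp: E_def intro!: mult_left_mono)
  obtain s where s: "s > 0" "ball x0 s \<subseteq> S" using open_S x0 openE by blast
  \<comment> \<open>Initial distances are magnified at most by the factor \<open>E\<close>, so
    radius r0 / E keeps trajectories in the tube of radius \<open>r0\<close>.\<close>
  define r where "r = min s (r0 / E)"
  have "r \<le> s" "r \<le> r0 / E" by (auto simp: r_def)
  moreover from this have "E * r \<le> E * (r0 / E)" using E(1) by (intro mult_left_mono) auto
  ultimately have r: "r > 0" "ball x0 r \<subseteq> S" "E * r \<le> r0"
    using s E(1) r0 by (auto simp: r_def)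
  have lip_aux: "norm (\<phi> a t - \<phi> b t) \<le> E * norm (a - b)"
    if a: "a \<in> S" and b: "b \<in> S" and t: "t \<in> {0..T}"
      and tube: "\<And>\<tau>. 0 \<le> \<tau> \<Longrightarrow> \<tau> < t \<Longrightarrow> \<phi> a \<tau> \<in> ball (\<phi> x0 \<tau>) r0 \<and> \<phi> b \<tau> \<in> ball (\<phi> x0 \<tau>) r0"
    for a b t
  proof -
    have "norm (\<phi> a t - \<phi> b t) \<le> exp ((2 * L + 1) * t) * (norm (\<phi> a 0 - \<phi> b 0) + 0 * (1 + t))"
    proof (rule gronwall)
      fix \<tau> assume "\<tau> \<in> {0..t}"
      then show "((\<lambda>\<tau>. \<phi> a \<tau> - \<phi> b \<tau>) has_vector_derivative F (\<phi> a \<tau>) - F (\<phi> b \<tau>)) (at \<tau> within {0..t})"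
        using a b by (intro has_vector_derivative_diff flow_deriv) auto
    next
      fix \<tau> assume "0 < \<tau>" "\<tau> < t"
      then show "norm (F (\<phi> a \<tau>) - F (\<phi> b \<tau>)) \<le> L * norm (\<phi> a \<tau> - \<phi> b \<tau>) + 0"
        using tube[of \<tau>] t C11_bound_lipschitz[OF loc[of \<tau>]] by auto
    qed (use L t in auto)
    also have "\<dots> = exp ((2 * L + 1) * t) * norm (a - b)" using a b by (simp add: flow_0)
    also have "\<dots> \<le> E * norm (a - b)" by (intro mult_right_mono E t) auto
    finally show ?thesis .
  qed
  have tube: "\<phi> a t \<in> ball (\<phi> x0 t) r0" if a: "a \<in> ball x0 r" and t: "t \<in> {0..T}" for a t
  proof -
    have aS: "a \<in> S" using a r by blast
    have "norm (\<phi> a t - \<phi> x0 t) < r0"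
    proof (rule continuous_bootstrap_less[where T = T and d = "\<lambda>t. norm (\<phi> a t - \<phi> x0 t)"])
      show "continuous_on {0..T} (\<lambda>t. norm (\<phi> a t - \<phi> x0 t))"
        using flow_cont aS x0 by (intro continuous_intros) auto
      fix t assume t: "t \<in> {0..T}" and small: "\<And>s. 0 \<le> s \<Longrightarrow> s < t \<Longrightarrow> norm (\<phi> a s - \<phi> x0 s) < r0"
      have "norm (\<phi> a t - \<phi> x0 t) \<le> E * norm (a - x0)"
        using small r0 by (intro lip_aux aS x0 t) (auto simp: dist_norm norm_minus_commute)
      also have "\<dots> < E * r"
        using a E by (intro mult_strict_left_mono) (auto simp: dist_norm norm_minus_commute)
      also have "\<dots> \<le> r0" by (rule r)
      finally show "norm (\<phi> a t - \<phi> x0 t) < r0" .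
    qed (rule t)
    then show ?thesis by (simp add: dist_norm norm_minus_commute)
  qed
  have lip: "norm (\<phi> a t - \<phi> b t) \<le> E * norm (a - b)"
    if "a \<in> ball x0 r" "b \<in> ball x0 r" "t \<in> {0..T}" for a b t
    using that r by (intro lip_aux) (auto simp del: mem_ball intro!: tube)
  \<comment> \<open>\<open>M\<close> dominates both the Lipschitz factor \<open>E\<close> and the
    constant from Gronwall's inequality with inhomogeneity L E^2 q.\<close>
  define M where "M = E * (1 + L * E\<^sup>2 * (1 + T))"
  have EM: "E \<le> M" using E L T by (auto simp: M_def)
  have "C11_bound M (ball x0 r) (\<lambda>x. \<phi> x t)" if t: "t \<in> {0..T}" for t
  proof (rule C11_boundI)
    show "0 \<le> M" using E EM by simp
    fix a b m assume ab: "a \<in> ball x0 r" "b \<in> ball x0 r"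
    show "norm (\<phi> a t - \<phi> b t) \<le> M * norm (a - b)"
      using lip[OF ab t] EM by (meson mult_right_mono norm_ge_zero order_trans)
    assume m: "m \<in> ball x0 r"
    have abm: "a \<in> S" "b \<in> S" "m \<in> S" using ab m r by auto
    let ?q = "(norm (a - m))\<^sup>2 + (norm (b - m))\<^sup>2" and ?d = "norm (a + b - 2 *\<^sub>R m)"
    let ?w = "\<lambda>t. \<phi> a t + \<phi> b t - 2 *\<^sub>R \<phi> m t"
    let ?c = "L * (E\<^sup>2 * ?q)"
    have "norm (?w t) \<le> exp ((2 * L + 1) * t) * (norm (?w 0) + ?c * (1 + t))"
    proof (rule gronwall)
      fix \<tau> assume "\<tau> \<in> {0..t}"
      then show "(?w has_vector_derivative (F (\<phi> a \<tau>) + F (\<phi> b \<tau>) - 2 *\<^sub>R F (\<phi> m \<tau>))) (at \<tau> within {0..t})"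
        using abm by (intro has_vector_derivative_diff has_vector_derivative_add flow_deriv
            bounded_linear.has_vector_derivative[OF bounded_linear_scaleR_right]) auto
    next
      fix \<tau> assume "0 < \<tau>" "\<tau> < t"
      then have \<tau>: "\<tau> \<in> {0..T}" using t by auto
      have sq: "(norm (\<phi> z \<tau> - \<phi> m \<tau>))\<^sup>2 \<le> E\<^sup>2 * (norm (z - m))\<^sup>2" if "z \<in> ball x0 r" for z
        using power_mono[OF lip[OF that m \<tau>] norm_ge_zero, of 2] by (simp add: power_mult_distrib)
      have "norm (F (\<phi> a \<tau>) + F (\<phi> b \<tau>) - 2 *\<^sub>R F (\<phi> m \<tau>))
        \<le> L * (norm (?w \<tau>) + (norm (\<phi> a \<tau> - \<phi> m \<tau>))\<^sup>2 + (norm (\<phi> b \<tau> - \<phi> m \<tau>))\<^sup>2)"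
        by (intro C11_bound_second[OF loc[OF \<tau>]] tube ab m \<tau>)
      also have "\<dots> \<le> L * (norm (?w \<tau>) + E\<^sup>2 * ?q)"
        using sq[OF ab(1)] sq[OF ab(2)] by (intro mult_left_mono L) (simp add: distrib_left)
      finally show "norm (F (\<phi> a \<tau>) + F (\<phi> b \<tau>) - 2 *\<^sub>R F (\<phi> m \<tau>)) \<le> L * norm (?w \<tau>) + ?c"
        by (simp only: distrib_left)
    qed (use L t in auto)
    also have "\<dots> \<le> E * (?d + ?c * (1 + T))"
      using abm t L E(1) by (intro mult_mono E add_mono mult_left_mono) (auto simp: flow_0)
    also have "\<dots> \<le> E * ((1 + L * E\<^sup>2 * (1 + T)) * (?d + ?q))"
      using E L T by (intro mult_left_mono) (auto simp: algebra_simps)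
    finally show "norm (?w t) \<le> M * (?d + (norm (a - m))\<^sup>2 + (norm (b - m))\<^sup>2)"
      by (simp add: M_def mult.assoc add.assoc)
  qed
  then show ?thesis using r(1,2) by blast
qed

lemma flow_compose_C11:
  assumes x0: "x0 \<in> S" and T: "T \<ge> 0" and l: "locally_C11 S l"
  shows "\<exists>r>0. \<exists>L. ball x0 r \<subseteq> S \<and> (\<forall>t\<in>{0..T}. C11_bound L (ball x0 r) (\<lambda>x. l (\<phi> x t)))"
proof -
  have "compact (\<phi> x0 ` {0..T})" "\<phi> x0 ` {0..T} \<subseteq> S"
    using flow_cont[OF x0] flow_in[OF x0] by (auto intro!: compact_continuous_image)
  from locally_C11_uniform[OF l this] obtain r1 M where r1: "r1 > 0"
    and loc: "\<And>t. t \<in> {0..T} \<Longrightarrow> C11_bound M (ball (\<phi> x0 t) r1) l"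
    by (metis imageI)
  from flow_C11[OF x0 T] obtain r L where r: "r > 0" "ball x0 r \<subseteq> S"
    and C: "\<And>t. t \<in> {0..T} \<Longrightarrow> C11_bound L (ball x0 r) (\<lambda>x. \<phi> x t)" by blast
  have L: "0 \<le> L" using C11_bound_nonneg[OF C[of 0]] T by simp
  define s where "s = min r (r1 / (L + 1))"
  have "s \<le> r" "s \<le> r1 / (L + 1)" by (auto simp: s_def)
  moreover from this have "(L + 1) * s \<le> (L + 1) * (r1 / (L + 1))" using L by (intro mult_left_mono) auto
  ultimately have s: "s > 0" "s \<le> r" "(L + 1) * s \<le> r1"
    using r(1) r1 L by (auto simp: s_def)
  have "C11_bound (M * (L + L\<^sup>2)) (ball x0 s) (\<lambda>x. l (\<phi> x t))" if t: "t \<in> {0..T}" for t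
  proof (rule C11_bound_compose[OF _ loc[OF t]])
    show "C11_bound L (ball x0 s) (\<lambda>x. \<phi> x t)"
      by (rule C11_bound_mono[OF C[OF t] order_refl subset_ball[OF s(2)]])
    show "(\<lambda>x. \<phi> x t) ` ball x0 s \<subseteq> ball (\<phi> x0 t) r1"
    proof clarify
      fix a assume a: "a \<in> ball x0 s"
      have "norm (\<phi> x0 t - \<phi> a t) \<le> L * norm (x0 - a)"
        by (rule C11_bound_lipschitz[OF C[OF t]]) (use a s(2) r(1) in simp_all)
      also have "\<dots> \<le> L * s" by (rule mult_left_mono[OF _ L]) (use a in \<open>simp add: dist_norm\<close>)
      also have "\<dots> < (L + 1) * s" using s(1) by (simp add: distrib_right)
      also have "\<dots> \<le> r1" by (rule s)
      finally show "\<phi> a t \<in> ball (\<phi> x0 t) r1" by (simp add: dist_norm)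
    qed
  qed
  moreover have "ball x0 s \<subseteq> S" using s r by auto
  ultimately show ?thesis using s(1) by blast
qed

end

text \<open>Separate from the flow because two running costs, the given one and the squared norm,
  are integrated along the same trajectories.\<close>

locale cost_flow = stable_flow F S \<phi>
  for F :: "'a::euclidean_space \<Rightarrow> 'a" and S \<phi> +
  fixes l :: "'a \<Rightarrow> real"
  assumes l_C11: "locally_C11 S l" and l_nonneg: "\<And>x. x \<in> S \<Longrightarrow> 0 \<le> l x" and l_zero: "l 0 = 0"
begin

definition v :: "'a \<Rightarrow> real" where "v x = integral {0..} (\<lambda>t. l (\<phi> x t))"

section \<open>Convergence and splitting of the cost integral\<close>

lemma cost_cont: "x \<in> S \<Longrightarrow> I \<subseteq> {0..} \<Longrightarrow> continuous_on I (\<lambda>t. l (\<phi> x t))"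
  by (rule continuous_on_compose2[OF locally_C11_continuous_on[OF l_C11] flow_cont])
     (auto intro: flow_in)

text \<open>After a finite time \<open>T\<close> the trajectory is in the region of exponential
  stability, and \<open>l\<close>, Lipschitz near 0 with l(0) = 0, inherits the decay. On the
  compact interval up to \<open>T\<close> a bound \<open>B\<close> is enough; the factor exp(\<nu>
  T) makes the majorant exceed it there.\<close>

lemma cost_decay:
  assumes x: "x \<in> S"
  obtains M \<nu> where "\<nu> > 0" "\<And>t. t \<ge> 0 \<Longrightarrow> \<bar>l (\<phi> x t)\<bar> \<le> M * exp (- \<nu> * t)"
proof -
  obtain \<epsilon> C \<nu> where e: "\<epsilon> > 0" "C > 0" "\<nu> > 0"
    and st: "\<And>y t. y \<in> ball 0 \<epsilon> \<Longrightarrow> t \<ge> 0 \<Longrightarrow> norm (\<phi> y t) \<le> C * exp (- \<nu> * t) * norm y"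
    using exp_stable by blast
  obtain r L where r: "r > 0" "C11_bound L (ball 0 r) l" using locally_C11_obtain[OF l_C11 zero_in] by metis
  have L: "0 \<le> L" by (rule C11_bound_nonneg[OF r(2)])
  have "\<forall>\<^sub>F t in at_top. dist (\<phi> x t) 0 < min \<epsilon> r"
    using attract[OF x] r(1) e(1) by (intro tendstoD) auto
  then obtain T0 where T0: "\<And>t. t \<ge> T0 \<Longrightarrow> norm (\<phi> x t) < min \<epsilon> r"
    by (auto simp: eventually_at_top_linorder)
  define T where "T = max 0 T0"
  have T: "T \<ge> 0" "\<And>t. t \<ge> T \<Longrightarrow> norm (\<phi> x t) < min \<epsilon> r" using T0 by (auto simp: T_def)
  have "compact ((\<lambda>t. l (\<phi> x t)) ` {0..T})" using cost_cont[OF x] by (intro compact_continuous_image) auto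
  then have "bounded ((\<lambda>t. l (\<phi> x t)) ` {0..T})" by (rule compact_imp_bounded)
  then obtain B where B: "\<And>t. t \<in> {0..T} \<Longrightarrow> \<bar>l (\<phi> x t)\<bar> \<le> B"
    unfolding bounded_iff by (metis (no_types, lifting) imageI real_norm_def)
  have B0: "0 \<le> B" using B[of 0] T by force
  show thesis
  proof (rule that[OF e(3)])
    fix t :: real assume t: "t \<ge> 0"
    have base: "0 \<le> L * C * \<epsilon>" using L e by simp
    show "\<bar>l (\<phi> x t)\<bar> \<le> ((B + L * C * \<epsilon>) * exp (\<nu> * T)) * exp (- \<nu> * t)"
    proof (cases "t \<le> T")
      case True
      then have "0 \<le> \<nu> * T - \<nu> * t" using e by simp
      then have ex: "1 \<le> exp (\<nu> * T - \<nu> * t)" by simp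
      have "\<bar>l (\<phi> x t)\<bar> \<le> (B + L * C * \<epsilon>) * 1" using B[of t] t True base by auto
      also have "\<dots> \<le> (B + L * C * \<epsilon>) * exp (\<nu> * T - \<nu> * t)"
        using ex base B0 by (intro mult_left_mono) auto
      finally show ?thesis by (simp add: exp_diff exp_minus divide_inverse mult.assoc)
    next
      case False
      let ?y = "\<phi> x T"
      have y: "norm ?y < \<epsilon>" using T by force
      have "\<phi> x t = \<phi> ?y (t - T)" using semigroup[OF x T(1), of "t - T"] False by simp
      then have "norm (\<phi> x t) \<le> C * exp (- \<nu> * (t - T)) * norm ?y" using st[of ?y "t - T"] y False by simp
      also have "\<dots> \<le> C * exp (- \<nu> * (t - T)) * \<epsilon>" using y e by (intro mult_left_mono) auto
      finally have n: "norm (\<phi> x t) \<le> C * exp (- \<nu> * (t - T)) * \<epsilon>" .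
      have inr: "\<phi> x t \<in> ball 0 r" using T(2)[of t] False by simp
      have "\<bar>l (\<phi> x t)\<bar> = norm (l (\<phi> x t) - l 0)" by (simp add: l_zero)
      also have "\<dots> \<le> L * norm (\<phi> x t - 0)"
        by (rule C11_bound_lipschitz[OF r(2) inr]) (use r(1) in simp)
      also have "\<dots> \<le> L * (C * exp (- \<nu> * (t - T)) * \<epsilon>)" using n L by (intro mult_left_mono) auto
      also have "\<dots> = L * C * \<epsilon> * exp (- \<nu> * (t - T))" by simp
      also have "\<dots> \<le> (B + L * C * \<epsilon>) * exp (- \<nu> * (t - T))" using B0 by (intro mult_right_mono) auto
      finally have "\<bar>l (\<phi> x t)\<bar> \<le> (B + L * C * \<epsilon>) * exp (- \<nu> * (t - T))" .
      moreover have "exp (- \<nu> * (t - T)) = exp (\<nu> * T) * exp (- \<nu> * t)"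
        unfolding mult_exp_exp by (simp add: algebra_simps)
      ultimately show ?thesis by (simp only: mult.assoc)
    qed
  qed
qed

lemma v_tendsto:
  assumes "x \<in> S"
  shows "((\<lambda>T. integral {0..T} (\<lambda>t. l (\<phi> x t))) \<longlongrightarrow> v x) at_top"
proof -
  obtain M \<nu> where "\<nu> > 0" "\<And>t. t \<ge> 0 \<Longrightarrow> \<bar>l (\<phi> x t)\<bar> \<le> M * exp (- \<nu> * t)" using cost_decay[OF assms] by blast
  from exp_bound_integral_tendsto[OF cost_cont[OF assms] this(2,1)] show ?thesis by (simp add: v_def)
qed

text \<open>Bellman's principle along a fixed control: by the semigroup law, the running cost after
  time \<open>T\<close> is that of the trajectory started at \<open>\<phi> x T\<close>. The identity
  is proved on finite horizons and passed to the limit.\<close>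

lemma v_split:
  assumes x: "x \<in> S" and T: "T \<ge> 0"
  shows "v x = integral {0..T} (\<lambda>t. l (\<phi> x t)) + v (\<phi> x T)"
proof -
  let ?f = "\<lambda>t. l (\<phi> x t)"
  have "((\<lambda>s. integral {0..s + T} ?f) \<longlongrightarrow> v x) at_top"
    by (rule filterlim_compose[OF v_tendsto[OF x]])
       (rule filterlim_at_top_mono[OF filterlim_ident], use T in \<open>auto intro: always_eventually\<close>)
  moreover have lim: "((\<lambda>s. integral {0..T} ?f + integral {0..s} (\<lambda>t. l (\<phi> (\<phi> x T) t))) \<longlongrightarrow> integral {0..T} ?f + v (\<phi> x T)) at_top"
    by (intro tendsto_add tendsto_const v_tendsto flow_in x T)
  have "\<forall>\<^sub>F s in at_top. integral {0..T} ?f + integral {0..s} (\<lambda>t. l (\<phi> (\<phi> x T) t)) = integral {0..s + T} ?f"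
    using eventually_ge_at_top[of 0]
  proof eventually_elim
    case (elim s)
    have "integral {0..s} (\<lambda>t. l (\<phi> (\<phi> x T) t)) = integral {0..s} (\<lambda>t. ?f (t + T))"
      by (rule Henstock_Kurzweil_Integration.integral_cong) (use x T in \<open>simp add: semigroup add.commute\<close>)
    also have "\<dots> = integral {T..s + T} ?f" using integral_shift_real_ivl[of T T "s + T" ?f] by simp
    finally show ?case
      using Henstock_Kurzweil_Integration.integral_combine[of 0 T "s + T" ?f] T elim
        integrable_continuous_real[OF cost_cont[OF x, of "{0..s+T}"]] by auto
  qed
  from Lim_transform_eventually[OF lim this]
  have "((\<lambda>s. integral {0..s + T} ?f) \<longlongrightarrow> integral {0..T} ?f + v (\<phi> x T)) at_top" .
  ultimately show ?thesis by (rule tendsto_unique[OF trivial_limit_at_top_linorder])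
qed

lemma v_nonneg: assumes x: "x \<in> S" shows "0 \<le> v x"
proof (rule tendsto_lowerbound[OF v_tendsto[OF x]])
  show "\<forall>\<^sub>F T in at_top. 0 \<le> integral {0..T} (\<lambda>t. l (\<phi> x t))"
    using x by (intro always_eventually allI Henstock_Kurzweil_Integration.integral_nonneg integrable_continuous_real cost_cont)
      (auto intro: l_nonneg flow_in)
qed simp

lemma v_zero: "v 0 = 0"
proof -
  have "v 0 = integral {0..} (\<lambda>t::real. 0::real)"
    unfolding v_def by (rule Henstock_Kurzweil_Integration.integral_cong) (simp add: flow_zero l_zero)
  then show ?thesis by simp
qed

text \<open>The integrand is continuous and equals l(x) > 0 at time 0, so already its integral over
  [0,1] is positive, and the remaining cost is nonnegative.\<close>

lemma v_pos:
  assumes x: "x \<in> S" and l: "l x > 0"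
  shows "v x > 0"
proof -
  let ?I = "integral {0..1} (\<lambda>t. l (\<phi> x t))"
  have cont: "continuous_on {0..1} (\<lambda>t. l (\<phi> x t))" using x by (intro cost_cont) auto
  have nn: "0 \<le> l (\<phi> x t)" if "t \<in> {0..1}" for t using that x by (auto intro: l_nonneg flow_in)
  have "?I \<noteq> 0"
    using integral_eq_0_iff[OF cont _ nn] l flow_0[OF x] by force
  moreover have "0 \<le> ?I" by (intro Henstock_Kurzweil_Integration.integral_nonneg integrable_continuous_real cont nn)
  ultimately show ?thesis
    using v_split[OF x, of 1] v_nonneg[OF flow_in[OF x, of 1]] by simp
qed

lemma v_flow_le:
  assumes x: "x \<in> S" and t: "t \<ge> 0"
  shows "v (\<phi> x t) \<le> v x"
proof -
  have "0 \<le> integral {0..t} (\<lambda>t. l (\<phi> x t))"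
    using x by (intro Henstock_Kurzweil_Integration.integral_nonneg integrable_continuous_real cost_cont)
      (auto intro: l_nonneg flow_in)
  then show ?thesis using v_split[OF x t] by simp
qed

lemma v_flow_tendsto:
  assumes x: "x \<in> S" shows "((\<lambda>t. v (\<phi> x t)) \<longlongrightarrow> 0) at_top"
proof -
  have "((\<lambda>t. v x - integral {0..t} (\<lambda>t. l (\<phi> x t))) \<longlongrightarrow> v x - v x) at_top"
    by (intro tendsto_intros v_tendsto x)
  then have "((\<lambda>t. v x - integral {0..t} (\<lambda>t. l (\<phi> x t))) \<longlongrightarrow> 0) at_top" by simp
  moreover have "\<forall>\<^sub>F t in at_top. v x - integral {0..t} (\<lambda>t. l (\<phi> x t)) = v (\<phi> x t)"
    using eventually_ge_at_top[of 0] by eventually_elim (use v_split[OF x] in simp)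
  ultimately show ?thesis by (rule Lim_transform_eventually)
qed

section \<open>C11 regularity of the cost\<close>

lemma partial_cost_C11:
  assumes "x0 \<in> S" "T \<ge> 0"
  shows "\<exists>r>0. \<exists>L. ball x0 r \<subseteq> S \<and> C11_bound L (ball x0 r) (\<lambda>x. integral {0..T} (\<lambda>t. l (\<phi> x t)))"
proof -
  obtain r L where r: "r > 0" "ball x0 r \<subseteq> S" and C: "\<forall>t\<in>{0..T}. C11_bound L (ball x0 r) (\<lambda>x. l (\<phi> x t))"
    using flow_compose_C11[OF assms l_C11] by blast
  have "C11_bound (L * T) (ball x0 r) (\<lambda>x. integral {0..T} (\<lambda>t. l (\<phi> x t)))"
    by (rule C11_bound_integral) (use C assms r in \<open>auto intro!: cost_cont\<close>)
  then show ?thesis using r by blast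
qed

lemma v_C11_near_0: "\<exists>r>0. \<exists>L. ball 0 r \<subseteq> S \<and> C11_bound L (ball 0 r) v"
proof -
  obtain \<epsilon> C \<nu> where e: "\<epsilon> > 0" "C > 0" "\<nu> > 0"
    and st: "\<And>y t. y \<in> ball 0 \<epsilon> \<Longrightarrow> t \<ge> 0 \<Longrightarrow> norm (\<phi> y t) \<le> C * exp (- \<nu> * t) * norm y"
    using exp_stable by blast
  have "((\<lambda>t. C * exp (- \<nu> * t)) \<longlongrightarrow> 0) at_top" using e by real_asymp
  then have "\<forall>\<^sub>F t in at_top. C * exp (- \<nu> * t) < 1/16" by (rule order_tendstoD) simp
  then obtain T0 where T0: "\<And>t. t \<ge> T0 \<Longrightarrow> C * exp (- \<nu> * t) < 1/16"
    unfolding eventually_at_top_linorder by blast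
  \<comment> \<open>The value 1/16 is the smallness required by the contraction lemma; T >= 1 makes
    the multiples of \<open>T\<close> tend to infinity.\<close>
  define T where "T = max 1 T0"
  have T: "T \<ge> 0" "C * exp (- \<nu> * T) < 1/16" "T > 0" using T0[of T] by (auto simp: T_def)
  define \<Phi> where "\<Phi> x = \<phi> x T" for x
  obtain r1 L where r1: "r1 > 0" "ball 0 r1 \<subseteq> S" and L: "\<forall>t\<in>{0..T}. C11_bound L (ball 0 r1) (\<lambda>x. \<phi> x t)"
    using flow_C11[OF zero_in T(1)] by blast
  obtain r2 M where r2: "r2 > 0" and M: "C11_bound M (ball 0 r2) (\<lambda>x. integral {0..T} (\<lambda>t. l (\<phi> x t)))"
    using partial_cost_C11[OF zero_in T(1)] by blast
  define r where "r = min \<epsilon> (min r1 r2)"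
  have r: "r > 0" "r \<le> \<epsilon>" "r \<le> r1" "r \<le> r2" using e r1 r2 by (auto simp: r_def)
  have "C11_bound L (ball 0 r1) \<Phi>" unfolding \<Phi>_def using L T(1) by auto
  then have \<Phi>: "C11_bound L (ball 0 r) \<Phi>" by (rule C11_bound_mono) (use r in auto)
  have L0: "0 \<le> L" by (rule C11_bound_nonneg[OF \<Phi>])
  have small: "norm (\<Phi> x) \<le> norm x / 16" if "x \<in> ball 0 r" for x
  proof -
    have "norm (\<Phi> x) \<le> C * exp (- \<nu> * T) * norm x" unfolding \<Phi>_def using that r by (intro st T) auto
    also have "\<dots> \<le> 1/16 * norm x" using T by (intro mult_right_mono) auto
    finally show ?thesis by simp
  qed
  obtain \<rho> where \<rho>: "\<rho> > 0" "\<rho> \<le> r"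
    and contr: "\<And>a b. a \<in> ball 0 \<rho> \<Longrightarrow> b \<in> ball 0 \<rho> \<Longrightarrow> norm (\<Phi> a - \<Phi> b) \<le> norm (a - b) / 2"
    using C11_bound_contraction[OF \<Phi> r(1) small] by metis
  \<comment> \<open>With radius \<rho>/3 the reflection of one point of \<open>U\<close> in another
    has norm below \<rho>, where \<Phi> is still a contraction.\<close>
  define U :: "'a set" where "U = ball 0 (\<rho> / 3)"
  have U: "x \<in> ball 0 \<rho>" "x \<in> ball 0 r" "x \<in> S" if "x \<in> U" for x
  proof -
    have "norm x < \<rho> / 3" using that by (simp add: U_def)
    then show "x \<in> ball 0 \<rho>" "x \<in> ball 0 r" using \<rho> by auto
    then show "x \<in> S" using r(3) r1(2) by auto
  qed
  have map: "\<Phi> x \<in> U" if "x \<in> U" for x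
  proof -
    have "norm x < \<rho> / 3" using that by (simp add: U_def)
    then have "norm (\<Phi> x) < \<rho> / 3"
      using small[OF U(2)[OF that]] norm_ge_zero[of x] by linarith
    then show ?thesis by (simp add: U_def)
  qed
  \<comment> \<open>The bound for \<Phi> has the coefficient \<open>L\<close> in front of a + b -
    2m, too large for iteration. Replacing \<open>b\<close> by the reflection \<open>c\<close>
    removes this term from the triple a, c, m, and b - c = a + b - 2m is left to the contraction
    with coefficient 1/2.\<close>
  have sec: "norm (\<Phi> a + \<Phi> b - 2 *\<^sub>R \<Phi> m)
       \<le> norm (a + b - 2 *\<^sub>R m) / 2 + (2 * L) * ((norm (a - m))\<^sup>2 + (norm (b - m))\<^sup>2)"
    if a: "a \<in> U" and b: "b \<in> U" and m: "m \<in> U" for a b m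
  proof -
    define c where "c = 2 *\<^sub>R m - a"
    have "norm c \<le> norm (2 *\<^sub>R m) + norm a" unfolding c_def by (rule norm_triangle_ineq4)
    also have "\<dots> < \<rho>" using a m by (simp add: U_def)
    finally have c: "c \<in> ball 0 \<rho>" by simp
    have cm: "c - m = - (a - m)" by (simp add: c_def scaleR_2)
    have "norm (\<Phi> a + \<Phi> c - 2 *\<^sub>R \<Phi> m) \<le> L * (norm (a + c - 2 *\<^sub>R m) + (norm (a - m))\<^sup>2 + (norm (c - m))\<^sup>2)"
      by (rule C11_bound_second[OF \<Phi> U(2)[OF a] _ U(2)[OF m]]) (use c \<rho>(2) in simp)
    also have "\<dots> = 2 * L * (norm (a - m))\<^sup>2" unfolding cm norm_minus_cancel by (simp add: c_def)
    also have "\<dots> \<le> (2 * L) * ((norm (a - m))\<^sup>2 + (norm (b - m))\<^sup>2)" using L0 by (intro mult_left_mono) auto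
    finally have A: "norm (\<Phi> a + \<Phi> c - 2 *\<^sub>R \<Phi> m) \<le> (2 * L) * ((norm (a - m))\<^sup>2 + (norm (b - m))\<^sup>2)" .
    have "norm (\<Phi> b - \<Phi> c) \<le> norm (b - c) / 2" by (rule contr[OF U(1)[OF b] c])
    also have "b - c = a + b - 2 *\<^sub>R m" by (simp add: c_def)
    finally have B: "norm (\<Phi> b - \<Phi> c) \<le> norm (a + b - 2 *\<^sub>R m) / 2" .
    have "norm (\<Phi> a + \<Phi> b - 2 *\<^sub>R \<Phi> m) = norm ((\<Phi> b - \<Phi> c) + (\<Phi> a + \<Phi> c - 2 *\<^sub>R \<Phi> m))"
      by (simp add: algebra_simps)
    also have "\<dots> \<le> norm (a + b - 2 *\<^sub>R m) / 2 + (2 * L) * ((norm (a - m))\<^sup>2 + (norm (b - m))\<^sup>2)"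
      by (intro norm_triangle_le add_mono A B)
    finally show ?thesis .
  qed
  let ?J = "\<lambda>x. integral {0..T} (\<lambda>t. l (\<phi> x t))"
  have J: "C11_bound M U ?J"
    by (rule C11_bound_mono[OF M order_refl]) (use \<rho> r in \<open>auto simp: U_def\<close>)
  have sums: "C11_bound (2 * (M * (1 + 4 * (2 * L)))) U (\<lambda>x. \<Sum>i<n. ?J ((\<Phi> ^^ i) x))" for n
    using L0 by (intro C11_bound_iterate_sum map contr U sec J) auto
  have it: "(\<Phi> ^^ n) x = \<phi> x (real n * T)" if "x \<in> U" for n x
  proof (induction n)
    case 0
    then show ?case using U[OF that] by (simp add: flow_0)
  next
    case (Suc n)
    then show ?case using T U[OF that] by (simp add: \<Phi>_def semigroup algebra_simps)
  qed
  have tele: "v x = (\<Sum>i<n. ?J ((\<Phi> ^^ i) x)) + v ((\<Phi> ^^ n) x)" if "x \<in> U" for n x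
  proof (induction n)
    case (Suc n)
    have "(\<Phi> ^^ n) x \<in> S" using it[OF that] U[OF that] T by (auto intro: flow_in)
    from v_split[OF this T(1)] Suc show ?case by (simp add: \<Phi>_def[of "(\<Phi> ^^ n) x"])
  qed simp
  have lim: "(\<lambda>n. \<Sum>i<n. ?J ((\<Phi> ^^ i) x)) \<longlonglongrightarrow> v x" if x: "x \<in> U" for x
  proof -
    have "filterlim (\<lambda>n. real n * T) at_top sequentially"
      using T(3) by real_asymp
    from filterlim_compose[OF v_flow_tendsto[OF U(3)[OF x]] this]
    have "(\<lambda>n. v x - v ((\<Phi> ^^ n) x)) \<longlonglongrightarrow> v x - 0" unfolding it[OF x] by (intro tendsto_intros)
    moreover have "v x - v ((\<Phi> ^^ n) x) = (\<Sum>i<n. ?J ((\<Phi> ^^ i) x))" for n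
      using tele[OF x, of n] by simp
    ultimately show ?thesis by simp
  qed
  have "C11_bound (2 * (M * (1 + 4 * (2 * L)))) U v" by (rule C11_bound_limit[OF sums lim])
  moreover have "U \<subseteq> S" "\<rho> / 3 > 0" using U \<rho> by auto
  ultimately show ?thesis unfolding U_def by blast
qed

text \<open>At a time \<open>T\<close> when the trajectory of \<open>x\<close> is already near 0,
  the splitting writes \<open>v\<close> as a finite-horizon cost plus the composition of
  \<open>v\<close> near 0 with the time-\<open>T\<close> map. Both terms are controlled on a
  neighbourhood of \<open>x\<close>.\<close>

lemma v_locally_C11: "locally_C11 S v"
  unfolding locally_C11_def
proof
  fix x assume x: "x \<in> S"
  obtain r0 M where r0: "r0 > 0" "ball 0 r0 \<subseteq> S" "C11_bound M (ball 0 r0) v"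
    using v_C11_near_0 by blast
  have "\<forall>\<^sub>F t in at_top. dist (\<phi> x t) 0 < r0" using attract[OF x] r0(1) by (rule tendstoD)
  then obtain T0 where T0: "\<And>t. t \<ge> T0 \<Longrightarrow> norm (\<phi> x t) < r0"
    by (auto simp: eventually_at_top_linorder)
  define T where "T = max 0 T0"
  have T: "T \<ge> 0" "norm (\<phi> x T) < r0" using T0[of T] by (auto simp: T_def)
  obtain r1 L1 where r1: "r1 > 0" "ball x r1 \<subseteq> S"
    and L1: "\<forall>t\<in>{0..T}. C11_bound L1 (ball x r1) (\<lambda>x. \<phi> x t)"
    using flow_C11[OF x T(1)] by blast
  obtain r2 L2 where r2: "r2 > 0" "ball x r2 \<subseteq> S"
    and L2: "C11_bound L2 (ball x r2) (\<lambda>x. integral {0..T} (\<lambda>t. l (\<phi> x t)))"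
    using partial_cost_C11[OF x T(1)] by blast
  have \<phi>T: "C11_bound L1 (ball x r1) (\<lambda>x. \<phi> x T)" using L1 T by simp
  \<comment> \<open>Chosen so that the time-\<open>T\<close> map, with Lipschitz constant
    \<open>L1\<close>, moves points by less than the room left between \<open>\<phi> x T\<close> and
    the sphere of radius \<open>r0\<close>.\<close>
  define \<delta> where "\<delta> = (r0 - norm (\<phi> x T)) / (L1 + 1)"
  have L10: "0 \<le> L1" by (rule C11_bound_nonneg[OF \<phi>T])
  have \<delta>: "\<delta> > 0" "(L1 + 1) * \<delta> = r0 - norm (\<phi> x T)" using T L10 by (auto simp: \<delta>_def)
  define r where "r = min \<delta> (min r1 r2)"
  have r: "r > 0" "r \<le> \<delta>" "r \<le> r1" "r \<le> r2" using \<delta> r1 r2 by (auto simp: r_def)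
  have sub: "(\<lambda>y. \<phi> y T) ` ball x r \<subseteq> ball 0 r0"
  proof clarify
    fix y assume y: "y \<in> ball x r"
    have "norm (\<phi> y T - \<phi> x T) \<le> L1 * norm (y - x)"
      by (rule C11_bound_lipschitz[OF \<phi>T]) (use y r(3) r1(1) in simp_all)
    also have "\<dots> \<le> L1 * \<delta>"
      by (rule mult_left_mono[OF _ L10]) (use y r(2) in \<open>simp add: dist_norm norm_minus_commute\<close>)
    also have "\<dots> < (L1 + 1) * \<delta>" using \<delta>(1) by (simp add: distrib_right)
    finally have "norm (\<phi> y T - \<phi> x T) < r0 - norm (\<phi> x T)" unfolding \<delta>(2) .
    then show "\<phi> y T \<in> ball 0 r0" using norm_triangle_sub[of "\<phi> y T" "\<phi> x T"] by simp
  qed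
  have "C11_bound (L2 + M * (L1 + L1\<^sup>2)) (ball x r) (\<lambda>y. integral {0..T} (\<lambda>t. l (\<phi> y t)) + v (\<phi> y T))"
    by (intro C11_bound_add C11_bound_compose[OF _ r0(3) sub]
        C11_bound_mono[OF L2 order_refl subset_ball[OF r(4)]] C11_bound_mono[OF \<phi>T order_refl subset_ball[OF r(3)]])
  then have "C11_bound (L2 + M * (L1 + L1\<^sup>2)) (ball x r) v"
  proof (rule C11_bound_cong[rotated])
    fix y assume "y \<in> ball x r"
    then have "y \<in> S" using r(3) r1(2) by auto
    then show "integral {0..T} (\<lambda>t. l (\<phi> y t)) + v (\<phi> y T) = v y" using v_split T(1) by simp
  qed
  moreover have "ball x r \<subseteq> S" using r(3) r1(2) by auto
  ultimately show "\<exists>r>0. \<exists>L. ball x r \<subseteq> S \<and> C11_bound L (ball x r) v" using r(1) by blast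
qed

section \<open>Gradient of the cost and quadratic bounds at the origin\<close>

lemma v_GDERIV: "x \<in> S \<Longrightarrow> GDERIV v x :> grad v x"
  using locally_C11_grad[OF v_locally_C11, of x] by (meson centre_in_ball)

lemma v_continuous_on: "continuous_on S v"
  by (rule locally_C11_continuous_on[OF v_locally_C11])

text \<open>The Lyapunov equation of the old control. The derivative of \<open>v\<close> along a
  trajectory at time 0 is computed by the chain rule and from the splitting; it is one-sided because
  trajectories exist for nonnegative times.\<close>

lemma v_grad_F:
  assumes x: "x \<in> S"
  shows "F x \<bullet> grad v x = - l x"
proof -
  let ?I = "{0..1::real}"
  have "((\<lambda>t. v (\<phi> x t)) has_real_derivative F (\<phi> x 0) \<bullet> grad v x) (at 0 within ?I)"
    by (rule GDERIV_chain[OF _ flow_deriv]) (use x v_GDERIV in \<open>auto simp: flow_0\<close>)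
  then have "((\<lambda>t. v (\<phi> x t)) has_vector_derivative F x \<bullet> grad v x) (at 0 within ?I)"
    using x by (simp add: flow_0 has_real_derivative_iff_has_vector_derivative)
  moreover have "((\<lambda>t. v (\<phi> x t)) has_vector_derivative - l x) (at 0 within ?I)"
  proof (rule has_vector_derivative_transform)
    have "((\<lambda>t. integral {0..t} (\<lambda>t. l (\<phi> x t))) has_vector_derivative l (\<phi> x 0)) (at 0 within ?I)"
      by (rule integral_has_vector_derivative) (use x in \<open>auto intro: cost_cont\<close>)
    then have "((\<lambda>t. v x - integral {0..t} (\<lambda>t. l (\<phi> x t))) has_vector_derivative 0 - l (\<phi> x 0)) (at 0 within ?I)"
      by (intro has_vector_derivative_diff has_vector_derivative_const)
    then show "((\<lambda>t. v x - integral {0..t} (\<lambda>t. l (\<phi> x t))) has_vector_derivative - l x) (at 0 within ?I)"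
      using x by (simp add: flow_0)
    show "v (\<phi> x t) = v x - integral {0..t} (\<lambda>t. l (\<phi> x t))" if "t \<in> ?I" for t
      using v_split[OF x, of t] that by simp
  qed simp
  ultimately show ?thesis
    using vector_derivative_unique_within_closed_interval[of 0 1 0] by auto
qed

text \<open>The origin is an interior minimum of the nonnegative function \<open>v\<close>.\<close>

lemma v_grad_zero: "grad v 0 = 0"
proof -
  have "(\<lambda>k. k \<bullet> grad v 0) = (\<lambda>k. 0)"
    using differential_zero_maxmin[OF zero_in open_S] v_GDERIV[OF zero_in] v_nonneg v_zero
    unfolding gderiv_def by metis
  then show ?thesis by (metis inner_eq_zero_iff)
qed

lemma v_quadratic_near_0:
  "\<exists>r>0. \<exists>L\<ge>0. ball 0 r \<subseteq> S \<and>
    (\<forall>x\<in>ball 0 r. v x \<le> L * (norm x)\<^sup>2 \<and> norm (grad v x) \<le> L * norm x)"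
proof -
  obtain r L where r: "r > 0" "L \<ge> 0" "ball 0 r \<subseteq> S"
    and T: "\<forall>y\<in>ball 0 r. \<forall>k. norm k < r \<longrightarrow> \<bar>v (y + k) - v y - k \<bullet> grad v y\<bar> \<le> L * (norm k)\<^sup>2"
    and G: "L-lipschitz_on (ball 0 r) (grad v)"
    using locally_C11_grad[OF v_locally_C11 zero_in] by blast
  have "v x \<le> L * (norm x)\<^sup>2 \<and> norm (grad v x) \<le> L * norm x" if x: "x \<in> ball 0 r" for x
  proof
    have "norm x < r" "0 \<in> ball 0 r" using x r(1) by auto
    with T have "\<bar>v (0 + x) - v 0 - x \<bullet> grad v 0\<bar> \<le> L * (norm x)\<^sup>2" by blast
    then show "v x \<le> L * (norm x)\<^sup>2" by (simp add: v_zero v_grad_zero)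
    show "norm (grad v x) \<le> L * norm x"
      using lipschitz_onD[OF G x, of 0] r by (simp add: v_grad_zero)
  qed
  then show ?thesis using r by blast
qed

text \<open>A trajectory cannot approach 0 too fast: near 0, |F y| <= L |y|, so the derivative of
  |y|^2 is at least -2 L |y|^2 and hence at least -2 L l(y), while that of \<open>v\<close> is -
  l(y). Thus |y|^2 - 2 L v is nondecreasing along trajectories and tends to 0, so it is nonpositive
  at time 0.\<close>

lemma v_lower_near_0:
  assumes l: "\<And>x. x \<in> S \<Longrightarrow> (norm x)\<^sup>2 \<le> l x"
  shows "\<exists>r>0. \<exists>c>0. ball 0 r \<subseteq> S \<and> (\<forall>x\<in>ball 0 r. c * (norm x)\<^sup>2 \<le> v x)"
proof -
  obtain \<epsilon> C \<nu> where e: "\<epsilon> > 0" "C > 0" "\<nu> > 0" "ball 0 \<epsilon> \<subseteq> S"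
    and st: "\<And>y t. y \<in> ball 0 \<epsilon> \<Longrightarrow> t \<ge> 0 \<Longrightarrow> norm (\<phi> y t) \<le> C * exp (- \<nu> * t) * norm y"
    using exp_stable by blast
  obtain s L where s: "s > 0" "C11_bound L (ball 0 s) F" using locally_C11_obtain[OF F_C11 zero_in] by metis
  have L: "0 \<le> L" by (rule C11_bound_nonneg[OF s(2)])
  \<comment> \<open>By stability trajectories from this ball never leave the ball of radius
    \<open>s\<close>, where \<open>F\<close> has Lipschitz constant \<open>L\<close>.\<close>
  define r where "r = min \<epsilon> (s / C)"
  have "r \<le> s / C" by (simp add: r_def)
  then have "C * r \<le> C * (s / C)" using e(2) by (intro mult_left_mono) auto
  then have r: "r > 0" "r \<le> \<epsilon>" "C * r \<le> s" using e s by (auto simp: r_def)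
  have "1 / (2 * L + 1) * (norm x)\<^sup>2 \<le> v x" if x: "x \<in> ball 0 r" for x
  proof -
    from x have xS: "x \<in> S" and xe: "x \<in> ball 0 \<epsilon>" using r e by auto
    have near: "\<phi> x t \<in> ball 0 s" if "t \<ge> 0" for t
    proof -
      have "norm (\<phi> x t) \<le> C * exp (- \<nu> * t) * norm x" by (rule st[OF xe that])
      also have "\<dots> \<le> C * 1 * norm x" using e that by (intro mult_right_mono mult_left_mono) auto
      also have "\<dots> < C * r" using x e by simp
      finally show ?thesis using r by simp
    qed
    define G where "G t = \<phi> x t \<bullet> \<phi> x t - 2 * L * v (\<phi> x t)" for t
    have "G 0 \<le> G t" if t: "t \<ge> 0" for t
    proof (rule DERIV_nonneg_imp_increasing_open[OF t])
      have "continuous_on {0..t} (\<lambda>t. v (\<phi> x t))"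
        by (rule continuous_on_compose2[OF v_continuous_on flow_cont[OF xS]]) (auto intro: flow_in xS)
      moreover have "continuous_on {0..t} (\<phi> x)" by (rule flow_cont[OF xS]) auto
      ultimately show "continuous_on {0..t} G" unfolding G_def by (intro continuous_intros)
      fix \<tau> assume \<tau>: "0 < \<tau>" "\<tau> < t"
      let ?y = "\<phi> x \<tau>"
      have "(\<phi> x has_vector_derivative F ?y) (at \<tau> within {0..t})" using \<tau> by (intro flow_deriv xS) auto
      then have d: "(\<phi> x has_vector_derivative F ?y) (at \<tau>)" using \<tau> by (simp add: at_within_Icc_at)
      have yS: "?y \<in> S" using \<tau> by (intro flow_in xS) auto
      have "((\<lambda>t. v (\<phi> x t)) has_real_derivative - l ?y) (at \<tau>)"
        using GDERIV_chain[OF v_GDERIV[OF yS] d] v_grad_F[OF yS] by simp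
      moreover have "((\<lambda>t. \<phi> x t \<bullet> \<phi> x t) has_real_derivative 2 * (?y \<bullet> F ?y)) (at \<tau>)"
        unfolding has_field_derivative_def
        by (rule has_derivative_eq_rhs[OF has_derivative_inner[OF d[unfolded has_vector_derivative_def] d[unfolded has_vector_derivative_def]]])
         (auto simp: inner_commute fun_eq_iff)
      ultimately have "(G has_real_derivative 2 * (?y \<bullet> F ?y) + 2 * L * l ?y) (at \<tau>)"
        unfolding G_def by (auto intro!: derivative_eq_intros)
      moreover have "0 \<le> 2 * (?y \<bullet> F ?y) + 2 * L * l ?y"
      proof -
        have "norm (F ?y) \<le> L * norm ?y"
          using C11_bound_lipschitz[OF s(2) near[of \<tau>], of 0] \<tau> s(1) by (simp add: F_zero)
        then have "\<bar>?y \<bullet> F ?y\<bar> \<le> norm ?y * (L * norm ?y)"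
          by (meson Cauchy_Schwarz_ineq2 mult_left_mono norm_ge_zero order_trans)
        also have "\<dots> \<le> L * l ?y" using l[OF yS] L by (simp add: power2_eq_square mult.left_commute mult_left_mono)
        finally show ?thesis by linarith
      qed
      ultimately show "\<exists>y. (G has_real_derivative y) (at \<tau>) \<and> 0 \<le> y" by blast
    qed
    then have "\<forall>\<^sub>F t in at_top. G 0 \<le> G t" unfolding eventually_at_top_linorder by blast
    moreover have "(G \<longlongrightarrow> (0::'a) \<bullet> 0 - 2 * L * 0) at_top"
      unfolding G_def by (intro tendsto_diff tendsto_inner tendsto_mult tendsto_const attract v_flow_tendsto xS)
    ultimately have "G 0 \<le> 0" by (intro tendsto_lowerbound[of G 0 at_top]) auto
    then have "(norm x)\<^sup>2 \<le> 2 * L * v x" by (simp add: G_def flow_0[OF xS] power2_norm_eq_inner)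
    then have "(norm x)\<^sup>2 \<le> (2 * L + 1) * v x" using v_nonneg[OF xS] by (simp add: distrib_right)
    then show ?thesis using L by (simp add: pos_divide_le_eq mult.commute)
  qed
  moreover have "1 / (2 * L + 1) > 0" "ball 0 r \<subseteq> S" using r e L by auto
  ultimately show ?thesis using r(1) by blast
qed

end

section \<open>Lyapunov functions\<close>

lemma solves_continuous_on:
  assumes "solves F A x I \<psi>" shows "continuous_on I \<psi>"
  unfolding continuous_on_eq_continuous_within
  using assms has_vector_derivative_continuous unfolding solves_def by blast

lemma solves_subinterval:
  assumes "solves F A x I \<psi>" "J \<subseteq> I"
  shows "solves F A x J \<psi>"
  using assms unfolding solves_def
  by (meson has_vector_derivative_within_subset subsetD)

lemma solves_unique_lipschitz:
  fixes F :: "'a::euclidean_space \<Rightarrow> 'a"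
  assumes L: "L-lipschitz_on A F"
    and sol: "solves F A x {0..T} \<psi>\<^sub>1" "solves F A x {0..T} \<psi>\<^sub>2" and t: "t \<in> {0..T}"
  shows "\<psi>\<^sub>1 t = \<psi>\<^sub>2 t"
proof -
  have s: "solves F A x {0..t} \<psi>\<^sub>1" "solves F A x {0..t} \<psi>\<^sub>2"
    using t by (auto intro: solves_subinterval[OF sol(1)] solves_subinterval[OF sol(2)])
  have "norm (\<psi>\<^sub>1 t - \<psi>\<^sub>2 t) \<le> exp ((2 * L + 1) * t) * (norm (\<psi>\<^sub>1 0 - \<psi>\<^sub>2 0) + 0 * (1 + t))"
  proof (rule gronwall)
    fix \<tau> assume "\<tau> \<in> {0..t}"
    then show "((\<lambda>\<tau>. \<psi>\<^sub>1 \<tau> - \<psi>\<^sub>2 \<tau>) has_vector_derivative F (\<psi>\<^sub>1 \<tau>) - F (\<psi>\<^sub>2 \<tau>)) (at \<tau> within {0..t})"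
      using s unfolding solves_def by (intro has_vector_derivative_diff) auto
  next
    fix \<tau> assume "0 < \<tau>" "\<tau> < t"
    then have "\<psi>\<^sub>1 \<tau> \<in> A" "\<psi>\<^sub>2 \<tau> \<in> A" using s unfolding solves_def by auto
    then show "norm (F (\<psi>\<^sub>1 \<tau>) - F (\<psi>\<^sub>2 \<tau>)) \<le> L * norm (\<psi>\<^sub>1 \<tau> - \<psi>\<^sub>2 \<tau>) + 0"
      using lipschitz_on_normD[OF L] by simp
  qed (use t lipschitz_on_nonneg[OF L] in auto)
  also have "\<dots> = 0" using sol unfolding solves_def by simp
  finally show ?thesis by simp
qed

text \<open>At the first exit time the curve is on the frontier, where \<open>V\<close> equals
  \<open>c\<close>, while \<open>V\<close> has not increased from a value below \<open>c\<close>.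
  The hypothesis \<open>decr\<close> speaks only of curves that have been in \<open>A\<close> so
  far, so it can be checked before invariance is known.\<close>

lemma stays_in_sublevel_set:
  fixes y :: "real \<Rightarrow> 'a::euclidean_space" and V :: "'a \<Rightarrow> real"
  assumes A: "open A" and VA: "continuous_on (closure A) V"
    and bnd: "\<And>x. x \<in> frontier A \<Longrightarrow> V x = c"
    and y: "continuous_on {0..T} y" "y 0 \<in> A" and c: "V (y 0) < c"
    and decr: "\<And>t. 0 < t \<Longrightarrow> t \<le> T \<Longrightarrow> (\<And>s. 0 \<le> s \<Longrightarrow> s < t \<Longrightarrow> y s \<in> A) \<Longrightarrow> y t \<in> closure A \<Longrightarrow> V (y t) \<le> V (y 0)"
    and t: "t \<in> {0..T}"
  shows "y t \<in> A"
proof (rule ccontr)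
  define B where "B = {t \<in> {0..T}. y t \<in> - A}"
  assume "y t \<notin> A"
  then have ne: "B \<noteq> {}" using t by (auto simp: B_def)
  have bb: "bdd_below B" unfolding B_def by (auto intro: bdd_belowI[of _ 0])
  have "closed B"
    using continuous_closed_preimage[OF y(1) closed_real_atLeastAtMost, of "- A"] A
    by (simp add: B_def closed_Compl vimage_def Int_def)
  then have inB: "Inf B \<in> B" using closed_contains_Inf[OF ne bb] by blast
  define \<tau> where "\<tau> = Inf B"
  have \<tau>: "0 \<le> \<tau>" "\<tau> \<le> T" "y \<tau> \<notin> A" using inB by (auto simp: \<tau>_def B_def)
  then have \<tau>0: "0 < \<tau>" using y(2) by (cases "\<tau> = 0") auto
  have before: "y s \<in> A" if "0 \<le> s" "s < \<tau>" for s
  proof -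
    have "s \<notin> B" using cInf_lower[OF _ bb] that(2) by (force simp: \<tau>_def)
    then show ?thesis using that \<tau>(2) by (auto simp: B_def)
  qed
  have "y ` closure {0..<\<tau>} \<subseteq> closure A"
  proof (rule image_closure_subset)
    show "continuous_on (closure {0..<\<tau>}) y"
      using \<tau>0 \<tau>(2) by (intro continuous_on_subset[OF y(1)]) auto
    show "y ` {0..<\<tau>} \<subseteq> closure A" using before closure_subset[of A] by fastforce
  qed simp
  then have cl: "y \<tau> \<in> closure A" using \<tau>0 by auto
  then have "V (y \<tau>) = c" using \<tau>(3) A by (intro bnd) (simp add: frontier_def interior_open)
  moreover have "V (y \<tau>) \<le> V (y 0)" by (rule decr[OF \<tau>0 \<tau>(2) before cl])
  ultimately show False using c by simp
qed

text \<open>\<open>F\<close> is Lipschitz around the compact closure of \<open>A\<close>, as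
  extension and uniqueness require. \<open>V\<close> is differentiated inside \<open>A\<close> only
  and merely continuous up to the frontier, where its constant value acts as a barrier.\<close>

locale lyapunov_sublevel =
  fixes F :: "'a::euclidean_space \<Rightarrow> 'a" and \<Omega> A :: "'a set" and V h :: "'a \<Rightarrow> real" and c :: real
  assumes open_\<Omega>: "open \<Omega>" and open_A: "open A" and bounded_A: "bounded A" and A_sub: "closure A \<subseteq> \<Omega>"
    and F_lip: "locally_lipschitz_on \<Omega> F"
    and V_cont: "continuous_on (closure A) V"
    and V_less: "\<And>x. x \<in> A \<Longrightarrow> V x < c" and V_frontier: "\<And>x. x \<in> frontier A \<Longrightarrow> V x = c"
    and V_zero: "V 0 = 0" and V_pos: "\<And>x. x \<in> closure A \<Longrightarrow> x \<noteq> 0 \<Longrightarrow> 0 < V x"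
    and V_grad: "\<And>x. x \<in> A \<Longrightarrow> GDERIV V x :> grad V x"
    and h_cont: "continuous_on (closure A) h" and h_zero: "h 0 = 0"
    and h_pos: "\<And>x. x \<noteq> 0 \<Longrightarrow> 0 < h x"
    and V_decr: "\<And>x. x \<in> A \<Longrightarrow> F x \<bullet> grad V x \<le> - h x"
begin

section \<open>Existence, uniqueness and attraction in a sublevel set\<close>

lemma compact_closure_A: "compact (closure A)"
  using bounded_A by simp

lemma V_nonneg: "x \<in> closure A \<Longrightarrow> 0 \<le> V x"
  using V_pos[of x] V_zero by (cases "x = 0") auto

lemma h_nonneg: "0 \<le> h x"
  using h_pos[of x] h_zero by (cases "x = 0") auto

text \<open>Interior times suffice for the derivative, so the end point may lie on the frontier of
  \<open>A\<close>. With \<delta> = 0 this is monotonicity, with \<delta> > 0 a linear rate of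
  decrease.\<close>

lemma V_decreasing:
  assumes ab: "a \<le> b" and cont: "continuous_on {a..b} y" and cl: "\<And>t. t \<in> {a..b} \<Longrightarrow> y t \<in> closure A"
    and int: "\<And>t. a < t \<Longrightarrow> t < b \<Longrightarrow> y t \<in> A \<and> (y has_vector_derivative F (y t)) (at t)"
    and \<delta>: "\<And>t. a < t \<Longrightarrow> t < b \<Longrightarrow> \<delta> \<le> h (y t)"
  shows "V (y b) \<le> V (y a) - \<delta> * (b - a)"
proof -
  define q where "q t = V (y t) + \<delta> * t" for t
  have "q b \<le> q a"
  proof (rule DERIV_nonpos_imp_decreasing_open[where f = q and a = a and b = b])
    have "continuous_on {a..b} (\<lambda>t. V (y t))"
      by (rule continuous_on_compose2[OF V_cont cont]) (use cl in auto)
    then show "continuous_on {a..b} q" unfolding q_def by (intro continuous_intros)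
    fix t assume t: "a < t" "t < b"
    have "((\<lambda>t. V (y t)) has_real_derivative F (y t) \<bullet> grad V (y t)) (at t)"
      using int[OF t] by (intro GDERIV_chain V_grad) auto
    then have "(q has_real_derivative F (y t) \<bullet> grad V (y t) + \<delta>) (at t)"
      unfolding q_def by (auto intro!: derivative_eq_intros)
    moreover have "F (y t) \<bullet> grad V (y t) + \<delta> \<le> 0" using V_decr[of "y t"] int[OF t] \<delta>[OF t] by force
    ultimately show "\<exists>d. (q has_real_derivative d) (at t) \<and> d \<le> 0" by blast
  qed (rule ab)
  then show ?thesis by (simp add: q_def algebra_simps)
qed

text \<open>A global solution of the extended field \<open>G\<close> is taken. As long as it is in
  \<open>A\<close> it also solves the original equation, so \<open>V\<close> does not increase along
  it and the barrier keeps it in \<open>A\<close> forever.\<close>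

lemma solution_exists:
  assumes x: "x \<in> A"
  shows "\<exists>y. solves F A x {0..} y"
proof -
  have ne: "closure A \<noteq> {}" using x by auto
  obtain G L M where G: "L-lipschitz_on UNIV G" "\<forall>x. norm (G x) \<le> M" "\<forall>x\<in>closure A. G x = F x"
    using lipschitz_extension_compact[OF F_lip open_\<Omega> compact_closure_A A_sub ne] by blast
  obtain y where y0: "y 0 = x" and y: "\<And>t. t \<ge> 0 \<Longrightarrow> (y has_vector_derivative G (y t)) (at t within {0..})"
    using global_lipschitz_ode_exists[OF G(1), of M x] G(2) by blast
  have cont: "continuous_on {0..} y"
    unfolding continuous_on_eq_continuous_within using y has_vector_derivative_continuous by fastforce
  have inA: "y t \<in> A" if "t \<ge> 0" for t
  proof (rule stays_in_sublevel_set[OF open_A V_cont V_frontier])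
    show "continuous_on {0..t} y" by (rule continuous_on_subset[OF cont]) auto
    show "y 0 \<in> A" "V (y 0) < c" using x y0 V_less by auto
    show "t \<in> {0..t}" using that by simp
    fix \<tau> assume \<tau>: "0 < \<tau>" "\<tau> \<le> t" and before: "\<And>s. 0 \<le> s \<Longrightarrow> s < \<tau> \<Longrightarrow> y s \<in> A" and cl: "y \<tau> \<in> closure A"
    have "V (y \<tau>) \<le> V (y 0) - 0 * (\<tau> - 0)"
    proof (rule V_decreasing)
      show "continuous_on {0..\<tau>} y" by (rule continuous_on_subset[OF cont]) auto
      show "y s \<in> closure A" if "s \<in> {0..\<tau>}" for s
        using before[of s] cl that closure_subset[of A] by (cases "s = \<tau>") auto
      fix s assume s: "0 < s" "s < \<tau>"
      have "(y has_vector_derivative G (y s)) (at s)"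
        using y[of s] s at_within_interior[of s "{0..}"] by simp
      then show "y s \<in> A \<and> (y has_vector_derivative F (y s)) (at s)"
        using before[of s] s G(3) closure_subset[of A] by auto
    qed (use \<tau> h_nonneg in auto)
    then show "V (y \<tau>) \<le> V (y 0)" by simp
  qed
  have "solves F A x {0..} y"
    unfolding solves_def
  proof (intro conjI ballI)
    fix t :: real assume t: "t \<in> {0..}"
    then show "y t \<in> A" using inA by simp
    then have "G (y t) = F (y t)" using G(3) closure_subset[of A] by auto
    then show "(y has_vector_derivative F (y t)) (at t within {0..})" using y[of t] t by simp
  qed (rule y0)
  then show ?thesis by blast
qed

lemma uniquely_solvable_sublevel:
  assumes x: "x \<in> A"
  shows "uniquely_solvable F A x"
proof -
  obtain y where y: "solves F A x {0..} y" using solution_exists[OF x] by blast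
  obtain L where "L-lipschitz_on (closure A) F"
    using locally_lipschitz_on_compact[OF F_lip compact_closure_A A_sub] by blast
  then have L: "L-lipschitz_on A F" by (rule lipschitz_on_subset) (rule closure_subset)
  have "\<psi> t = y t" if "solves F A x {0..T} \<psi>" "t \<in> {0..T}" for T \<psi> t
    by (rule solves_unique_lipschitz[OF L that(1) _ that(2)]) (rule solves_subinterval[OF y], auto)
  then show ?thesis unfolding uniquely_solvable_def using y by blast
qed

lemma V_solution_decreasing:
  assumes y: "solves F A x {0..} y" and ab: "0 \<le> a" "a \<le> b"
    and \<delta>: "\<And>t. a < t \<Longrightarrow> t < b \<Longrightarrow> \<delta> \<le> h (y t)"
  shows "V (y b) \<le> V (y a) - \<delta> * (b - a)"
proof (rule V_decreasing[OF ab(2)])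
  show "continuous_on {a..b} y" using ab by (intro continuous_on_subset[OF solves_continuous_on[OF y]]) auto
  show "y t \<in> closure A" if "t \<in> {a..b}" for t
    using y that ab closure_subset[of A] unfolding solves_def by fastforce
  show "y t \<in> A \<and> (y has_vector_derivative F (y t)) (at t)" if "a < t" "t < b" for t
  proof -
    have t: "t \<in> {0..}" "at t within {0..} = at t" using that ab at_within_interior[of t "{0..}"] by simp_all
    have "y t \<in> A \<and> (y has_vector_derivative F (y t)) (at t within {0..})"
      using y t(1) unfolding solves_def by blast
    then show ?thesis unfolding t(2) .
  qed
qed (rule \<delta>)

text \<open>If \<open>V\<close> stayed above some \<eta> > 0, the curve would remain in a compact
  set away from 0, where \<open>h\<close> has a positive minimum, and \<open>V\<close> would fall
  linearly. So \<open>V\<close> gets below every \<eta> and stays there; and outside a ball around 0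
  \<open>V\<close> is bounded below by a positive number.\<close>

lemma solution_tendsto_0:
  assumes y: "solves F A x {0..} y"
  shows "(y \<longlongrightarrow> 0) at_top"
proof -
  have yA: "y t \<in> A" if "t \<ge> 0" for t using y that unfolding solves_def by simp
  have ycl: "y t \<in> closure A" if "t \<ge> 0" for t using yA[OF that] closure_subset[of A] by auto
  have small: "\<exists>t\<ge>0. V (y t) < \<eta>" if \<eta>: "\<eta> > 0" for \<eta>
  proof (rule ccontr)
    assume "\<not> (\<exists>t\<ge>0. V (y t) < \<eta>)"
    then have big: "\<eta> \<le> V (y t)" if "t \<ge> 0" for t using that by force
    define Z where "Z = {x \<in> closure A. V x \<in> {\<eta>..}}"
    have "closed Z" using continuous_closed_preimage[OF V_cont closed_closure closed_atLeast, of \<eta>]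
      by (simp add: Z_def vimage_def Int_def)
    then have "compact Z" using compact_Int_closed[OF compact_closure_A]
      by (metis (no_types, lifting) Int_absorb1 Z_def mem_Collect_eq subsetI)
    moreover have yZ: "y t \<in> Z" if "t \<ge> 0" for t using big[OF that] ycl[OF that] by (simp add: Z_def)
    moreover have "continuous_on Z h" by (rule continuous_on_subset[OF h_cont]) (auto simp: Z_def)
    ultimately obtain z where z: "z \<in> Z" "\<And>w. w \<in> Z \<Longrightarrow> h z \<le> h w"
      using continuous_attains_inf[of Z h] yZ[of 0] by (metis empty_iff order_refl)
    have "z \<noteq> 0" using z(1) \<eta> V_zero by (auto simp: Z_def)
    then have hz: "h z > 0" by (rule h_pos)
    \<comment> \<open>At this time the linear decrease has used up the whole initial value of
      \<open>V\<close>.\<close>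
    define t where "t = V (y 0) / h z"
    have t: "t \<ge> 0" using V_nonneg[OF ycl[of 0]] hz by (simp add: t_def)
    have "V (y t) \<le> V (y 0) - h z * (t - 0)"
      by (rule V_solution_decreasing[OF y order_refl t]) (use z(2) yZ in simp)
    also have "\<dots> = 0" using hz by (simp add: t_def)
    finally show False using big[OF t] \<eta> by simp
  qed
  show ?thesis
  proof (rule tendstoI)
    fix e :: real assume e: "e > 0"
    define Z where "Z = closure A - ball 0 e"
    have Z: "compact Z" unfolding Z_def by (intro compact_diff compact_closure_A open_ball)
    have "\<exists>\<eta>>0. \<forall>z\<in>Z. \<eta> \<le> V z"
    proof (cases "Z = {}")
      case False
      have "continuous_on Z V" by (rule continuous_on_subset[OF V_cont]) (auto simp: Z_def)
      then obtain z where z: "z \<in> Z" "\<forall>w\<in>Z. V z \<le> V w" using continuous_attains_inf[OF Z False] by blast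
      then have "V z > 0" using e by (intro V_pos) (auto simp: Z_def)
      then show ?thesis using z by blast
    qed (auto intro: exI[of _ 1])
    then obtain \<eta> where \<eta>: "\<eta> > 0" "\<forall>z\<in>Z. \<eta> \<le> V z" by blast
    obtain t0 where t0: "t0 \<ge> 0" "V (y t0) < \<eta>" using small[OF \<eta>(1)] by blast
    have "dist (y t) 0 < e" if t: "t \<ge> t0" for t
    proof -
      have "V (y t) \<le> V (y t0) - 0 * (t - t0)"
        by (rule V_solution_decreasing[OF y t0(1) t]) (rule h_nonneg)
      then have "V (y t) < \<eta>" using t0 by simp
      then have "y t \<notin> Z" using \<eta>(2) by force
      then show ?thesis using ycl[of t] t t0 by (simp add: Z_def)
    qed
    then show "\<forall>\<^sub>F t in at_top. dist (y t) 0 < e" unfolding eventually_at_top_linorder by blast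
  qed
qed

end

text \<open>As long as the curve is in the ball, W(y(t)) exp(\<gamma> t / c2) is nonincreasing, and
  comparing \<open>W\<close> with the squared norm gives the decay, with half the rate after the
  square root. The decay in turn confines the curve; the smallness of \<open>x\<close> makes both
  |x| and sqrt(c2/c1) |x| less than r/2.\<close>

lemma local_quadratic_lyapunov:
  fixes F :: "'a::euclidean_space \<Rightarrow> 'a" and y :: "real \<Rightarrow> 'a"
  assumes c: "0 < c1" "0 < c2" "0 < \<gamma>"
    and W: "\<And>x. x \<in> ball 0 r \<Longrightarrow> c1 * (norm x)\<^sup>2 \<le> W x" "\<And>x. x \<in> ball 0 r \<Longrightarrow> W x \<le> c2 * (norm x)\<^sup>2"
    and D: "\<And>x. x \<in> ball 0 r \<Longrightarrow> GDERIV W x :> D x" "\<And>x. x \<in> ball 0 r \<Longrightarrow> F x \<bullet> D x \<le> - \<gamma> * (norm x)\<^sup>2"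
    and y: "solves F A x {0..} y" and x: "(2 * sqrt (c2 / c1) + 2) * norm x < r" and t: "0 \<le> t"
  shows "norm (y t) \<le> sqrt (c2 / c1) * exp (- (\<gamma> / (2 * c2)) * t) * norm x"
proof -
  let ?k = "\<gamma> / c2" and ?s = "sqrt (c2 / c1)"
  have y0: "y 0 = x" and der: "\<And>t. t \<ge> 0 \<Longrightarrow> (y has_vector_derivative F (y t)) (at t within {0..})"
    using y unfolding solves_def by auto
  have cont: "continuous_on {0..} y" by (rule solves_continuous_on[OF y])
  have s0: "0 \<le> ?s" using c by simp
  have "0 \<le> (2 * ?s + 2) * norm x" using s0 by simp
  then have r: "r > 0" using x by linarith
  have xr: "norm x < r / 2" "?s * norm x < r / 2"
  proof -
    have "2 * (?s * norm x) + 2 * norm x < r" using x by (simp add: distrib_right)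
    then show "norm x < r / 2" "?s * norm x < r / 2"
      using mult_nonneg_nonneg[OF s0 norm_ge_zero[of x]] norm_ge_zero[of x] by linarith+
  qed
  have decay: "norm (y t) \<le> ?s * exp (- (\<gamma> / (2 * c2)) * t) * norm x"
    if t: "0 \<le> t" and inb: "\<And>s. 0 \<le> s \<Longrightarrow> s \<le> t \<Longrightarrow> y s \<in> ball 0 r" for t
  proof -
    define q where "q t = exp (?k * t) * W (y t)" for t
    have dW: "((\<lambda>t. W (y t)) has_real_derivative F (y s) \<bullet> D (y s)) (at s within {0..t})" if "s \<in> {0..t}" for s
      using that by (intro GDERIV_chain D inb has_vector_derivative_within_subset[OF der]) auto
    have "q t \<le> q 0"
    proof (rule DERIV_nonpos_imp_decreasing_open[where f = q and a = 0 and b = t])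
      have "continuous_on {0..t} (\<lambda>t. W (y t))"
        unfolding continuous_on_eq_continuous_within using dW DERIV_continuous by blast
      then show "continuous_on {0..t} q" unfolding q_def by (intro continuous_intros)
      fix s assume s: "0 < s" "s < t"
      then have ys: "y s \<in> ball 0 r" using inb by simp
      have "((\<lambda>t. W (y t)) has_real_derivative F (y s) \<bullet> D (y s)) (at s)"
        using dW[of s] s by (simp add: at_within_Icc_at)
      then have "(q has_real_derivative (exp (?k * s) * (?k * W (y s) + F (y s) \<bullet> D (y s)))) (at s)"
        unfolding q_def using c(2) by (auto intro!: derivative_eq_intros simp: algebra_simps)
      moreover have "exp (?k * s) * (?k * W (y s) + F (y s) \<bullet> D (y s)) \<le> 0"
      proof (rule mult_nonneg_nonpos)
        have "?k * W (y s) \<le> ?k * (c2 * (norm (y s))\<^sup>2)" using c by (intro mult_left_mono W(2)[OF ys]) auto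
        then show "?k * W (y s) + F (y s) \<bullet> D (y s) \<le> 0" using D(2)[OF ys] c by simp
      qed simp
      ultimately show "\<exists>d. (q has_real_derivative d) (at s) \<and> d \<le> 0" by blast
    qed (rule t)
    then have "exp (?k * t) * W (y t) \<le> W x" by (simp add: q_def y0)
    also have "\<dots> \<le> c2 * (norm x)\<^sup>2" using inb[of 0] t y0 by (intro W(2)) auto
    finally have 1: "exp (?k * t) * W (y t) \<le> c2 * (norm x)\<^sup>2" .
    have "exp (?k * t) * (c1 * (norm (y t))\<^sup>2) \<le> exp (?k * t) * W (y t)"
      using inb[of t] t by (intro mult_left_mono W(1)) auto
    also note 1
    also have "exp (?k * t) * (c1 * (norm (y t))\<^sup>2) = c1 * (exp (?k * t) * (norm (y t))\<^sup>2)"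
      by (rule mult.left_commute)
    finally have "c1 * (exp (?k * t) * (norm (y t))\<^sup>2) \<le> c2 * (norm x)\<^sup>2" .
    then have "exp (?k * t) * (norm (y t))\<^sup>2 \<le> c2 * (norm x)\<^sup>2 / c1" using c by (simp add: pos_le_divide_eq mult.commute)
    then have "exp (- ?k * t) * (exp (?k * t) * (norm (y t))\<^sup>2) \<le> exp (- ?k * t) * (c2 * (norm x)\<^sup>2 / c1)"
      by (rule mult_left_mono) simp
    then have 2: "(norm (y t))\<^sup>2 \<le> exp (- ?k * t) * (c2 * (norm x)\<^sup>2 / c1)"
      by (simp add: exp_minus mult.assoc[symmetric])
    have "(exp (- (\<gamma> / (2 * c2)) * t))\<^sup>2 = exp (- ?k * t)"
      by (simp add: power2_eq_square mult_exp_exp)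
    then have "(?s * exp (- (\<gamma> / (2 * c2)) * t) * norm x)\<^sup>2 = (c2 / c1) * exp (- ?k * t) * (norm x)\<^sup>2"
      using c by (simp only: power_mult_distrib) simp
    with 2 have "(norm (y t))\<^sup>2 \<le> (?s * exp (- (\<gamma> / (2 * c2)) * t) * norm x)\<^sup>2" by (simp add: mult_ac)
    then show ?thesis by (rule power2_le_imp_le) (use s0 in simp)
  qed
  have small: "norm (y s) < r / 2" if s: "s \<in> {0..t}" for s
  proof (rule continuous_bootstrap_less[where d = "\<lambda>t. norm (y t)", OF _ _ s])
    show "continuous_on {0..t} (\<lambda>t. norm (y t))"
      by (intro continuous_intros continuous_on_subset[OF cont]) auto
    fix \<tau> assume \<tau>: "\<tau> \<in> {0..t}" and before: "\<And>s. 0 \<le> s \<Longrightarrow> s < \<tau> \<Longrightarrow> norm (y s) < r / 2"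
    show "norm (y \<tau>) < r / 2"
    proof (cases "\<tau> = 0")
      case False
      then have \<tau>0: "0 < \<tau>" using \<tau> by simp
      \<comment> \<open>The bound r/2 holds before \<tau> and weakly at \<tau> by continuity. As r/2
        < r, the decay estimate is available up to and including \<tau> and restores the strict
        inequality.\<close>
      have "y ` {0..<\<tau>} \<subseteq> cball 0 (r / 2)" using before by (fastforce intro: less_imp_le)
      then have "y ` closure {0..<\<tau>} \<subseteq> cball 0 (r / 2)"
        by (intro image_closure_subset continuous_on_subset[OF cont]) (use \<tau>0 in auto)
      then have cl: "norm (y s) \<le> r / 2" if "s \<in> {0..\<tau>}" for s
      proof -
        have "closure {0..<\<tau>} = {0..\<tau>}" using \<tau>0 by simp
        then have "y s \<in> cball 0 (r / 2)"
          using that \<open>y ` closure {0..<\<tau>} \<subseteq> cball 0 (r / 2)\<close> by blast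
        then show ?thesis by simp
      qed
      have "norm (y \<tau>) \<le> ?s * exp (- (\<gamma> / (2 * c2)) * \<tau>) * norm x"
        using \<tau> cl r by (intro decay) force+
      also have "\<dots> \<le> ?s * 1 * norm x"
        using c \<tau> s0 by (intro mult_right_mono mult_left_mono) auto
      finally show ?thesis using xr by simp
    qed (use xr y0 in simp)
  qed
  show ?thesis using small r t by (intro decay) force+
qed

section \<open>Policy improvement\<close>

lemma locally_C11_imp_locally_lipschitz:
  assumes "locally_C11 S f" shows "locally_lipschitz_on S f"
  unfolding locally_lipschitz_on_def
proof
  fix x assume "x \<in> S"
  then obtain r L where "r > 0" "C11_bound L (ball x r) f" using locally_C11_obtain[OF assms] by metis
  then show "\<exists>r>0. \<exists>L. L-lipschitz_on (ball x r) f"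
    by (intro exI[of _ r] conjI exI[of _ L] lipschitz_onI)
       (auto simp: dist_norm C11_bound_lipschitz C11_bound_nonneg)
qed

lemma locally_C11_imp_grad_locally_lipschitz:
  fixes f :: "'a::euclidean_space \<Rightarrow> real"
  assumes "locally_C11 S f" shows "locally_lipschitz_on S (grad f)"
  unfolding locally_lipschitz_on_def using locally_C11_grad[OF assms] by meson

lemma smooth_on_imp_locally_C11:
  fixes f :: "'a::euclidean_space \<Rightarrow> 'b::real_normed_vector"
  shows "smooth_on S f \<Longrightarrow> open S \<Longrightarrow> locally_C11 S f"
  unfolding smooth_on_def by (blast intro: Ck_2_locally_C11)

section \<open>Matrix products and positive-definite matrices\<close>

lemma bounded_bilinear_matrix_vector: "bounded_bilinear (\<lambda>(A::real^'m^'n) x. A *v x)"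
  unfolding bilinear_conv_bounded_bilinear[symmetric] bilinear_def
  by (auto intro!: linearI simp: matrix_vector_mult_add_rdistrib matrix_vector_right_distrib
      matrix_vector_mult_scaleR scaleR_matrix_vector_assoc)

lemma bounded_bilinear_transpose_matrix_vector: "bounded_bilinear (\<lambda>(A::real^'m^'n) x. transpose A *v x)"
  unfolding bilinear_conv_bounded_bilinear[symmetric] bilinear_def
  by (auto intro!: linearI simp del: transpose_matrix_vector simp: matrix_vector_mult_add_rdistrib
      matrix_vector_right_distrib matrix_vector_mult_scaleR scaleR_matrix_vector_assoc transpose_def vec_eq_iff
      matrix_vector_mult_def sum.distrib distrib_right distrib_left sum_distrib_left mult_ac)

lemma inner_matrix_transpose:
  fixes G :: "real^'m^'n"
  shows "(G *v w) \<bullet> D = w \<bullet> (transpose G *v D)"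
  using dot_lmul_matrix[of D G w] by (simp add: inner_commute)

text \<open>The constant is the minimum of the quadratic form on the unit sphere; homogeneity does
  the rest.\<close>

lemma sym_pos_def_matrix_coercive:
  fixes R :: "real^'m^'m"
  assumes "sym_pos_def_matrix R"
  shows "\<exists>r>0. \<forall>w. r * (norm w)\<^sup>2 \<le> w \<bullet> (R *v w)"
proof -
  have pos: "w \<noteq> 0 \<Longrightarrow> 0 < w \<bullet> (R *v w)" for w
    using assms unfolding sym_pos_def_matrix_def by blast
  have cont: "continuous_on (sphere 0 1) (\<lambda>w. w \<bullet> (R *v w))"
    by (intro continuous_intros linear_continuous_on) auto
  have "sphere (0::real^'m) 1 \<noteq> {}" using vector_choose_size[of 1] by (auto simp: sphere_def dist_norm)
  from continuous_attains_inf[OF compact_sphere this cont]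
  obtain z :: "real^'m" where z: "z \<in> sphere 0 1" "\<forall>w\<in>sphere 0 1. z \<bullet> (R *v z) \<le> w \<bullet> (R *v w)"
    by blast
  have "z \<noteq> 0" using z(1) by auto
  have "z \<bullet> (R *v z) * (norm w)\<^sup>2 \<le> w \<bullet> (R *v w)" for w
  proof (cases "w = 0")
    case False
    have "z \<bullet> (R *v z) \<le> sgn w \<bullet> (R *v sgn w)" using z(2) False by (simp add: norm_sgn)
    then have "z \<bullet> (R *v z) * (norm w)\<^sup>2 \<le> sgn w \<bullet> (R *v sgn w) * (norm w)\<^sup>2" by (intro mult_right_mono) auto
    also have "\<dots> = (norm w *\<^sub>R sgn w) \<bullet> (R *v (norm w *\<^sub>R sgn w))"
      by (simp only: matrix_vector_mult_scaleR inner_scaleR_left inner_scaleR_right power2_eq_square mult_ac)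
    also have "norm w *\<^sub>R sgn w = w" using False by (simp add: sgn_div_norm)
    finally show ?thesis .
  qed simp
  then show ?thesis using pos[OF \<open>z \<noteq> 0\<close>] by blast
qed

lemma sym_pos_def_matrix_inverse:
  fixes R :: "real^'m^'m"
  assumes "sym_pos_def_matrix R"
  shows "R *v (matrix_inv R *v w) = w"
proof -
  have "x = 0" if "R *v x = 0" for x
    using assms that unfolding sym_pos_def_matrix_def by force
  then have "\<exists>B. B ** R = mat 1" unfolding matrix_left_invertible_ker by blast
  then have "invertible R" using invertible_left_inverse by blast
  then have "R ** matrix_inv R = mat 1"
    unfolding invertible_def matrix_inv_def by (metis (mono_tags, lifting) someI_ex)
  then show ?thesis by (simp add: matrix_vector_mul_assoc)
qed

lemma sym_pos_def_matrix_symmetric: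
  fixes R :: "real^'m^'m"
  assumes "sym_pos_def_matrix R"
  shows "a \<bullet> (R *v b) = b \<bullet> (R *v a)"
proof -
  have T: "transpose R = R" using assms unfolding sym_pos_def_matrix_def by blast
  have "(R *v a) \<bullet> b = a \<bullet> (R *v b)" using inner_matrix_transpose[of R a b] unfolding T .
  then show ?thesis by (simp only: inner_commute[of b])
qed

text \<open>The level \<open>c\<close> is the minimum of \<open>V\<close> on a sphere inside the
  domain. The set where \<open>V\<close> is below \<open>c\<close> in the ball may be disconnected,
  so its component of 0 is taken.\<close>

lemma proper_sublevel_set_exists:
  fixes V :: "'a::euclidean_space \<Rightarrow> real"
  assumes \<Omega>: "open \<Omega>" and V: "continuous_on \<Omega> V" "pos_def_fun_on \<Omega> V"
  shows "\<exists>c S. proper_sublevel_set V \<Omega> c S"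
proof -
  have V0: "0 \<in> \<Omega>" "V 0 = 0" and Vpos: "\<And>x. x \<in> \<Omega> \<Longrightarrow> x \<noteq> 0 \<Longrightarrow> 0 < V x"
    using V(2) unfolding pos_def_fun_on_def by auto
  obtain r where r: "r > 0" "cball 0 r \<subseteq> \<Omega>" using \<Omega> V0(1) open_contains_cball by blast
  have "sphere (0::'a) r \<noteq> {}" using vector_choose_size[of r] r by (auto simp: sphere_def dist_norm)
  moreover have "continuous_on (sphere 0 r) V" by (rule continuous_on_subset[OF V(1)]) (use r in auto)
  ultimately obtain z where z: "z \<in> sphere 0 r" "\<forall>w\<in>sphere 0 r. V z \<le> V w"
    using continuous_attains_inf[OF compact_sphere] by metis
  define c where "c = V z"
  have c: "c > 0" unfolding c_def using z(1) r by (intro Vpos) auto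
  define U where "U = {x \<in> ball 0 r. V x \<in> {..<c}}"
  have contV: "continuous_on (ball 0 r) V" by (rule continuous_on_subset[OF V(1)]) (use r in auto)
  have U: "open U"
    using continuous_open_preimage[OF contV open_ball open_lessThan, of c] by (simp add: U_def vimage_def Int_def)
  define S where "S = connected_component_set U 0"
  have U0: "0 \<in> U" using V0 c r by (simp add: U_def)
  have SU: "S \<subseteq> U" unfolding S_def by (rule connected_component_subset)
  have S0: "0 \<in> S" using U0 by (simp add: S_def)
  have clS: "closure S \<subseteq> cball 0 r" using SU by (intro closure_minimal) (auto simp: U_def)
  have opS: "open S" unfolding S_def by (rule open_connected_component[OF U])
  have dom: "is_domain S" unfolding is_domain_def
    using S0 opS connected_connected_component[of U 0, folded S_def] by blast
  have clV: "V x \<le> c" if "x \<in> closure S" for x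
  proof -
    have "V ` closure S \<subseteq> {..c}"
    proof (rule image_closure_subset)
      show "continuous_on (closure S) V" by (rule continuous_on_subset[OF V(1)]) (use clS r in blast)
      show "V ` S \<subseteq> {..c}" using SU by (auto simp: U_def intro: less_imp_le)
    qed simp
    then show ?thesis using that by auto
  qed
  have fr: "V x = c" if x: "x \<in> frontier S" for x
  proof (rule ccontr)
    assume ne: "V x \<noteq> c"
    have xcl: "x \<in> closure S" and xS: "x \<notin> S" using x opS by (auto simp: frontier_def interior_open)
    then have lt: "V x < c" using clV[OF xcl] ne by simp
    have "x \<notin> sphere 0 r"
    proof
      assume "x \<in> sphere 0 r"
      then have "V z \<le> V x" using z(2) by blast
      then show False using lt by (simp add: c_def)
    qed
    moreover have "x \<in> cball 0 r" using clS xcl by blast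
    ultimately have xU: "x \<in> U" using lt by (simp add: U_def)
    \<comment> \<open>A frontier point with value below \<open>c\<close> is not on the sphere and so
      lies in \<open>U\<close>. Components are closed relative to \<open>U\<close>, which would put
      it into \<open>S\<close>.\<close>
    have "closedin (top_of_set U) S" unfolding S_def by (rule closedin_connected_component)
    then obtain T where T: "closed T" "S = U \<inter> T" unfolding closedin_closed by metis
    have "S \<subseteq> T" using T(2) by simp
    then have "closure S \<subseteq> T" using T(1) by (rule closure_minimal)
    then have "x \<in> U \<inter> T" using xcl xU by blast
    then show False using xS T(2) by simp
  qed
  have "proper_sublevel_set V \<Omega> c S"
    unfolding proper_sublevel_set_def pos_def_fun_on_def
  proof (intro conjI ballI)
    show "bounded S" using SU by (intro bounded_subset[OF bounded_ball[of 0 r]]) (auto simp: U_def)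
    show "closure S \<subseteq> \<Omega>" using clS r by blast
    then show "continuous_on (closure S) V" by (rule continuous_on_subset[OF V(1)])
    show "0 \<in> closure S" using S0 closure_subset by blast
    show "V x < c" if "x \<in> S" for x using SU that by (auto simp: U_def)
    show "0 < V x" if "x \<in> closure S - {0}" for x using that clS r by (intro Vpos) auto
  qed (use c dom V0 fr in auto)
  then show ?thesis by blast
qed

section \<open>Trajectories as a semigroup and restriction to invariant subdomains\<close>

lemma uniquely_solvable_eq:
  assumes "uniquely_solvable F A x" "solves F A x {0..T} \<psi>\<^sub>1" "solves F A x {0..T} \<psi>\<^sub>2" "t \<in> {0..T}"
  shows "\<psi>\<^sub>1 t = \<psi>\<^sub>2 t"
proof -
  have "T \<ge> 0" using assms(4) by simp
  then show ?thesis using assms unfolding uniquely_solvable_def by metis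
qed

lemma trajectory_eq_solution:
  assumes u: "uniquely_solvable F A x" and y: "solves F A x {0..} y" and "t \<ge> 0"
  shows "trajectory F A x t = y t"
  by (rule trajectory_eq[OF y _ assms(3)])
     (rule uniquely_solvable_eq[OF u _ solves_subinterval[OF y]], auto)

lemma trajectory_semigroup:
  assumes u: "\<And>x. x \<in> A \<Longrightarrow> uniquely_solvable F A x" and x: "x \<in> A" and st: "0 \<le> s" "0 \<le> t"
  shows "trajectory F A (trajectory F A x s) t = trajectory F A x (s + t)"
proof (rule trajectory_eq_solution[OF u _ st(2)])
  let ?y = "trajectory F A x"
  have sol: "solves F A x {0..} ?y" by (rule uniquely_solvable_trajectory[OF u[OF x]])
  then have y: "\<And>t. t \<ge> 0 \<Longrightarrow> ?y t \<in> A \<and> (?y has_vector_derivative F (?y t)) (at t within {0..})"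
    unfolding solves_def by simp
  then show "?y s \<in> A" using st(1) by blast
  show "solves F A (?y s) {0..} (\<lambda>t. ?y (s + t))"
    unfolding solves_def
  proof (intro conjI ballI)
    fix t :: real assume t: "t \<in> {0..}"
    then show "?y (s + t) \<in> A" using y[of "s + t"] st(1) by simp
    have "(?y has_vector_derivative F (?y (s + t))) (at (s + t) within (\<lambda>t. s + t) ` {0..})"
      by (rule has_vector_derivative_within_subset[of _ _ _ "{0..}"]) (use y[of "s + t"] t st(1) in auto)
    moreover have "((\<lambda>t. s + t) has_vector_derivative 1) (at t within {0..})"
      by (auto intro!: derivative_eq_intros)
    ultimately have "(?y \<circ> (\<lambda>t. s + t) has_vector_derivative 1 *\<^sub>R F (?y (s + t))) (at t within {0..})"
      by (intro vector_diff_chain_within)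
    then show "((\<lambda>t. ?y (s + t)) has_vector_derivative F (?y (s + t))) (at t within {0..})"
      by (simp add: o_def)
  qed simp
qed

text \<open>Trajectories relative to \<open>A\<close> and to \<open>\<Omega>\<close> are the same
  curves: invariance makes the old trajectory a solution in \<open>A\<close>, and uniqueness
  descends because every solution in \<open>A\<close> is one in \<open>\<Omega>\<close>.\<close>

lemma admissible_subset:
  assumes adm: "admissible f g u \<Omega>" and A: "is_domain A" "A \<subseteq> \<Omega>" "0 \<in> A"
    and inv: "\<And>x t. x \<in> A \<Longrightarrow> t \<ge> 0 \<Longrightarrow> trajectory (closed_loop f g u) \<Omega> x t \<in> A"
  shows "admissible f g u A"
proof -
  let ?F = "closed_loop f g u"
  let ?y = "trajectory ?F \<Omega>"
  have us: "uniquely_solvable ?F \<Omega> x" if "x \<in> A" for x using adm A that unfolding admissible_def by blast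
  have sol: "solves ?F A x {0..} (?y x)" if "x \<in> A" for x
    using uniquely_solvable_trajectory[OF us[OF that]] inv[OF that] unfolding solves_def by simp
  have up: "solves ?F \<Omega> x {0..T} \<psi>" if "solves ?F A x {0..T} \<psi>" for x T \<psi>
    using that A(2) unfolding solves_def by blast
  have usA: "uniquely_solvable ?F A x" if x: "x \<in> A" for x
  proof -
    have "\<psi> t = ?y x t" if "solves ?F A x {0..T} \<psi>" "t \<in> {0..T}" for T \<psi> t
      by (rule uniquely_solvable_eq[OF us[OF x] up[OF that(1)] _ that(2)])
         (rule solves_subinterval[OF uniquely_solvable_trajectory[OF us[OF x]]], auto)
    then show ?thesis unfolding uniquely_solvable_def using sol[OF x] by blast
  qed
  have eq: "trajectory ?F A x t = ?y x t" if "x \<in> A" "t \<ge> 0" for x t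
    by (rule trajectory_eq_solution[OF usA[OF that(1)] sol[OF that(1)] that(2)])
  obtain \<epsilon> C \<nu> where e: "\<epsilon> > 0" "C > 0" "\<nu> > 0"
    and st: "\<And>x t. x \<in> ball 0 \<epsilon> \<Longrightarrow> t \<ge> 0 \<Longrightarrow> norm (?y x t) \<le> C * exp (- \<nu> * t) * norm x"
    using adm unfolding admissible_def by blast
  have "open A" using A(1) by (simp add: is_domain_def)
  then obtain s where s: "s > 0" "ball 0 s \<subseteq> A" using A(3) openE by blast
  show ?thesis
    unfolding admissible_def
  proof (intro conjI ballI)
    show "is_domain A" "0 \<in> A" "u 0 = 0" "continuous_on A u"
      using adm A continuous_on_subset unfolding admissible_def by auto
    fix x assume x: "x \<in> A"
    show "uniquely_solvable ?F A x" by (rule usA[OF x])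
    have lim: "((\<lambda>t. norm (?y x t)) \<longlongrightarrow> 0) at_top" using adm A x unfolding admissible_def by blast
    have ev: "\<forall>\<^sub>F t in at_top. norm (?y x t) = norm (trajectory ?F A x t)"
      using eventually_ge_at_top[of 0] by eventually_elim (simp add: eq[OF x])
    show "((\<lambda>t. norm (trajectory ?F A x t)) \<longlongrightarrow> 0) at_top" by (rule Lim_transform_eventually[OF lim ev])
  next
    have "norm (trajectory ?F A x t) \<le> C * exp (- \<nu> * t) * norm x" if "x \<in> ball 0 (min \<epsilon> s)" "t \<ge> 0" for x t
    proof -
      have "x \<in> A" "x \<in> ball 0 \<epsilon>" using that(1) s by auto
      then show ?thesis using st that(2) by (simp only: eq)
    qed
    moreover have "min \<epsilon> s > 0" "ball 0 (min \<epsilon> s) \<subseteq> A" using e s by auto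
    ultimately show "\<exists>\<epsilon> C \<nu>. \<epsilon> > 0 \<and> C > 0 \<and> \<nu> > 0 \<and> ball 0 \<epsilon> \<subseteq> A \<and>
        (\<forall>x\<in>ball 0 \<epsilon>. \<forall>t\<ge>0. norm (trajectory ?F A x t) \<le> C * exp (- \<nu> * t) * norm x)"
      using e by blast
  qed
qed

theorem theorem3p4:
  fixes f :: "real^'n \<Rightarrow> real^'n"
    and g :: "real^'n \<Rightarrow> real^'m^'n"
    and h :: "real^'n \<Rightarrow> real"
    and R :: "real^'m^'m"
    and \<Omega> :: "(real^'n) set"
    and u :: "real^'n \<Rightarrow> real^'m"
  defines "v \<equiv> cost f g h R u \<Omega>"
  defines "u_plus \<equiv> improved_control g R v"
  assumes "data_assumption f g h R"
    and "is_domain \<Omega>" and "bounded \<Omega>"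
    and "admissible f g u \<Omega>"
    and "smooth_on \<Omega> u"
  shows "(\<exists>c \<Omega>\<^sub>c. proper_sublevel_set v \<Omega> c \<Omega>\<^sub>c)
       \<and> (\<forall>c \<Omega>\<^sub>c. proper_sublevel_set v \<Omega> c \<Omega>\<^sub>c \<longrightarrow> admissible f g u \<Omega>\<^sub>c)
       \<and> (\<forall>c \<Omega>\<^sub>c. proper_sublevel_set v \<Omega> c \<Omega>\<^sub>c \<longrightarrow> admissible f g u_plus \<Omega>\<^sub>c)"
proof -
  have op: "open \<Omega>" using assms(4) by (simp add: is_domain_def)
  have spd: "sym_pos_def_matrix R" and f0: "f 0 = 0" and h0: "h 0 = 0" and hpos: "\<And>x. x \<noteq> 0 \<Longrightarrow> 0 < h x"
    using assms(3) unfolding data_assumption_def pos_def_fun_on_def by auto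
  have fC: "locally_C11 \<Omega> f" and gC: "locally_C11 \<Omega> g" and hC: "locally_C11 \<Omega> h"
    using assms(3) smooth_on_imp_locally_C11[of UNIV] locally_C11_subset[OF _ op subset_UNIV]
    unfolding data_assumption_def by blast+
  have uC: "locally_C11 \<Omega> u" by (rule smooth_on_imp_locally_C11[OF assms(7) op])
  have z\<Omega>: "0 \<in> \<Omega>" and u0: "u 0 = 0" and us: "\<And>x. x \<in> \<Omega> \<Longrightarrow> uniquely_solvable (closed_loop f g u) \<Omega> x"
    using assms(6) unfolding admissible_def by auto
  define F where "F = closed_loop f g u"
  define \<phi> where "\<phi> = trajectory F \<Omega>"
  define l where "l x = h x + u x \<bullet> (R *v u x)" for x
  have gu: "locally_C11 \<Omega> (\<lambda>x. g x *v u x)"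
    by (rule locally_C11_bilinear[OF bounded_bilinear_matrix_vector gC uC])
  have FC: "locally_C11 \<Omega> F" unfolding F_def closed_loop_def[abs_def]
    by (rule locally_C11_add[OF fC gu])
  have "locally_C11 \<Omega> (\<lambda>x. R *v u x)"
    by (rule locally_C11_compose[OF uC locally_C11_bounded_linear[OF matrix_vector_mul_bounded_linear open_UNIV]]) simp
  then have lC: "locally_C11 \<Omega> l"
    unfolding l_def[abs_def] by (intro locally_C11_add[OF hC] locally_C11_bilinear[OF bounded_bilinear_inner uC])
  have idC: "locally_C11 \<Omega> (\<lambda>x. x)" by (rule locally_C11_bounded_linear[OF bounded_linear_ident op])
  have R_nonneg: "0 \<le> w \<bullet> (R *v w)" for w
    using spd unfolding sym_pos_def_matrix_def by (cases "w = 0") (auto intro: less_imp_le)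
  have h_nonneg: "0 \<le> h x" for x using hpos[of x] h0 by (cases "x = 0") auto
  interpret stable_flow F \<Omega> \<phi>
  proof
    show "F 0 = 0" by (simp add: F_def closed_loop_def f0 u0)
    show "solves F \<Omega> x {0..} (\<phi> x)" if "x \<in> \<Omega>" for x
      unfolding \<phi>_def F_def by (rule uniquely_solvable_trajectory[OF us[OF that]])
    show "\<phi> (\<phi> x s) t = \<phi> x (s + t)" if "x \<in> \<Omega>" "0 \<le> s" "0 \<le> t" for x s t
      unfolding \<phi>_def F_def by (rule trajectory_semigroup[OF us that])
    show "(\<phi> x \<longlongrightarrow> 0) at_top" if "x \<in> \<Omega>" for x
      unfolding \<phi>_def F_def
      using assms(6) that unfolding admissible_def by (blast intro: tendsto_norm_zero_cancel)
    show "\<exists>\<epsilon> C \<nu>. \<epsilon> > 0 \<and> C > 0 \<and> \<nu> > 0 \<and> ball 0 \<epsilon> \<subseteq> \<Omega> \<and>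
        (\<forall>x\<in>ball 0 \<epsilon>. \<forall>t\<ge>0. norm (\<phi> x t) \<le> C * exp (- \<nu> * t) * norm x)"
      unfolding \<phi>_def F_def using assms(6) unfolding admissible_def by blast
  qed (fact op z\<Omega> FC)+
  \<comment> \<open>\<open>C.v\<close> is the given cost, \<open>Q.v\<close> the auxiliary cost of
    the squared norm, both along the old flow.\<close>
  interpret C: cost_flow F \<Omega> \<phi> l
    by unfold_locales (use lC h_nonneg R_nonneg in \<open>auto simp: l_def h0 u0\<close>)
  interpret Q: cost_flow F \<Omega> \<phi> "\<lambda>x. x \<bullet> x"
    by unfold_locales (auto intro: locally_C11_bilinear[OF bounded_bilinear_inner idC idC])
  have v: "v = C.v"
    unfolding fun_eq_iff v_def cost_def C.v_def Let_def by (simp add: l_def \<phi>_def F_def)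
  have l_pos: "0 < l x" if "x \<noteq> 0" for x using hpos[OF that] R_nonneg[of "u x"] by (simp add: l_def)
  have pd: "pos_def_fun_on \<Omega> v" unfolding pos_def_fun_on_def v
    using z\<Omega> C.v_zero C.v_pos l_pos by auto

  \<comment> \<open>The old control on a proper sublevel set\<close>
  have u_adm: "admissible f g u A" if ps: "proper_sublevel_set v \<Omega> c A" for c A
  proof (rule admissible_subset[OF assms(6)])
    have A: "is_domain A" "closure A \<subseteq> \<Omega>" "continuous_on (closure A) v" "0 \<in> closure A" "0 < c"
      and Vl: "\<And>x. x \<in> A \<Longrightarrow> v x < c" and Vf: "\<And>x. x \<in> frontier A \<Longrightarrow> v x = c"
      using ps unfolding proper_sublevel_set_def pos_def_fun_on_def by auto
    show "is_domain A" "A \<subseteq> \<Omega>" using A closure_subset by auto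
    have opA: "open A" using A(1) by (simp add: is_domain_def)
    \<comment> \<open>The definition places 0 in the closure only; since \<open>v\<close> is 0 there
      and \<open>c\<close> > 0 on the frontier, 0 is an interior point.\<close>
    have "0 \<notin> frontier A" using Vf[of 0] C.v_zero A(5) by (auto simp: v)
    then show "0 \<in> A" using A(4) opA by (auto simp: frontier_def interior_open)
    fix x and t :: real assume x: "x \<in> A" and t: "t \<ge> 0"
    have x\<Omega>: "x \<in> \<Omega>" using x A(2) closure_subset by blast
    have "\<phi> x t \<in> A"
    proof (rule stays_in_sublevel_set[OF opA A(3) Vf])
      show "continuous_on {0..t} (\<phi> x)" by (rule flow_cont[OF x\<Omega>]) auto
      show "\<phi> x 0 \<in> A" "v (\<phi> x 0) < c" using x Vl flow_0[OF x\<Omega>] by auto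
      show "v (\<phi> x \<tau>) \<le> v (\<phi> x 0)" if "0 < \<tau>" for \<tau>
        using C.v_flow_le[OF x\<Omega>, of \<tau>] that flow_0[OF x\<Omega>] by (simp add: v)
    qed (use t in auto)
    then show "trajectory (closed_loop f g u) \<Omega> x t \<in> A" by (simp add: \<phi>_def F_def)
  qed

  \<comment> \<open>Dissipation inequality and regularity for the improved control\<close>
  define F' where "F' = closed_loop f g u_plus"
  have Ru: "R *v u_plus x = - (1/2) *\<^sub>R (transpose (g x) *v grad v x)" for x
    unfolding u_plus_def improved_control_def matrix_vector_mult_scaleR sym_pos_def_matrix_inverse[OF spd] ..
  have F': "F' x = F x + g x *v (u_plus x - u x)" for x
    by (simp add: F'_def F_def closed_loop_def matrix_vector_mult_diff_distrib)
  text \<open>Complete the square, using that the gradient enters only through \<open>R u_plus\<close>.\<close>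
  have decr: "F' x \<bullet> grad v x = - h x - u_plus x \<bullet> (R *v u_plus x) - (u_plus x - u x) \<bullet> (R *v (u_plus x - u x))"
    if x: "x \<in> \<Omega>" for x
  proof -
    let ?p = "u_plus x" and ?q = "u x"
    have "transpose (g x) *v grad v x = - 2 *\<^sub>R (R *v ?p)" unfolding Ru by simp
    then have "(g x *v (?p - ?q)) \<bullet> grad v x = - 2 * ((?p - ?q) \<bullet> (R *v ?p))"
      unfolding inner_matrix_transpose by simp
    moreover have "F x \<bullet> grad v x = - l x" using C.v_grad_F[OF x] by (simp add: v)
    moreover have "?p \<bullet> (R *v ?q) = ?q \<bullet> (R *v ?p)" by (rule sym_pos_def_matrix_symmetric[OF spd])
    ultimately show ?thesis
      by (simp add: F' inner_add_left l_def matrix_vector_mult_diff_distrib inner_diff_left inner_diff_right)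
  qed
  have up0: "u_plus 0 = 0"
    using C.v_grad_zero by (simp add: u_plus_def improved_control_def v)
  have lip_u: "locally_lipschitz_on \<Omega> u_plus"
  proof -
    have 1: "locally_lipschitz_on \<Omega> (\<lambda>x. transpose (g x) *v grad v x)"
      unfolding v
      by (rule locally_lipschitz_on_bilinear[OF bounded_bilinear_transpose_matrix_vector
          locally_C11_imp_locally_lipschitz[OF gC] locally_C11_imp_grad_locally_lipschitz[OF C.v_locally_C11]])
    show ?thesis unfolding u_plus_def improved_control_def[abs_def]
      by (rule locally_lipschitz_on_bilinear[OF bounded_bilinear_scaleR locally_lipschitz_on_const
          locally_lipschitz_on_bilinear[OF bounded_bilinear_matrix_vector locally_lipschitz_on_const 1]])
  qed
  have lip_F': "locally_lipschitz_on \<Omega> F'"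
    unfolding F'_def closed_loop_def[abs_def]
    by (intro locally_lipschitz_on_add locally_lipschitz_on_bilinear[OF bounded_bilinear_matrix_vector] lip_u
        locally_C11_imp_locally_lipschitz fC gC)

  \<comment> \<open>A quadratic Lyapunov function for the improved system near the origin\<close>
  have lyap: "\<exists>r c1 c2 W. 0 < r \<and> 0 < c1 \<and> 0 < c2 \<and> ball 0 r \<subseteq> \<Omega> \<and>
     (\<forall>x\<in>ball 0 r. c1 * (norm x)\<^sup>2 \<le> W x \<and> W x \<le> c2 * (norm x)\<^sup>2 \<and>
        GDERIV W x :> grad W x \<and> F' x \<bullet> grad W x \<le> - (1/2) * (norm x)\<^sup>2)"
  proof -
    obtain \<rho> where \<rho>: "\<rho> > 0" "\<forall>w. \<rho> * (norm w)\<^sup>2 \<le> w \<bullet> (R *v w)"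
      using sym_pos_def_matrix_coercive[OF spd] by blast
    obtain r1 L1 where r1: "r1 > 0" "L1 \<ge> 0" "ball 0 r1 \<subseteq> \<Omega>"
      "\<forall>x\<in>ball 0 r1. Q.v x \<le> L1 * (norm x)\<^sup>2 \<and> norm (grad Q.v x) \<le> L1 * norm x"
      using Q.v_quadratic_near_0 by blast
    obtain r2 L2 where r2: "r2 > 0" "L2 \<ge> 0" "ball 0 r2 \<subseteq> \<Omega>"
      "\<forall>x\<in>ball 0 r2. C.v x \<le> L2 * (norm x)\<^sup>2 \<and> norm (grad C.v x) \<le> L2 * norm x"
      using C.v_quadratic_near_0 by blast
    obtain r3 c where r3: "r3 > 0" "c > 0" "ball 0 r3 \<subseteq> \<Omega>" "\<forall>x\<in>ball 0 r3. c * (norm x)\<^sup>2 \<le> Q.v x"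
      using Q.v_lower_near_0[OF eq_refl[OF power2_norm_eq_inner]] by blast
    obtain r4 L4 where r4: "r4 > 0" "C11_bound L4 (ball 0 r4) g" using locally_C11_obtain[OF gC z\<Omega>] by metis
    obtain K where K: "K > 0" "\<And>(G::real^'m^'n) w. norm (G *v w) \<le> norm G * norm w * K"
      using bounded_bilinear.pos_bounded[OF bounded_bilinear_matrix_vector] by blast
    define B where "B = (norm (g 0) + L4 * r4) * K"
    have B: "norm (g x *v w) \<le> B * norm w" if "x \<in> ball 0 r4" for x w
    proof -
      have "norm (g x *v w) \<le> norm (g x) * norm w * K" by (rule K(2))
      also have "\<dots> \<le> (norm (g 0) + L4 * r4) * norm w * K"
        using K(1) by (intro mult_right_mono C11_bound_ball_bounded[OF r4(2) that]) auto
      finally show ?thesis by (simp add: B_def mult_ac)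
    qed
    \<comment> \<open>Chosen so that \<kappa> \<rho> |d|^2, the decrease that \<kappa> v gains from
      d = u_plus - u, equals the term (B L1 |d|)^2 / 2 that Young's inequality produces from the
      cross term.\<close>
    define \<kappa> where "\<kappa> = (B * L1)\<^sup>2 / (2 * \<rho>)"
    have \<kappa>: "\<kappa> \<ge> 0" "\<kappa> * \<rho> = (B * L1)\<^sup>2 / 2" using \<rho>(1) by (simp_all add: \<kappa>_def)
    define W where "W x = Q.v x + \<kappa> * C.v x" for x
    define r where "r = min (min r1 r2) (min r3 r4)"
    have r: "r > 0" "ball 0 r \<subseteq> \<Omega>" using r1 r2 r3 r4 by (auto simp: r_def)
    have main: "c * (norm x)\<^sup>2 \<le> W x \<and> W x \<le> (L1 + \<kappa> * L2 + 1) * (norm x)\<^sup>2 \<and>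
        GDERIV W x :> grad W x \<and> F' x \<bullet> grad W x \<le> - (1/2) * (norm x)\<^sup>2" if x: "x \<in> ball 0 r" for x
    proof (intro conjI)
      have xs: "x \<in> ball 0 r1" "x \<in> ball 0 r2" "x \<in> ball 0 r3" "x \<in> ball 0 r4" "x \<in> \<Omega>"
        using x r(2) by (auto simp: r_def)
      have "0 \<le> \<kappa> * C.v x" using \<kappa>(1) C.v_nonneg[OF xs(5)] by simp
      then show "c * (norm x)\<^sup>2 \<le> W x" using r3(4) xs(3) unfolding W_def by force
      have "\<kappa> * C.v x \<le> \<kappa> * (L2 * (norm x)\<^sup>2)" using r2(4) xs(2) \<kappa>(1) by (intro mult_left_mono) auto
      moreover have "Q.v x \<le> L1 * (norm x)\<^sup>2" using r1(4) xs(1) by blast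
      moreover have "(L1 + \<kappa> * L2 + 1) * (norm x)\<^sup>2 = L1 * (norm x)\<^sup>2 + \<kappa> * (L2 * (norm x)\<^sup>2) + (norm x)\<^sup>2"
        by (simp add: algebra_simps)
      ultimately show "W x \<le> (L1 + \<kappa> * L2 + 1) * (norm x)\<^sup>2"
        unfolding W_def using zero_le_power2[of "norm x"] by linarith
      have dW: "GDERIV W x :> grad Q.v x + \<kappa> *\<^sub>R grad C.v x"
      proof -
        have "((\<lambda>x. Q.v x + \<kappa> * C.v x) has_derivative (\<lambda>k. k \<bullet> grad Q.v x + \<kappa> * (k \<bullet> grad C.v x))) (at x)"
          using Q.v_GDERIV[OF xs(5)] C.v_GDERIV[OF xs(5)] unfolding gderiv_def
          by (intro has_derivative_add has_derivative_mult_right)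
        then show ?thesis unfolding gderiv_def W_def[abs_def] by (simp add: inner_add_right)
      qed
      then have gW: "grad W x = grad Q.v x + \<kappa> *\<^sub>R grad C.v x" by (rule GDERIV_grad)
      then show "GDERIV W x :> grad W x" using dW by simp
      let ?d = "u_plus x - u x" and ?n = "norm x"
      have "(g x *v ?d) \<bullet> grad Q.v x \<le> norm (g x *v ?d) * norm (grad Q.v x)" by (rule norm_cauchy_schwarz)
      also have "\<dots> \<le> (B * norm ?d) * (L1 * ?n)"
        using r1(4) xs B[OF xs(4), of ?d] by (intro mult_mono) (auto intro: order_trans[OF norm_ge_zero])
      also have "\<dots> = (B * L1 * norm ?d) * ?n" by (simp add: mult_ac)
      \<comment> \<open>Young's inequality: the part |x|^2 / 2 uses half of the decay rate of
        \<open>Q.v\<close>.\<close>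
      also have "\<dots> \<le> 1/2 * (B * L1 * norm ?d)\<^sup>2 + 1/2 * ?n\<^sup>2"
        using zero_le_power2[of "B * L1 * norm ?d - ?n"] by (simp add: power2_diff)
      finally have 1: "(g x *v ?d) \<bullet> grad Q.v x \<le> 1/2 * (B * L1 * norm ?d)\<^sup>2 + 1/2 * ?n\<^sup>2" .
      have 2: "F x \<bullet> grad Q.v x = - (?n\<^sup>2)" using Q.v_grad_F[OF xs(5)] by (simp add: power2_norm_eq_inner)
      have "F' x \<bullet> grad C.v x \<le> - (\<rho> * (norm ?d)\<^sup>2)"
        using decr[OF xs(5)] h_nonneg[of x] R_nonneg[of "u_plus x"] \<rho>(2)[rule_format, of ?d] unfolding v by linarith
      then have "\<kappa> * (F' x \<bullet> grad C.v x) \<le> \<kappa> * (- (\<rho> * (norm ?d)\<^sup>2))" using \<kappa>(1) by (rule mult_left_mono)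
      also have "\<dots> = - (\<kappa> * \<rho> * (norm ?d)\<^sup>2)" by simp
      also have "\<dots> = - (1/2 * (B * L1 * norm ?d)\<^sup>2)" unfolding \<kappa>(2) by (simp add: power_mult_distrib)
      finally have 3: "\<kappa> * (F' x \<bullet> grad C.v x) \<le> - (1/2 * (B * L1 * norm ?d)\<^sup>2)" .
      have "F' x \<bullet> grad W x = F x \<bullet> grad Q.v x + (g x *v ?d) \<bullet> grad Q.v x + \<kappa> * (F' x \<bullet> grad C.v x)"
        unfolding gW inner_add_right inner_scaleR_right by (simp add: F' inner_add_left)
      then show "F' x \<bullet> grad W x \<le> - (1/2) * ?n\<^sup>2" using 1 2 3 by linarith
    qed
    have "0 < L1 + \<kappa> * L2 + 1" using r1(2) r2(2) \<kappa>(1) by (simp add: add_nonneg_pos)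
    then show ?thesis using main r r3(2) by blast
  qed

  \<comment> \<open>The improved control on a proper sublevel set\<close>
  have up_adm: "admissible f g u_plus A" if ps: "proper_sublevel_set v \<Omega> c A" for c A
  proof -
    have A: "is_domain A" "bounded A" "closure A \<subseteq> \<Omega>" "continuous_on (closure A) v" "0 < c"
      "pos_def_fun_on (closure A) v"
      and Vl: "\<And>x. x \<in> A \<Longrightarrow> v x < c" and Vf: "\<And>x. x \<in> frontier A \<Longrightarrow> v x = c"
      using ps unfolding proper_sublevel_set_def by auto
    have opA: "open A" using A(1) by (simp add: is_domain_def)
    have A\<Omega>: "A \<subseteq> \<Omega>" using A(3) closure_subset by blast
    have "0 \<notin> frontier A" using Vf[of 0] C.v_zero A(5) by (auto simp: v)
    then have A0: "0 \<in> A" using A(6) opA by (auto simp: pos_def_fun_on_def frontier_def interior_open)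
    interpret L: lyapunov_sublevel F' \<Omega> A v h c
    proof
      show "0 < v x" if "x \<in> closure A" "x \<noteq> 0" for x using A(6) that unfolding pos_def_fun_on_def by blast
      show "v 0 = 0" using C.v_zero by (simp add: v)
      show "GDERIV v x :> grad v x" if "x \<in> A" for x using C.v_GDERIV[of x] that A\<Omega> by (auto simp: v)
      show "continuous_on (closure A) h" by (rule continuous_on_subset[OF locally_C11_continuous_on[OF hC] A(3)])
      show "F' x \<bullet> grad v x \<le> - h x" if "x \<in> A" for x
        using decr[of x] that A\<Omega> R_nonneg[of "u_plus x"] R_nonneg[of "u_plus x - u x"] by auto
    qed (use op opA A lip_F' Vl Vf h0 hpos in auto)
    have usA: "uniquely_solvable F' A x" if "x \<in> A" for x by (rule L.uniquely_solvable_sublevel[OF that])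
    obtain r c1 c2 W where W: "0 < r" "0 < c1" "0 < c2"
      and W': "\<forall>x\<in>ball 0 r. c1 * (norm x)\<^sup>2 \<le> W x \<and> W x \<le> c2 * (norm x)\<^sup>2 \<and>
        GDERIV W x :> grad W x \<and> F' x \<bullet> grad W x \<le> - (1/2) * (norm x)\<^sup>2"
      using lyap by blast
    obtain s where s: "s > 0" "ball 0 s \<subseteq> A" using opA A0 openE by blast
    let ?K = "2 * sqrt (c2 / c1) + 2"
    have K: "?K > 0" using W by (simp add: add_nonneg_pos)
    \<comment> \<open>Radius \<open>s\<close> keeps initial points in \<open>A\<close>; r /
      \<open>?K\<close> is the smallness under which the local Lyapunov estimate confines
      trajectories to the ball of radius \<open>r\<close>.\<close>
    define e where "e = min s (r / ?K)"
    have e: "e > 0" "e \<le> s" "e \<le> r / ?K" using s W K by (auto simp: e_def)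
    have exp: "norm (trajectory F' A x t) \<le> sqrt (c2 / c1) * exp (- ((1/2) / (2 * c2)) * t) * norm x"
      if x: "x \<in> ball 0 e" and t: "t \<ge> 0" for x t
    proof (rule local_quadratic_lyapunov[where W = W and D = "grad W" and r = r, OF W(2,3)])
      have "x \<in> A" using x e s by auto
      then show "solves F' A x {0..} (trajectory F' A x)" by (intro uniquely_solvable_trajectory usA)
      have "norm x < r / ?K" using x e(3) by simp
      then show "?K * norm x < r" using K by (simp add: pos_less_divide_eq mult.commute)
    qed (use W' t in auto)
    show ?thesis
      unfolding admissible_def F'_def[symmetric]
    proof (intro conjI ballI)
      show "continuous_on A u_plus"
        by (rule continuous_on_subset[OF locally_lipschitz_on_imp_continuous[OF lip_u] A\<Omega>])
      fix x assume x: "x \<in> A"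
      show "uniquely_solvable F' A x" by (rule usA[OF x])
      show "((\<lambda>t. norm (trajectory F' A x t)) \<longlongrightarrow> 0) at_top"
        by (intro tendsto_norm_zero L.solution_tendsto_0[OF uniquely_solvable_trajectory[OF usA[OF x]]])
    next
      have "ball 0 e \<subseteq> A" using e s by auto
      moreover have "sqrt (c2 / c1) > 0" "(1/2) / (2 * c2) > 0" using W by auto
      ultimately show "\<exists>\<epsilon> C \<nu>. \<epsilon> > 0 \<and> C > 0 \<and> \<nu> > 0 \<and> ball 0 \<epsilon> \<subseteq> A \<and>
        (\<forall>x\<in>ball 0 \<epsilon>. \<forall>t\<ge>0. norm (trajectory F' A x t) \<le> C * exp (- \<nu> * t) * norm x)"
        using e(1) exp by blast
    qed (use A A0 up0 in auto)
  qed
  have "continuous_on \<Omega> v" unfolding v by (rule C.v_continuous_on)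
  then show ?thesis using proper_sublevel_set_exists[OF op _ pd] u_adm up_adm by blast
qed

end
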